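(* Let $\mathcal{X} \in \mathbb{R}^{m \times ps}$ satisfy $O(\varepsilon)\,\kappa^2(\mathcal{X}) \le \frac12$, and let $\bar{\mathcal{Q}} \in \mathbb{R}^{m\times ps}$ and $\bar{\mathcal{R}} \in \mathbb{R}^{ps \times ps}$ be computed by the algorithm BCGS-PIP+ applied to $(\mathcal{X}, \mathrm{IO})$ in floating-point arithmetic with unit roundoff $\varepsilon$. Assume that for all $X \in \mathbb{R}^{m \times s}$ with $\kappa(X) \le \kappa(\mathcal{X})$, the computed factors $[\bar Q, \bar R] = \mathrm{IO}(X)$ satisfy $$\bar R^T \bar R = X^T X + \Delta E,\quad \|\Delta E\| \le O(\varepsilon)\|X\|^2,$$ $$\bar Q \bar R = X + \Delta D,\quad \|\Delta D\| \le O(\varepsilon)\bigl(\|X\| + \|\bar Q\|\,\|\bar R\|\bigr).$$ Then $$\|I - \bar{\mathcal{Q}}^T \bar{\mathcal{Q}}\| \le O(\varepsilon),$$ $$\bar{\mathcal{Q}}\bar{\mathcal{R}} = \mathcal{X} + \Delta\mathcal{D}, \quad \|\Delta \mathcal{D}\| \le O(\varepsilon)\|\mathcal{X}\|.$$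
   Context: $\|\cdot\|$ is the spectral norm; $\kappa$ is the 2-norm condition number (ratio of largest to smallest singular value). Bars denote quantities computed in floating-point arithmetic (standard rounding model) with unit roundoff $\varepsilon$. $O(\varepsilon)$ means $c(m,ps)\,\varepsilon$ with $c$ a low-degree polynomial in the dimensions, possibly different at each occurrence; a hypothesis $O(\varepsilon)\kappa^2(\mathcal{X})\le \frac12$ means $c(m,ps)\,\varepsilon\,\kappa^2(\mathcal{X}) \le \frac12$ for a suitable such $c$. $\mathcal{X} = [X_1\ X_2\ \cdots\ X_p]$ is partitioned into blocks $X_k \in \mathbb{R}^{m\times s}$, $m \gg s$. For a matrix $\mathcal{R} \in \mathbb{R}^{ps\times ps}$ with $s \times s$ blocks $R_{ij}$, $\mathcal{R}_{1:k-1,k}$ is the block column $[R_{1,k}; \dots; R_{k-1,k}]$; $\mathcal{Q}_{k} = [Q_1\ \cdots\ Q_k]$. $\mathrm{IO}$ (intraorthogonalization) is a routine which, given $X \in \mathbb{R}^{m \times s}$, returns the factors $Q \in \mathbb{R}^{m\times s}$ (orthonormal in exact arithmetic) and upper triangular $R \in \mathbb{R}^{s \times s}$ of a QR factorization $X = QR$. $\mathrm{chol}(A)$ is the upper triangular Cholesky factor $R$, $R^TR = A$. Algorithm $[\mathcal{Q},\mathcal{R}] = \text{BCGS-PIP}(\mathcal{X}, \mathrm{IO})$: set $[Q_1,R_{11}] = \mathrm{IO}(X_1)$; for $k=2,\dots,p$: $\mathcal{R}_{1:k-1,k} = \mathcal{Q}_{k-1}^T X_k$ and $P_k = X_k^T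 X_k$; $R_{kk} = \mathrm{chol}(P_k - \mathcal{R}_{1:k-1,k}^T\mathcal{R}_{1:k-1,k})$; $V_k = X_k - \mathcal{Q}_{k-1}\mathcal{R}_{1:k-1,k}$; $Q_k = V_k R_{kk}^{-1}$. Return $\mathcal{Q} = [Q_1,\dots,Q_p]$, $\mathcal{R} = (R_{ij})$ (block upper triangular). Algorithm $[\mathcal{Q},\mathcal{R}] = \text{BCGS-PIP+}(\mathcal{X}, \mathrm{IO})$: $[\mathcal{U},\mathcal{S}] = \text{BCGS-PIP}(\mathcal{X},\mathrm{IO})$; $[\mathcal{Q},\mathcal{T}] = \text{BCGS-PIP}(\mathcal{U},\mathrm{IO})$; $\mathcal{R} = \mathcal{T}\mathcal{S}$.
   Formalization: The IO bounds are assumed for all X with κ(X) ≤ max(κ(𝒳), τ), τ > 1 any fixed number on which the constants may depend; with κ(X) ≤ κ(𝒳) alone the claim fails for 𝒳 with orthonormal columns, as the second IO call may get a block with κ slightly above 1. *)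

theory Defs
  imports
    "Jordan_Normal_Form.Char_Poly"
    "HOL-Library.Multiset"
    "HOL-Library.Extended_Real"
begin

definition vec_norm2 :: "real vec \<Rightarrow> real" where
  "vec_norm2 v = sqrt (v \<bullet> v)"

definition spectral_norm :: "real mat \<Rightarrow> real" where
  "spectral_norm A = Sup {vec_norm2 (A *\<^sub>v v) | v. v \<in> carrier_vec (dim_col A) \<and> vec_norm2 v = 1}"

(* Singular values counted over the columns: for a matrix with more columns than rows
   this set contains 0. *)
definition singular_values :: "real mat \<Rightarrow> real set" where
  "singular_values A = {\<sigma>. 0 \<le> \<sigma> \<and> eigenvalue (transpose_mat A * A) (\<sigma>\<^sup>2)}"

(* Infinite exactly when the columns are linearly dependent; real division by 0 would
   instead make every rank-deficient matrix perfectly conditioned. *)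
definition cond2 :: "real mat \<Rightarrow> ereal" where
  "cond2 A = (if Min (singular_values A) = 0 then \<infinity>
              else ereal (Max (singular_values A) / Min (singular_values A)))"

(* The constants c(m, n) behind O(eps): polynomials of degree at most d in each of the
   two dimensions.  Nonnegative coefficients lose no generality, since replacing the
   coefficients by their absolute values only enlarges c. *)
definition dim_poly :: "nat \<Rightarrow> (nat \<Rightarrow> nat \<Rightarrow> real) \<Rightarrow> bool" where
  "dim_poly d c \<longleftrightarrow> (\<exists>a :: nat \<Rightarrow> nat \<Rightarrow> real. (\<forall>i j. 0 \<le> a i j) \<and>
     (\<forall>m n. c m n = (\<Sum>i\<le>d. \<Sum>j\<le>d. a i j * real m ^ i * real n ^ j)))"

(* Standard rounding model (no underflow or overflow): y is an admissible floating-point value of the exact result x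
   of one operation.  Everything below is a relation between inputs and possible computed
   outputs, so no particular rounding rule is fixed. *)
definition fl :: "real \<Rightarrow> real \<Rightarrow> real \<Rightarrow> bool" where
  "fl \<epsilon> x y \<longleftrightarrow> (\<exists>\<delta>. \<bar>\<delta>\<bar> \<le> \<epsilon> \<and> y = x * (1 + \<delta>))"

(* Summation in an arbitrary order and with arbitrary bracketing.  There is deliberately
   no rule for the empty multiset: it would allow an unbounded number of roundings. *)
inductive fl_sum :: "real \<Rightarrow> real multiset \<Rightarrow> real \<Rightarrow> bool" for \<epsilon> :: real where
  single: "fl_sum \<epsilon> {#x#} x"
| plus: "fl_sum \<epsilon> A a \<Longrightarrow> fl_sum \<epsilon> B b \<Longrightarrow> fl \<epsilon> (a + b) c \<Longrightarrow> fl_sum \<epsilon> (A + B) c"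

(* sum of x k * y k over k < n *)
definition fl_dot :: "real \<Rightarrow> nat \<Rightarrow> (nat \<Rightarrow> real) \<Rightarrow> (nat \<Rightarrow> real) \<Rightarrow> real \<Rightarrow> bool" where
  "fl_dot \<epsilon> n x y z \<longleftrightarrow> (\<exists>w. (\<forall>k<n. fl \<epsilon> (x k * y k) (w k)) \<and>
     fl_sum \<epsilon> (image_mset w (mset_set {..<n})) z)"

(* a minus the sum of x k * y k over k < n *)
definition fl_minus_dot ::
    "real \<Rightarrow> nat \<Rightarrow> real \<Rightarrow> (nat \<Rightarrow> real) \<Rightarrow> (nat \<Rightarrow> real) \<Rightarrow> real \<Rightarrow> bool" where
  "fl_minus_dot \<epsilon> n a x y z \<longleftrightarrow> (\<exists>w. (\<forall>k<n. fl \<epsilon> (x k * y k) (w k)) \<and>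
     fl_sum \<epsilon> (add_mset a (image_mset (\<lambda>k. - w k) (mset_set {..<n}))) z)"

definition fl_mult :: "real \<Rightarrow> real mat \<Rightarrow> real mat \<Rightarrow> real mat \<Rightarrow> bool" where
  "fl_mult \<epsilon> A B C \<longleftrightarrow> dim_col A = dim_row B \<and> C \<in> carrier_mat (dim_row A) (dim_col B) \<and>
     (\<forall>i<dim_row A. \<forall>j<dim_col B.
        fl_dot \<epsilon> (dim_col A) (\<lambda>k. A $$ (i, k)) (\<lambda>k. B $$ (k, j)) (C $$ (i, j)))"

definition fl_minus :: "real \<Rightarrow> real mat \<Rightarrow> real mat \<Rightarrow> real mat \<Rightarrow> bool" where
  "fl_minus \<epsilon> A B C \<longleftrightarrow> A \<in> carrier_mat (dim_row B) (dim_col B) \<and>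
     C \<in> carrier_mat (dim_row B) (dim_col B) \<and>
     (\<forall>i<dim_row B. \<forall>j<dim_col B. fl \<epsilon> (A $$ (i, j) - B $$ (i, j)) (C $$ (i, j)))"

(* R is computed by a Cholesky factorization of A that runs to completion, i.e. every
   computed pivot is positive.  Only the upper triangle of A is read. *)
definition fl_chol :: "real \<Rightarrow> real mat \<Rightarrow> real mat \<Rightarrow> bool" where
  "fl_chol \<epsilon> A R \<longleftrightarrow> A \<in> carrier_mat (dim_row A) (dim_row A) \<and>
     R \<in> carrier_mat (dim_row A) (dim_row A) \<and> upper_triangular R \<and>
     (\<forall>j<dim_row A.
        (\<forall>i<j. \<exists>z. fl_minus_dot \<epsilon> i (A $$ (i, j)) (\<lambda>k. R $$ (k, i)) (\<lambda>k. R $$ (k, j)) z \<and>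
                    fl \<epsilon> (z / R $$ (i, i)) (R $$ (i, j))) \<and>
        (\<exists>z>0. fl_minus_dot \<epsilon> j (A $$ (j, j)) (\<lambda>k. R $$ (k, j)) (\<lambda>k. R $$ (k, j)) z \<and>
               fl \<epsilon> (sqrt z) (R $$ (j, j))))"

(* Q = V R^{-1} for upper triangular R, computed row by row by substitution in Q R = V. *)
definition fl_trsolve :: "real \<Rightarrow> real mat \<Rightarrow> real mat \<Rightarrow> real mat \<Rightarrow> bool" where
  "fl_trsolve \<epsilon> V R Q \<longleftrightarrow> R \<in> carrier_mat (dim_col V) (dim_col V) \<and>
     Q \<in> carrier_mat (dim_row V) (dim_col V) \<and>
     (\<forall>i<dim_row V. \<forall>j<dim_col V.
        \<exists>z. fl_minus_dot \<epsilon> j (V $$ (i, j)) (\<lambda>k. Q $$ (i, k)) (\<lambda>k. R $$ (k, j)) z \<and>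
            fl \<epsilon> (z / R $$ (j, j)) (Q $$ (i, j)))"

(* the r by c submatrix whose top left entry is A $$ (i0, j0) *)
definition sub_mat :: "real mat \<Rightarrow> nat \<Rightarrow> nat \<Rightarrow> nat \<Rightarrow> nat \<Rightarrow> real mat" where
  "sub_mat A i0 j0 r c = mat r c (\<lambda>(i, j). A $$ (i0 + i, j0 + j))"

(* Possible outcomes (Q, R) of BCGS-PIP in floating-point arithmetic, for X with p blocks of
   s columns; blocks are numbered from 0, so Qprev consists of blocks 0, ..., k - 1.
   IO is the floating-point intraorthogonalization routine. *)
definition fl_bcgs_pip ::
    "real \<Rightarrow> (real mat \<Rightarrow> real mat \<times> real mat) \<Rightarrow> nat \<Rightarrow> nat \<Rightarrow> real mat \<Rightarrow> real mat \<Rightarrow> real mat \<Rightarrow> bool"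
  where
  "fl_bcgs_pip \<epsilon> IO s p X Q R \<longleftrightarrow>
     (let m = dim_row X in
      Q \<in> carrier_mat m (p * s) \<and> R \<in> carrier_mat (p * s) (p * s) \<and>
      IO (sub_mat X 0 0 m s) = (sub_mat Q 0 0 m s, sub_mat R 0 0 s s) \<and>
      (\<forall>k\<in>{1..<p}.
         let Xk = sub_mat X 0 (k * s) m s;
             Qprev = sub_mat Q 0 0 m (k * s);
             Qk = sub_mat Q 0 (k * s) m s;
             Rcol = sub_mat R 0 (k * s) (k * s) s;
             Rkk = sub_mat R (k * s) (k * s) s s
         in fl_mult \<epsilon> (transpose_mat Qprev) Xk Rcol \<and>
            (\<exists>P G H. fl_mult \<epsilon> (transpose_mat Xk) Xk P \<and>
               fl_mult \<epsilon> (transpose_mat Rcol) Rcol G \<and> fl_minus \<epsilon> P G H \<and> fl_chol \<epsilon> H Rkk) \<and>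
            (\<exists>W V. fl_mult \<epsilon> Qprev Rcol W \<and> fl_minus \<epsilon> Xk W V \<and> fl_trsolve \<epsilon> V Rkk Qk)) \<and>
      (\<forall>k<p. \<forall>l<k. sub_mat R (k * s) (l * s) s s = 0\<^sub>m s s))"

definition fl_bcgs_pip_plus ::
    "real \<Rightarrow> (real mat \<Rightarrow> real mat \<times> real mat) \<Rightarrow> nat \<Rightarrow> nat \<Rightarrow> real mat \<Rightarrow> real mat \<Rightarrow> real mat \<Rightarrow> bool"
  where
  "fl_bcgs_pip_plus \<epsilon> IO s p X Q R \<longleftrightarrow>
     (\<exists>U S T. fl_bcgs_pip \<epsilon> IO s p X U S \<and> fl_bcgs_pip \<epsilon> IO s p U Q T \<and> fl_mult \<epsilon> T S R)"

(* IO returns, for every m by s matrix of condition number at most K, an upper triangular R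
   with R^T R = X^T X + dE and a Q with Q R = X + dD; bE and bD are the bounds O(eps)
   on the relative sizes of dE and dD.  BCGS-PIP+ applied to X also calls IO on the first block
   of the computed U, whose condition number can exceed cond2 X through rounding when cond2 X
   is close to 1 (take X with exactly orthonormal columns); K has to leave room for that. *)
definition io_accurate ::
    "nat \<Rightarrow> nat \<Rightarrow> ereal \<Rightarrow> real \<Rightarrow> real \<Rightarrow> (real mat \<Rightarrow> real mat \<times> real mat) \<Rightarrow> bool" where
  "io_accurate m s K bE bD IO \<longleftrightarrow>
     (\<forall>X\<in>carrier_mat m s. cond2 X \<le> K \<longrightarrow>
        (\<exists>Q R. IO X = (Q, R) \<and> Q \<in> carrier_mat m s \<and> R \<in> carrier_mat s s \<and> upper_triangular R \<and>
           (\<exists>dE\<in>carrier_mat s s. transpose_mat R * R = transpose_mat X * X + dE \<and>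
              spectral_norm dE \<le> bE * (spectral_norm X)\<^sup>2) \<and>
           (\<exists>dD\<in>carrier_mat m s. Q * R = X + dD \<and>
              spectral_norm dD \<le> bD * (spectral_norm X + spectral_norm Q * spectral_norm R))))"

end

theory Submission
  imports Defs "HOL-Analysis.L2_Norm" "HOL-Analysis.Function_Topology"
begin

text \<open>One pass of BCGS-PIP yields \<open>Q R = X + D\<close> and \<open>R\<^sup>T R = X\<^sup>T X + E\<close>.  The residual of column \<open>j\<close> involves
  only the columns of \<open>Q\<close> before \<open>j\<close>, and a block of \<open>E\<close> to the right of the diagonal involves only
  earlier columns of \<open>D\<close>, since there \<open>R\<^sub>k\<^sub>j \<approx> Q\<^sub>k\<^sup>T X\<^sub>j\<close>.  So an induction over the columns bounds \<open>D\<close>, \<open>E\<close>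
  and \<open>\<parallel>Q\<parallel> \<le> 2\<close> together; writing \<open>Q = (X + D) R\<^sup>-\<^sup>1\<close> then gives \<open>\<parallel>I - Q\<^sup>T Q\<parallel> \<le> O(\<epsilon>) \<kappa>\<^sup>2(X)\<close>.
  The hypothesis makes this loss of orthogonality so small after the first pass that
  the computed \<open>U\<close> is well conditioned (its first block even has condition number at most \<open>\<tau>\<close>, as the
  second call of \<open>IO\<close> requires), and the second pass loses only \<open>O(\<epsilon>)\<close>.\<close>

subsection \<open>Euclidean norms and triangular systems\<close>

text \<open>Rounding analysis and linear algebra meet only in the locale
  \<open>perturbed_gram_schmidt\<close>: every error of a pass is measured by one number \<theta>,
  and the input enters only through \<sigma> |v| <= |X v| <= \<xi> |v|. The obstacle is a circle:
  the errors made in forming Q are proportional to the size of Q, and that size is known only once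
  the errors are. Two facts break it. Columns of R are controlled without Q, because the diagonal
  entries of R^T R - X^T X lie in diagonal blocks, where the defect is bounded directly. The defect
  of R^T R has size \<theta> \<xi>^2 and must stay below \<sigma>^2, which is where the square of
  the condition number comes from. Entry and column bounds are turned into norm bounds crudely, at
  the price of powers of n; this raises the degree of the polynomials. In the second pass \<sigma> =
  1/2 and \<xi> = 2 are absolute constants, so \<xi>^2 / \<sigma>^2 disappears from the
  bounds.\<close>

abbreviation nrm :: "nat \<Rightarrow> (nat \<Rightarrow> real) \<Rightarrow> real" where
  "nrm n x \<equiv> L2_set x {..<n}"

text \<open>Matrices are functions on all pairs of naturals, so passing to the leading columns only
  changes the bound \<open>n\<close>; no submatrix has to be formed. Bounds valid for n columns pass
  to l <= n columns by padding the vector with zeros (\<open>mv_restrict\<close>,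
  \<open>nrm_restrict\<close>).\<close>

definition mv :: "nat \<Rightarrow> (nat \<Rightarrow> nat \<Rightarrow> real) \<Rightarrow> (nat \<Rightarrow> real) \<Rightarrow> nat \<Rightarrow> real" where
  "mv n A v = (\<lambda>i. \<Sum>j<n. A i j * v j)"

lemma L2_set_sq: "(L2_set x A)\<^sup>2 = (\<Sum>i\<in>A. (x i)\<^sup>2)"
  by (simp add: L2_set_def sum_nonneg)

lemma L2_set_abs [simp]: "L2_set (\<lambda>i. \<bar>x i\<bar>) A = L2_set x A"
  by (simp add: L2_set_def)

lemma L2_set_cauchy_schwarz: "\<bar>\<Sum>i\<in>A. x i * y i\<bar> \<le> L2_set x A * L2_set y A"
proof -
  have "\<bar>\<Sum>i\<in>A. x i * y i\<bar> \<le> (\<Sum>i\<in>A. \<bar>x i\<bar> * \<bar>y i\<bar>)"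
    by (rule order_trans[OF sum_abs]) (simp add: abs_mult)
  then show ?thesis using L2_set_mult_ineq order_trans by blast
qed

lemma L2_set_abs_mono: "(\<And>i. i \<in> A \<Longrightarrow> \<bar>x i\<bar> \<le> y i) \<Longrightarrow> L2_set x A \<le> L2_set y A"
  using L2_set_mono[of A "\<lambda>i. \<bar>x i\<bar>" y] by simp

lemma L2_set_scale: "L2_set (\<lambda>i. c * x i) A = \<bar>c\<bar> * L2_set x A"
  using L2_set_right_distrib[of "\<bar>c\<bar>" "\<lambda>i. \<bar>x i\<bar>" A]
  by (simp flip: abs_mult)

lemma L2_set_sum_le:
  "L2_set (\<lambda>i. \<Sum>k\<in>K. c k * f k i) A \<le> (\<Sum>k\<in>K. \<bar>c k\<bar> * L2_set (f k) A)"
proof (induction K rule: infinite_finite_induct)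
  case (insert k K)
  then show ?case
    using L2_set_triangle_ineq[of "\<lambda>i. c k * f k i" "\<lambda>i. \<Sum>k\<in>K. c k * f k i" A]
    by (simp add: L2_set_scale)
qed (simp_all add: L2_set_def)

lemma L2_set_sq_diff:
  "(L2_set (\<lambda>i. x i + y i) A)\<^sup>2 - (L2_set x A)\<^sup>2 = 2 * (\<Sum>i\<in>A. x i * y i) + (L2_set y A)\<^sup>2"
  unfolding L2_set_sq by (simp add: power2_sum sum.distrib sum_distrib_left algebra_simps)

lemma member_le_nrm: "i < n \<Longrightarrow> \<bar>x i\<bar> \<le> nrm n x"
  using member_le_L2_set[of "{..<n}" i "\<lambda>i. \<bar>x i\<bar>"] by simp

lemma nrm_unit:
  assumes "j < n" shows "nrm n (\<lambda>i. if i = j then 1 else 0) = 1"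
proof -
  have "(\<Sum>i<n. (if i = j then 1 else 0 :: real)\<^sup>2) = (\<Sum>i<n. if i = j then 1 else 0)"
    by (intro sum.cong) auto
  then show ?thesis using assms by (simp add: L2_set_def sum.delta)
qed

lemma mv_unit: "j < n \<Longrightarrow> mv n A (\<lambda>i. if i = j then 1 else 0) = (\<lambda>i. A i j)"
  unfolding mv_def by (simp add: if_distrib[of "\<lambda>x. _ * x"] sum.delta cong: if_cong)

lemma mv_restrict:
  assumes "l \<le> n" shows "mv n A (\<lambda>j. if j < l then v j else 0) = mv l A v"
proof -
  have "(\<Sum>j<n. A i j * (if j < l then v j else 0)) = (\<Sum>j<l. A i j * v j)" for i
    using assms by (intro sum.mono_neutral_cong_right) auto
  then show ?thesis unfolding mv_def by simp
qed

lemma nrm_restrict: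
  assumes "l \<le> n" shows "nrm n (\<lambda>j. if j < l then v j else 0) = nrm l v"
proof -
  have "(\<Sum>j<n. (if j < l then v j else 0)\<^sup>2) = (\<Sum>j<l. (v j)\<^sup>2)"
    using assms by (intro sum.mono_neutral_cong_right) auto
  then show ?thesis unfolding L2_set_def by simp
qed

lemma column_le:
  assumes "\<And>v. nrm m (mv n A v) \<le> c * nrm n v" "j < n"
  shows "nrm m (\<lambda>i. A i j) \<le> c"
  using assms(1)[of "\<lambda>i. if i = j then 1 else 0"] nrm_unit[OF assms(2)] mv_unit[OF assms(2)]
  by simp

text \<open>Deliberately crude: each |v j| is replaced by the norm of v, which costs n where
  Cauchy-Schwarz would cost sqrt n. Powers of n are absorbed by O(\<epsilon>).\<close>

lemma nrm_mv_le:
  assumes "\<And>j. j < n \<Longrightarrow> nrm m (\<lambda>i. A i j) \<le> c"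
  shows "nrm m (mv n A v) \<le> real n * c * nrm n v"
proof -
  have "nrm m (mv n A v) = nrm m (\<lambda>i. \<Sum>j<n. v j * A i j)"
    by (simp add: mv_def mult.commute)
  also have "\<dots> \<le> (\<Sum>j<n. \<bar>v j\<bar> * nrm m (\<lambda>i. A i j))" by (rule L2_set_sum_le)
  also have "\<dots> \<le> (\<Sum>j<n. nrm n v * c)"
    using assms by (intro sum_mono mult_mono) (auto intro: member_le_nrm)
  finally show ?thesis by (simp add: mult_ac)
qed

text \<open>Both squared norms are quadratic forms of Gram matrices. This turns entrywise control of
  R^T R - X^T X into a comparison of |R v| and |X v| for all v at once.\<close>

lemma gram_diff:
  "(nrm l (mv n A v))\<^sup>2 - (nrm m (mv n B v))\<^sup>2
     = (\<Sum>i<n. \<Sum>j<n. v i * v j * ((\<Sum>k<l. A k i * A k j) - (\<Sum>k<m. B k i * B k j)))"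
proof -
  have *: "(nrm l (mv n A v))\<^sup>2 = (\<Sum>i<n. \<Sum>j<n. v i * v j * (\<Sum>k<l. A k i * A k j))" for l A
  proof -
    have "(nrm l (mv n A v))\<^sup>2 = (\<Sum>k<l. \<Sum>i<n. \<Sum>j<n. v i * v j * (A k i * A k j))"
      unfolding L2_set_sq mv_def unfolding power2_eq_square sum_product
      by (intro sum.cong refl) (simp add: mult_ac)
    also have "\<dots> = (\<Sum>i<n. \<Sum>k<l. \<Sum>j<n. v i * v j * (A k i * A k j))" by (rule sum.swap)
    also have "\<dots> = (\<Sum>i<n. \<Sum>j<n. \<Sum>k<l. v i * v j * (A k i * A k j))"
      by (intro sum.cong refl sum.swap)
    finally show ?thesis by (simp add: sum_distrib_left)
  qed
  show ?thesis unfolding * by (simp add: right_diff_distrib sum_subtractf)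
qed

lemma quadratic_form_le:
  assumes "\<And>i j. i < n \<Longrightarrow> j < n \<Longrightarrow> \<bar>E i j\<bar> \<le> e" "0 \<le> e"
  shows "\<bar>\<Sum>i<n. \<Sum>j<n. v i * v j * E i j\<bar> \<le> real n ^ 2 * e * (nrm n v)\<^sup>2"
proof -
  have "\<bar>\<Sum>i<n. \<Sum>j<n. v i * v j * E i j\<bar> \<le> (\<Sum>i<n. \<Sum>j<n. \<bar>v i * v j * E i j\<bar>)"
    by (rule order_trans[OF sum_abs]) (intro sum_mono sum_abs)
  also have "\<dots> \<le> (\<Sum>i<n. \<Sum>j<n. nrm n v * nrm n v * e)"
    unfolding abs_mult using assms
    by (intro sum_mono mult_mono) (auto intro: member_le_nrm)
  finally show ?thesis by (simp add: power2_eq_square mult_ac)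
qed

text \<open>Injectivity implies solvability, by induction on the size. Padding by zero makes the
  leading block injective. If the last diagonal entry were 0, solving the leading system for the
  last column would give a kernel vector with last component -1. Otherwise the last unknown is
  \<open>w l / R l l\<close> and the leading block does the rest. This replaces the inverse of R
  throughout.\<close>

lemma triangular_solve:
  assumes "\<And>v i. (\<And>i. i < l \<Longrightarrow> mv l R v i = 0) \<Longrightarrow> i < l \<Longrightarrow> v i = 0"
    and "\<And>i j. i < l \<Longrightarrow> j < i \<Longrightarrow> R i j = 0"
  shows "\<exists>v. \<forall>i<l. mv l R v i = w i"
  using assms
proof (induction l arbitrary: w)
  case (Suc l)
  have ext: "mv (Suc l) R (v(l := c)) i = mv l R v i + R i l * c" for v c i
    by (simp add: mv_def)
  have last: "mv l R v l = 0" for v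
    using Suc.prems(2) by (simp add: mv_def)
  have solve: "\<exists>v. \<forall>i<l. mv l R v i = w i" for w
  proof (rule Suc.IH)
    fix v i assume "\<And>i. i < l \<Longrightarrow> mv l R v i = 0" "i < l"
    then have "mv (Suc l) R (v(l := 0)) i = 0" if "i < Suc l" for i
      using that last by (auto simp: ext less_Suc_eq)
    from Suc.prems(1)[OF this, of i] show "v i = 0" using \<open>i < l\<close> by simp
  qed (use Suc.prems(2) in auto)
  have "R l l \<noteq> 0"
  proof
    assume 0: "R l l = 0"
    obtain u where "\<forall>i<l. mv l R u i = R i l"
      using solve[of "\<lambda>i. R i l"] by blast
    then have "mv (Suc l) R (u(l := -1)) i = 0" if "i < Suc l" for i
      using that last 0 by (auto simp: ext less_Suc_eq)
    from Suc.prems(1)[OF this, of l] show False by simp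
  qed
  obtain u where "\<forall>i<l. mv l R u i = w i - R i l * (w l / R l l)"
    using solve[of "\<lambda>i. w i - R i l * (w l / R l l)"] by blast
  then have "\<forall>i<Suc l. mv (Suc l) R (u(l := w l / R l l)) i = w i"
    using last \<open>R l l \<noteq> 0\<close> by (auto simp: ext less_Suc_eq)
  then show ?case by blast
qed simp

text \<open>The loss of orthogonality of \<open>Q = (X + D) R\<^sup>-\<^sup>1\<close> is governed by how far \<open>R\<close> is from being
  an exact Cholesky factor of \<open>X\<^sup>T X\<close> and by the residual \<open>D\<close>.\<close>

lemma orthogonality_of_residual:
  fixes X Q R D :: "nat \<Rightarrow> nat \<Rightarrow> real"
  assumes \<sigma>: "0 < \<sigma>" and \<delta>: "0 \<le> \<delta>"
    and low: "\<And>v. \<sigma> * nrm l v \<le> nrm m (mv l X v)"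
    and up: "\<And>v. nrm m (mv l X v) \<le> \<xi> * nrm l v"
    and tri: "\<And>i j. i < l \<Longrightarrow> j < i \<Longrightarrow> R i j = 0"
    and gram: "\<And>v. \<bar>(nrm l (mv l R v))\<^sup>2 - (nrm m (mv l X v))\<^sup>2\<bar> \<le> e * (nrm l v)\<^sup>2"
    and e: "2 * e \<le> \<sigma>\<^sup>2"
    and QR: "\<And>i j. i < m \<Longrightarrow> j < l \<Longrightarrow> (\<Sum>k<l. Q i k * R k j) = X i j + D i j"
    and res: "\<And>v. nrm m (mv l D v) \<le> \<delta> * nrm l v"
  shows "nrm m (mv l Q w) \<le> 3/2 * (1 + \<delta> / \<sigma>) * nrm l w"
    and "\<bar>(nrm m (mv l Q w))\<^sup>2 - (nrm l w)\<^sup>2\<bar>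
           \<le> (e + 2 * \<xi> * \<delta> + \<delta>\<^sup>2) * (2 / \<sigma>\<^sup>2) * (nrm l w)\<^sup>2"
proof -
  \<comment> \<open>The condition 2 e <= \<sigma>^2 leaves R at least half of the squared lower
    bound of X. This gives injectivity of R and, in effect, |R^-1|^2 <= 2 / \<sigma>^2.\<close>
  have key: "\<sigma>\<^sup>2 * (nrm l v)\<^sup>2 \<le> 2 * (nrm l (mv l R v))\<^sup>2" for v
  proof -
    have "\<sigma>\<^sup>2 * (nrm l v)\<^sup>2 \<le> (nrm m (mv l X v))\<^sup>2"
      using power_mono[OF low[of v], of 2] \<sigma> by (simp add: power_mult_distrib)
    moreover have "2 * (e * (nrm l v)\<^sup>2) \<le> \<sigma>\<^sup>2 * (nrm l v)\<^sup>2"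
      using mult_right_mono[OF e, of "(nrm l v)\<^sup>2"] by (simp add: mult_ac)
    ultimately show ?thesis using gram[of v] by linarith
  qed
  \<comment> \<open>Writing w = R v turns Q w into X v + D v, so only X, D and the size of v need to
    be compared with w.\<close>
  have "\<exists>v. \<forall>i<l. mv l R v i = w i"
  proof (rule triangular_solve)
    fix v i assume z: "\<And>i. i < l \<Longrightarrow> mv l R v i = 0" and i: "i < l"
    have "nrm l (mv l R v) = 0" using z by (simp add: L2_set_def)
    then have "(\<sigma> * nrm l v)\<^sup>2 \<le> 0" using key[of v] by (simp add: power_mult_distrib)
    then have "nrm l v = 0" using \<sigma> by simp
    then show "v i = 0" using member_le_nrm[OF i, of v] by simp
  qed (use tri in auto)
  then obtain v where v: "\<And>i. i < l \<Longrightarrow> mv l R v i = w i" by blast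
  have nw: "nrm l (mv l R v) = nrm l w" using v by (intro L2_set_cong) auto
  have Qw: "mv l Q w i = mv l X v i + mv l D v i" if "i < m" for i
  proof -
    have "mv l Q w i = (\<Sum>k<l. Q i k * mv l R v k)" using v by (simp add: mv_def)
    also have "\<dots> = (\<Sum>k<l. \<Sum>j<l. Q i k * R k j * v j)"
      by (simp add: mv_def sum_distrib_left mult_ac)
    also have "\<dots> = (\<Sum>j<l. (\<Sum>k<l. Q i k * R k j) * v j)"
      by (subst sum.swap) (simp add: sum_distrib_right)
    also have "\<dots> = (\<Sum>j<l. (X i j + D i j) * v j)" using QR that by simp
    finally show ?thesis by (simp add: mv_def sum.distrib algebra_simps)
  qed
  then have nQ: "nrm m (mv l Q w) = nrm m (\<lambda>i. mv l X v i + mv l D v i)"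
    by (intro L2_set_cong) auto
  define a b c q where "a = nrm l v" and "b = nrm m (mv l X v)" and "c = nrm l w"
    and "q = nrm m (mv l D v)"
  have pos: "0 \<le> a" "0 \<le> b" "0 \<le> c" "0 \<le> q" by (simp_all add: a_def b_def c_def q_def)
  have k: "\<sigma>\<^sup>2 * a\<^sup>2 \<le> 2 * c\<^sup>2" using key[of v] nw by (simp add: a_def c_def)
  have g: "\<bar>c\<^sup>2 - b\<^sup>2\<bar> \<le> e * a\<^sup>2" using gram[of v] nw by (simp add: a_def b_def c_def)
  have qa: "q \<le> \<delta> * a" using res[of v] by (simp add: q_def a_def)
  have ba: "b \<le> \<xi> * a" using up[of v] by (simp add: b_def a_def)
  have ea: "2 * (e * a\<^sup>2) \<le> \<sigma>\<^sup>2 * a\<^sup>2"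
    using mult_right_mono[OF e, of "a\<^sup>2"] by (simp add: mult_ac)
  \<comment> \<open>Here and for \<open>bc\<close>, 3/2 is a rational upper bound for sqrt
    2.\<close>
  have sa: "\<sigma> * a \<le> 3/2 * c"
  proof (rule power2_le_imp_le)
    show "(\<sigma> * a)\<^sup>2 \<le> (3/2 * c)\<^sup>2"
      using k zero_le_power2[of c] unfolding power_mult_distrib power_divide by (simp; linarith)
  qed (use pos in simp)
  have bc: "b \<le> 3/2 * c"
  proof (rule power2_le_imp_le)
    have "b\<^sup>2 \<le> 2 * c\<^sup>2" using g ea k by linarith
    then show "b\<^sup>2 \<le> (3/2 * c)\<^sup>2"
      using zero_le_power2[of c] unfolding power_mult_distrib power_divide by (simp; linarith)
  qed (use pos in simp)
  have "\<delta> * a = (\<delta> / \<sigma>) * (\<sigma> * a)" using \<sigma> by simp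
  also have "\<dots> \<le> (\<delta> / \<sigma>) * (3/2 * c)" using sa \<sigma> \<delta> by (intro mult_left_mono) auto
  finally have "q \<le> 3/2 * (\<delta> / \<sigma>) * c" using qa by (simp add: mult_ac)
  moreover have "nrm m (mv l Q w) \<le> b + q" unfolding nQ b_def q_def by (rule L2_set_triangle_ineq)
  ultimately show "nrm m (mv l Q w) \<le> 3/2 * (1 + \<delta> / \<sigma>) * nrm l w"
    using bc unfolding c_def[symmetric] distrib_left distrib_right by linarith
  have a2: "a\<^sup>2 \<le> 2 / \<sigma>\<^sup>2 * c\<^sup>2" using k \<sigma> by (simp add: field_simps)
  have bq: "b * q \<le> \<xi> * a * (\<delta> * a)"
    using ba qa pos by (intro mult_mono) (auto intro: order_trans)
  have q2: "q\<^sup>2 \<le> \<delta>\<^sup>2 * a\<^sup>2" using power_mono[OF qa, of 2] pos by (simp add: power_mult_distrib)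
  \<comment> \<open>The cross term of |X v + D v|^2. It contributes the summand 2 \<xi> \<delta>,
    the only place where the upper bound of X is needed.\<close>
  define t where "t = (\<Sum>i<m. mv l X v i * mv l D v i)"
  have t: "\<bar>t\<bar> \<le> b * q" unfolding t_def b_def q_def by (rule L2_set_cauchy_schwarz)
  have "(nrm m (mv l Q w))\<^sup>2 - b\<^sup>2 = 2 * t + q\<^sup>2"
    unfolding nQ b_def q_def t_def by (rule L2_set_sq_diff)
  then have "\<bar>(nrm m (mv l Q w))\<^sup>2 - c\<^sup>2\<bar> \<le> e * a\<^sup>2 + 2 * (\<xi> * a * (\<delta> * a)) + \<delta>\<^sup>2 * a\<^sup>2"
    using g t bq q2 zero_le_power2[of q] by linarith
  also have "\<dots> = (e + 2 * \<xi> * \<delta> + \<delta>\<^sup>2) * a\<^sup>2" by (simp add: power2_eq_square algebra_simps)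
  finally have main: "\<bar>(nrm m (mv l Q w))\<^sup>2 - c\<^sup>2\<bar> \<le> (e + 2 * \<xi> * \<delta> + \<delta>\<^sup>2) * a\<^sup>2" .
  show "\<bar>(nrm m (mv l Q w))\<^sup>2 - (nrm l w)\<^sup>2\<bar> \<le> (e + 2 * \<xi> * \<delta> + \<delta>\<^sup>2) * (2 / \<sigma>\<^sup>2) * (nrm l w)\<^sup>2"
  \<comment> \<open>The sign of the coefficient is not among the hypotheses. For a \<noteq> 0 it can
    be read off from \<open>main\<close>; for a = 0 both sides vanish.\<close>
  proof (cases "a = 0")
    case True
    then have "c = 0" using g ba pos by simp
    then show ?thesis using main True by (simp add: c_def)
  next
    case False
    then have "0 < a\<^sup>2" by simp
    then have "0 \<le> e + 2 * \<xi> * \<delta> + \<delta>\<^sup>2"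
      using order_trans[OF abs_ge_zero main] by (simp add: zero_le_mult_iff)
    from mult_left_mono[OF a2 this] main show ?thesis unfolding c_def mult.assoc by linarith
  qed
qed

subsection \<open>Perturbed block Gram-Schmidt\<close>

text \<open>What one computed pass satisfies, with all roundings summarized by \<theta>.
  \<open>gram\<close> speaks of diagonal blocks only, since only these come from a Cholesky
  factorization or from the routine; the blocks above them are described by \<open>proj\<close>. The
  right side of \<open>res\<close> stops before column j, whereas \<open>first_res\<close> is free
  of Q: there the dependence of the bound of the routine on its own output is already resolved. The
  sums run to the diagonal because R is triangular.\<close>

locale perturbed_gram_schmidt =
  fixes X Q R :: "nat \<Rightarrow> nat \<Rightarrow> real" and m n s :: nat and \<theta> \<sigma> \<xi> :: real
  assumes \<sigma>: "0 < \<sigma>" and \<theta>: "0 \<le> \<theta>" "\<theta> \<le> 1" and n: "0 < n" and s: "s \<le> n"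
    and low: "\<sigma> * nrm n v \<le> nrm m (mv n X v)"
    and up: "nrm m (mv n X v) \<le> \<xi> * nrm n v"
    and tri: "j < i \<Longrightarrow> i < n \<Longrightarrow> R i j = 0"
    and gram: "i \<le> j \<Longrightarrow> j < n \<Longrightarrow> i div s = j div s \<Longrightarrow>
      \<bar>(\<Sum>k\<le>i. R k i * R k j) - (\<Sum>a<m. X a i * X a j)\<bar> \<le> \<theta> * \<xi>\<^sup>2"
    and proj: "j < n \<Longrightarrow> i div s < j div s \<Longrightarrow>
      \<bar>R i j - (\<Sum>a<m. Q a i * X a j)\<bar> \<le> \<theta> * \<xi> * nrm m (\<lambda>a. Q a i)"
    and first_res: "j < s \<Longrightarrow> nrm m (\<lambda>a. (\<Sum>k<s. Q a k * R k j) - X a j) \<le> 4 * \<theta> * \<xi>"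
    and first_bound: "j < s \<Longrightarrow> nrm m (\<lambda>a. Q a j) \<le> 2"
    and res: "s \<le> j \<Longrightarrow> j < n \<Longrightarrow> nrm m (\<lambda>a. (\<Sum>k\<le>j. Q a k * R k j) - X a j)
      \<le> \<theta> * (\<xi> + (\<Sum>k<j. nrm m (\<lambda>a. Q a k) * \<bar>R k j\<bar>))"
    and small: "60 * real n ^ 3 * \<theta> * \<xi>\<^sup>2 \<le> \<sigma>\<^sup>2"
begin

definition D where "D a j = (\<Sum>k\<le>j. Q a k * R k j) - X a j"
definition E where "E i j = (\<Sum>k<n. R k i * R k j) - (\<Sum>a<m. X a i * X a j)"

lemma sum_R_mult: "i < n \<Longrightarrow> (\<Sum>k<n. R k i * f k) = (\<Sum>k\<le>i. R k i * f k)"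
  by (rule sum.mono_neutral_right) (auto simp: tri)

lemma sum_mult_R: "j < l \<Longrightarrow> l \<le> n \<Longrightarrow> (\<Sum>k<l. f k * R k j) = (\<Sum>k\<le>j. f k * R k j)"
  by (rule sum.mono_neutral_right) (auto simp: tri)

lemma E_eq: "i < n \<Longrightarrow> E i j = (\<Sum>k\<le>i. R k i * R k j) - (\<Sum>a<m. X a i * X a j)"
  unfolding E_def by (simp add: sum_R_mult)

lemma E_sym: "E i j = E j i"
  unfolding E_def by (simp add: mult.commute)

lemma X_column: "j < n \<Longrightarrow> nrm m (\<lambda>a. X a j) \<le> \<xi>"
  by (rule column_le[OF up])

lemma \<sigma>_le_\<xi>: "\<sigma> \<le> \<xi>" and \<xi>: "0 < \<xi>"
proof -
  show "\<sigma> \<le> \<xi>"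
    using low[of "\<lambda>i. if i = 0 then 1 else 0"] up[of "\<lambda>i. if i = 0 then 1 else 0"] nrm_unit[OF n]
    by simp
  then show "0 < \<xi>" using \<sigma> by linarith
qed

text \<open>\<open>E j j\<close> is the difference of the squared norms of column j of R and of X,
  and it lies in a diagonal block. So \<open>gram\<close> bounds R with no knowledge of Q, which
  keeps the induction over the columns of Q from being circular.\<close>

lemma R_entry: assumes "k < n" "j < n" shows "\<bar>R k j\<bar> \<le> 2 * \<xi>"
proof -
  have "\<bar>E j j\<bar> \<le> \<theta> * \<xi>\<^sup>2" using gram[of j j] assms by (simp add: E_eq)
  also have "\<dots> \<le> \<xi>\<^sup>2" using \<theta> by (simp add: mult_left_le_one_le)
  finally have "\<bar>E j j\<bar> \<le> \<xi>\<^sup>2" .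
  moreover have "E j j = (nrm n (\<lambda>k. R k j))\<^sup>2 - (nrm m (\<lambda>a. X a j))\<^sup>2"
    unfolding E_def L2_set_sq by (simp add: power2_eq_square)
  moreover have "(nrm m (\<lambda>a. X a j))\<^sup>2 \<le> \<xi>\<^sup>2"
    using X_column[OF assms(2)] by (simp add: power_mono)
  ultimately have "(nrm n (\<lambda>k. R k j))\<^sup>2 \<le> 2 * \<xi>\<^sup>2" by linarith
  then have "(nrm n (\<lambda>k. R k j))\<^sup>2 \<le> (2 * \<xi>)\<^sup>2"
    using zero_le_power2[of \<xi>] unfolding power_mult_distrib by (simp; linarith)
  then have "nrm n (\<lambda>k. R k j) \<le> 2 * \<xi>" by (rule power2_le_imp_le) (use \<xi> in simp)
  then show ?thesis using member_le_nrm[OF assms(1), of "\<lambda>k. R k j"] by linarith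
qed

text \<open>With entries of R at most 2 \<xi> and earlier columns of Q at most 2, the bracket in
  \<open>res\<close> is at most \<xi> + 4 n \<xi>; hence the factor 5 n.\<close>

lemma D_column:
  assumes "j < n" "\<And>k. k < j \<Longrightarrow> nrm m (\<lambda>a. Q a k) \<le> 2"
  shows "nrm m (\<lambda>a. D a j) \<le> 5 * real n * \<theta> * \<xi>"
proof (cases "j < s")
  case True
  have "nrm m (\<lambda>a. D a j) \<le> 4 * \<theta> * \<xi>"
    using first_res[OF True] sum_mult_R[OF True s] by (simp add: D_def)
  also have "\<dots> \<le> 5 * real n * \<theta> * \<xi>"
    using n \<theta> \<xi> by (intro mult_right_mono) auto
  finally show ?thesis .
next
  case False
  have "(\<Sum>k<j. nrm m (\<lambda>a. Q a k) * \<bar>R k j\<bar>) \<le> (\<Sum>k<j. 2 * (2 * \<xi>))"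
    using assms R_entry \<xi> by (intro sum_mono mult_mono) auto
  also have "\<dots> \<le> 4 * real n * \<xi>" using assms(1) \<xi> by simp
  finally have "\<xi> + (\<Sum>k<j. nrm m (\<lambda>a. Q a k) * \<bar>R k j\<bar>) \<le> 5 * real n * \<xi>"
    using n \<xi> mult_right_mono[of 1 "real n" \<xi>] by linarith
  then have "\<theta> * (\<xi> + (\<Sum>k<j. nrm m (\<lambda>a. Q a k) * \<bar>R k j\<bar>)) \<le> \<theta> * (5 * real n * \<xi>)"
    using \<theta> by (intro mult_left_mono)
  with res[of j] False assms(1) show ?thesis by (simp add: D_def mult_ac)
qed

text \<open>Off the diagonal blocks put h = R_j - Q^T X_j. Then R_i^T R_j = R_i^T h + (Q R_i)^T X_j,
  and Q R_i = X_i + D_i, so E_ij = R_i^T h + D_i^T X_j. The two summands contribute 4 n and 5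
  n.\<close>

lemma E_entry:
  assumes "i \<le> j" "j < n" "\<And>k. k < j \<Longrightarrow> nrm m (\<lambda>a. Q a k) \<le> 2"
  shows "\<bar>E i j\<bar> \<le> 9 * real n * \<theta> * \<xi>\<^sup>2"
proof (cases "i div s = j div s")
  case True
  have "\<bar>E i j\<bar> \<le> \<theta> * \<xi>\<^sup>2" using gram[OF assms(1,2) True] assms by (simp add: E_eq)
  also have "\<dots> \<le> 9 * real n * \<theta> * \<xi>\<^sup>2"
    using n \<theta> mult_right_mono[of 1 "9 * real n" \<theta>] by (intro mult_right_mono) auto
  finally show ?thesis .
next
  case False
  then have blk: "i div s < j div s" using assms(1) by (simp add: div_le_mono le_neq_trans)
  then have ij: "i < j" using assms(1) by (cases "i = j") auto
  define h where "h k = R k j - (\<Sum>a<m. Q a k * X a j)" for k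
  \<comment> \<open>Indices k <= i may share the block of i, but that block precedes the block of j,
    so \<open>proj\<close> applies to all of them.\<close>
  have h: "\<bar>h k\<bar> \<le> 2 * \<theta> * \<xi>" if "k \<le> i" for k
  proof -
    have "k div s < j div s" using div_le_mono[OF that, of s] blk by linarith
    then have "\<bar>h k\<bar> \<le> \<theta> * \<xi> * nrm m (\<lambda>a. Q a k)" unfolding h_def using assms(2) by (intro proj)
    also have "\<dots> \<le> \<theta> * \<xi> * 2" using assms(3)[of k] that ij \<theta> \<xi> by (intro mult_left_mono) auto
    finally show ?thesis by simp
  qed
  have "(\<Sum>k\<le>i. R k i * R k j) = (\<Sum>k\<le>i. R k i * h k) + (\<Sum>k\<le>i. \<Sum>a<m. Q a k * R k i * X a j)"
    unfolding h_def by (simp add: right_diff_distrib sum_subtractf sum_distrib_left mult_ac)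
  also have "(\<Sum>k\<le>i. \<Sum>a<m. Q a k * R k i * X a j) = (\<Sum>a<m. (\<Sum>k\<le>i. Q a k * R k i) * X a j)"
    by (subst sum.swap) (simp add: sum_distrib_right)
  also have "\<dots> = (\<Sum>a<m. D a i * X a j) + (\<Sum>a<m. X a i * X a j)"
    by (simp add: D_def left_diff_distrib sum_subtractf)
  finally have eq: "E i j = (\<Sum>k\<le>i. R k i * h k) + (\<Sum>a<m. D a i * X a j)"
    using assms(1,2) by (simp add: E_eq)
  have "\<bar>\<Sum>k\<le>i. R k i * h k\<bar> \<le> (\<Sum>k\<le>i. \<bar>R k i * h k\<bar>)" by (rule sum_abs)
  also have "\<dots> \<le> (\<Sum>k\<le>i. 2 * \<xi> * (2 * \<theta> * \<xi>))"
    unfolding abs_mult using R_entry h ij assms(2) \<xi> by (intro sum_mono mult_mono) auto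
  also have "\<dots> = real (Suc i) * (4 * \<theta> * \<xi>\<^sup>2)" by (simp add: power2_eq_square)
  also have "\<dots> \<le> real n * (4 * \<theta> * \<xi>\<^sup>2)"
    using ij assms(2) \<theta> by (intro mult_right_mono) auto
  finally have 1: "\<bar>\<Sum>k\<le>i. R k i * h k\<bar> \<le> real n * (4 * \<theta> * \<xi>\<^sup>2)" .
  have "\<bar>\<Sum>a<m. D a i * X a j\<bar> \<le> nrm m (\<lambda>a. D a i) * nrm m (\<lambda>a. X a j)"
    by (rule L2_set_cauchy_schwarz)
  also have "\<dots> \<le> 5 * real n * \<theta> * \<xi> * \<xi>"
    using D_column[of i] assms ij X_column \<theta> \<xi> by (intro mult_mono) auto
  finally show ?thesis using 1 unfolding eq power2_eq_square by (simp add: algebra_simps)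
qed

text \<open>The hypothesis leaves out the last column k = l - 1, while the conclusion includes it:
  the bounds on D and E for the leading l columns never use it. This gain of one column drives the
  induction in \<open>Q_column\<close>.\<close>

lemma leading_columns:
  assumes l: "l \<le> n" and bound: "\<And>k. Suc k < l \<Longrightarrow> nrm m (\<lambda>a. Q a k) \<le> 2"
  shows "nrm m (mv l Q w) \<le> 2 * nrm l w"
    and "\<bar>(nrm m (mv l Q w))\<^sup>2 - (nrm l w)\<^sup>2\<bar> \<le> 48 * real n ^ 3 * \<theta> * \<xi>\<^sup>2 / \<sigma>\<^sup>2 * (nrm l w)\<^sup>2"
proof -
  \<comment> \<open>The entry bound 9 n \<theta> \<xi>^2 of E and the column bound 5 n \<theta>
    \<xi> of D, multiplied by n^2 and n for the passage to norms.\<close>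
  define e where "e = 9 * real n ^ 3 * \<theta> * \<xi>\<^sup>2"
  define \<delta> where "\<delta> = 5 * real n ^ 2 * \<theta> * \<xi>"
  have n1: "1 \<le> real n" using n by simp
  have \<delta>0: "0 \<le> \<delta>" using \<theta> \<xi> by (simp add: \<delta>_def)
  have E: "\<bar>E i j\<bar> \<le> 9 * real n * \<theta> * \<xi>\<^sup>2" if "i < l" "j < l" for i j
  proof (cases "i \<le> j")
    case True
    show ?thesis by (rule E_entry) (use True that l bound in auto)
  next
    case False
    show ?thesis unfolding E_sym[of i j] by (rule E_entry) (use False that l bound in auto)
  qed
  have gramR: "\<bar>(nrm l (mv l R v))\<^sup>2 - (nrm m (mv l X v))\<^sup>2\<bar> \<le> e * (nrm l v)\<^sup>2" for v
  proof -
    \<comment> \<open>In the first l columns of R the rows from l on vanish, so the leading block of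
      R has the same Gram entries as the whole of R.\<close>
    have Rl: "(\<Sum>k<l. R k i * R k j) = (\<Sum>k<n. R k i * R k j)" if "i < l" for i j
      using that l by (intro sum.mono_neutral_left) (auto simp: tri)
    have "\<bar>(nrm l (mv l R v))\<^sup>2 - (nrm m (mv l X v))\<^sup>2\<bar> = \<bar>\<Sum>i<l. \<Sum>j<l. v i * v j * E i j\<bar>"
      unfolding gram_diff E_def by (simp add: Rl)
    also have "\<dots> \<le> real l ^ 2 * (9 * real n * \<theta> * \<xi>\<^sup>2) * (nrm l v)\<^sup>2"
      using E \<theta> by (intro quadratic_form_le) auto
    also have "\<dots> \<le> real n ^ 2 * (9 * real n * \<theta> * \<xi>\<^sup>2) * (nrm l v)\<^sup>2"
      using l \<theta> by (intro mult_right_mono power_mono) auto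
    finally show ?thesis by (simp add: e_def power2_eq_square power3_eq_cube mult_ac)
  qed
  have resD: "nrm m (mv l D v) \<le> \<delta> * nrm l v" for v
  proof -
    have "nrm m (mv l D v) \<le> real l * (5 * real n * \<theta> * \<xi>) * nrm l v"
      using l bound by (intro nrm_mv_le D_column) auto
    also have "\<dots> \<le> real n * (5 * real n * \<theta> * \<xi>) * nrm l v"
      using l \<theta> \<xi> by (intro mult_right_mono) auto
    finally show ?thesis by (simp add: \<delta>_def power2_eq_square mult_ac)
  qed
  have lowl: "\<sigma> * nrm l v \<le> nrm m (mv l X v)" and upl: "nrm m (mv l X v) \<le> \<xi> * nrm l v" for v
    using low[of "\<lambda>j. if j < l then v j else 0"] up[of "\<lambda>j. if j < l then v j else 0"]
    by (simp_all add: mv_restrict[OF l] nrm_restrict[OF l])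
  have QR: "(\<Sum>k<l. Q a k * R k j) = X a j + D a j" if "j < l" for a j
    using that l by (simp add: sum_mult_R D_def)
  have e0: "0 \<le> e" using \<theta> by (simp add: e_def)
  have se: "60 * e \<le> 9 * \<sigma>\<^sup>2" using small unfolding e_def by linarith
  have tri': "\<And>i j. i < l \<Longrightarrow> j < i \<Longrightarrow> R i j = 0" using tri l by simp
  have e': "2 * e \<le> \<sigma>\<^sup>2" using se zero_le_power2[of \<sigma>] by linarith
  note * = orthogonality_of_residual[where Q = Q and D = D and w = w and m = m,
    OF \<sigma> \<delta>0 lowl upl tri' gramR e' QR resD]
  have \<delta>\<xi>: "9 * (\<delta> * \<xi>) \<le> 5 * e"
  proof -
    have "\<delta> * \<xi> = 5 * (real n ^ 2 * (\<theta> * \<xi>\<^sup>2))" by (simp add: \<delta>_def power2_eq_square)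
    also have "\<dots> \<le> 5 * (real n ^ 3 * (\<theta> * \<xi>\<^sup>2))"
      using n1 \<theta> by (intro mult_left_mono mult_right_mono power_increasing) auto
    finally show ?thesis by (simp add: e_def mult_ac)
  qed
  have "\<delta> * \<sigma> \<le> \<delta> * \<xi>" using \<delta>0 \<sigma>_le_\<xi> by (rule mult_left_mono[rotated])
  then have "3 * (\<delta> * \<sigma>) \<le> \<sigma> * \<sigma>"
    using \<delta>\<xi> se zero_le_power2[of \<sigma>] unfolding power2_eq_square by linarith
  \<comment> \<open>With \<delta> at most \<sigma> / 3 the factor 3/2 (1 + \<delta> / \<sigma>) is
    at most 2, the very bound assumed for the earlier columns.\<close>
  then have \<delta>\<sigma>: "3 * \<delta> \<le> \<sigma>" using \<sigma> by (simp add: field_simps)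
  then have "3/2 * (1 + \<delta> / \<sigma>) \<le> 2" using \<sigma> by (simp add: field_simps)
  then show "nrm m (mv l Q w) \<le> 2 * nrm l w"
    using *(1) mult_right_mono[of "3/2 * (1 + \<delta> / \<sigma>)" 2 "nrm l w"] by fastforce
  have "\<delta>\<^sup>2 \<le> \<delta> * \<xi>" unfolding power2_eq_square
    using \<delta>\<sigma> \<sigma>_le_\<xi> \<delta>0 by (intro mult_left_mono) auto
  \<comment> \<open>Since \<delta>^2 <= \<delta> \<xi> <= 5/9 e, the sum is at most e + 15/9 e =
    24/9 e; with e = 9 n^3 \<theta> \<xi>^2 the factor 2 / \<sigma>^2 makes it 48.\<close>
  then have "(e + 2 * \<xi> * \<delta> + \<delta>\<^sup>2) * (2 / \<sigma>\<^sup>2) \<le> (24/9 * e) * (2 / \<sigma>\<^sup>2)"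
    using \<delta>\<xi> by (intro mult_right_mono) (auto simp: mult_ac)
  also have "\<dots> = 48 * real n ^ 3 * \<theta> * \<xi>\<^sup>2 / \<sigma>\<^sup>2" by (simp add: e_def)
  finally show "\<bar>(nrm m (mv l Q w))\<^sup>2 - (nrm l w)\<^sup>2\<bar> \<le> 48 * real n ^ 3 * \<theta> * \<xi>\<^sup>2 / \<sigma>\<^sup>2 * (nrm l w)\<^sup>2"
    using *(2) mult_right_mono[OF _ zero_le_power2[of "nrm l w"]] order_trans by blast
qed

lemma Q_column: "k < n \<Longrightarrow> nrm m (\<lambda>a. Q a k) \<le> 2"
proof (induction k rule: less_induct)
  case (less k)
  show ?case
    by (rule column_le[where n = "Suc k"], rule leading_columns(1)) (use less in auto)
qed

lemma Q_norm: "nrm m (mv n Q w) \<le> 2 * nrm n w"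
  and Q_orthogonality:
    "\<bar>(nrm m (mv n Q w))\<^sup>2 - (nrm n w)\<^sup>2\<bar> \<le> 48 * real n ^ 3 * \<theta> * \<xi>\<^sup>2 / \<sigma>\<^sup>2 * (nrm n w)\<^sup>2"
  by (rule leading_columns; use Q_column in simp)+

lemma residual_column:
  assumes "j < n"
  shows "nrm m (\<lambda>a. (\<Sum>k<n. Q a k * R k j) - X a j) \<le> 5 * real n * \<theta> * \<xi>"
proof -
  have "(\<lambda>a. (\<Sum>k<n. Q a k * R k j) - X a j) = (\<lambda>a. D a j)"
    using assms by (simp add: sum_mult_R D_def)
  then show ?thesis using D_column[OF assms] Q_column assms by simp
qed

end

subsection \<open>Rounding errors of the kernels\<close>

lemma fl_error: "fl \<epsilon> x y \<Longrightarrow> \<bar>y - x\<bar> \<le> \<epsilon> * \<bar>x\<bar>"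
  unfolding fl_def by (auto simp: distrib_left abs_mult mult.commute intro!: mult_right_mono)

text \<open>Both operands of an addition are nonempty, so the size of their union exceeds the larger
  of the two sizes by at least 1. That is the room for the new rounding in
  \<open>fl_sum_error\<close>.\<close>

lemma fl_sum_nonempty: "fl_sum \<epsilon> A z \<Longrightarrow> 0 < size A"
  by (induction rule: fl_sum.induct) auto

text \<open>Holds for every bracketing because a summation tree is less deep than its number of
  leaves. If both operands have relative error (1 + \<epsilon>)^k - 1, one more rounded addition
  raises the exponent by 1.\<close>

lemma fl_sum_error:
  assumes "fl_sum \<epsilon> A z" "0 \<le> \<epsilon>"
  shows "\<bar>z - \<Sum>\<^sub># A\<bar> \<le> ((1 + \<epsilon>) ^ size A - 1) * (\<Sum>x\<in>#A. \<bar>x\<bar>)"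
  using assms(1)
proof induction
  case (single x)
  then show ?case using assms(2) by simp
next
  case (plus A a B b c)
  define SA SB where "SA = (\<Sum>x\<in>#A. \<bar>x\<bar>)" and "SB = (\<Sum>x\<in>#B. \<bar>x\<bar>)"
  define k where "k = max (size A) (size B)"
  have sA: "\<bar>\<Sum>\<^sub># A\<bar> \<le> SA" and sB: "\<bar>\<Sum>\<^sub># B\<bar> \<le> SB"
    unfolding SA_def SB_def by (induction A) (auto, induction B, auto)
  have nn: "0 \<le> SA" "0 \<le> SB" using sA sB by linarith+
  have "\<bar>a - \<Sum>\<^sub># A\<bar> \<le> ((1 + \<epsilon>) ^ k - 1) * SA"
    by (rule order_trans[OF plus.IH(1)], unfold SA_def[symmetric], rule mult_right_mono)
      (use assms(2) nn in \<open>auto simp: k_def intro!: power_increasing\<close>)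
  moreover have "\<bar>b - \<Sum>\<^sub># B\<bar> \<le> ((1 + \<epsilon>) ^ k - 1) * SB"
    by (rule order_trans[OF plus.IH(2)], unfold SB_def[symmetric], rule mult_right_mono)
      (use assms(2) nn in \<open>auto simp: k_def intro!: power_increasing\<close>)
  ultimately have e: "\<bar>a + b - (\<Sum>\<^sub># A + \<Sum>\<^sub># B)\<bar> \<le> ((1 + \<epsilon>) ^ k - 1) * (SA + SB)"
    unfolding distrib_left by linarith
  have "\<bar>c - (a + b)\<bar> \<le> \<epsilon> * \<bar>a + b\<bar>" by (rule fl_error) fact
  also have "\<dots> \<le> \<epsilon> * (((1 + \<epsilon>) ^ k - 1) * (SA + SB) + (SA + SB))"
    using e sA sB assms(2) by (intro mult_left_mono) linarith+
  finally have "\<bar>c - (\<Sum>\<^sub># A + \<Sum>\<^sub># B)\<bar> \<le>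
      ((1 + \<epsilon>) ^ k - 1) * (SA + SB) + \<epsilon> * (((1 + \<epsilon>) ^ k - 1) * (SA + SB) + (SA + SB))"
    using e by linarith
  also have "\<dots> = ((1 + \<epsilon>) ^ Suc k - 1) * (SA + SB)" by (simp add: algebra_simps)
  also have "\<dots> \<le> ((1 + \<epsilon>) ^ (size A + size B) - 1) * (SA + SB)"
  proof -
    have "Suc k \<le> size A + size B"
      using fl_sum_nonempty[OF plus.hyps(1)] fl_sum_nonempty[OF plus.hyps(2)] by (auto simp: k_def)
    then show ?thesis
      using assms(2) nn by (intro mult_right_mono diff_right_mono power_increasing) auto
  qed
  finally show ?case by (simp add: SA_def SB_def)
qed

lemma one_plus_power_le:
  assumes "0 \<le> \<epsilon>" "real N * \<epsilon> \<le> 1"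
  shows "(1 + \<epsilon>) ^ N - 1 \<le> 2 * real N * \<epsilon>"
proof -
  define x where "x = real N * \<epsilon>"
  have x: "0 \<le> x" "x \<le> 1" using assms by (simp_all add: x_def)
  have "(1 + \<epsilon>) ^ N \<le> exp \<epsilon> ^ N"
    using assms by (intro power_mono) (auto simp: exp_ge_add_one_self)
  also have "\<dots> = exp x" by (simp add: x_def exp_of_nat_mult)
  also have "\<dots> \<le> 1 + x + x\<^sup>2" using x by (intro exp_bound)
  also have "x\<^sup>2 \<le> x" using x by (simp add: power2_eq_square mult_left_le)
  finally show ?thesis by (simp add: x_def mult_ac)
qed

lemma sum_mset_image_lessThan:
  fixes f :: "nat \<Rightarrow> real"
  shows "\<Sum>\<^sub># (image_mset f (mset_set {..<n})) = (\<Sum>k<n. f k)"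
  by (simp add: sum_unfold_sum_mset)

lemma sum_atMost_split: "(\<Sum>k\<le>i. f k) = (\<Sum>k<i. f k) + (f i :: real)" for i :: nat
  by (simp flip: lessThan_Suc_atMost)

text \<open>N is at least the number of roundings that any entry of a kernel accumulates, so the
  single constant \<gamma> serves all kernels. The bound 1/100 lets second-order terms be absorbed
  into integer constants.\<close>

locale rounding =
  fixes \<epsilon> \<gamma> :: real and N :: nat
  assumes \<epsilon>: "0 \<le> \<epsilon>" and N: "0 < N" and power_bound: "(1 + \<epsilon>) ^ N - 1 \<le> \<gamma>" and \<gamma>_small: "\<gamma> \<le> 1/100"
begin

lemma power_le: "k \<le> N \<Longrightarrow> (1 + \<epsilon>) ^ k - 1 \<le> \<gamma>"
  using power_bound power_increasing[of k N "1 + \<epsilon>"] \<epsilon> by simp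

lemma \<epsilon>_le_\<gamma>: "\<epsilon> \<le> \<gamma>"
  using power_le[of 1] N by simp

lemma \<gamma>_nonneg: "0 \<le> \<gamma>"
  using \<epsilon> \<epsilon>_le_\<gamma> by simp

lemma fl_close: "fl \<epsilon> x y \<Longrightarrow> \<bar>y - x\<bar> \<le> \<gamma> * \<bar>x\<bar>"
  using fl_error mult_right_mono[OF \<epsilon>_le_\<gamma>] order_trans abs_ge_zero by blast

lemma rounded_products:
  assumes "\<forall>k<n. fl \<epsilon> (x k * y k) (w k)"
  shows "\<bar>(\<Sum>k<n. w k) - (\<Sum>k<n. x k * y k)\<bar> \<le> \<epsilon> * (\<Sum>k<n. \<bar>x k\<bar> * \<bar>y k\<bar>)"
    and "(\<Sum>k<n. \<bar>w k\<bar>) \<le> (1 + \<epsilon>) * (\<Sum>k<n. \<bar>x k\<bar> * \<bar>y k\<bar>)"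
proof -
  have e: "\<bar>w k - x k * y k\<bar> \<le> \<epsilon> * (\<bar>x k\<bar> * \<bar>y k\<bar>)" if "k < n" for k
    using fl_error[of \<epsilon> "x k * y k" "w k"] assms that by (simp add: abs_mult)
  have "\<bar>(\<Sum>k<n. w k) - (\<Sum>k<n. x k * y k)\<bar> \<le> (\<Sum>k<n. \<bar>w k - x k * y k\<bar>)"
    unfolding sum_subtractf[symmetric] by (rule sum_abs)
  also have "\<dots> \<le> (\<Sum>k<n. \<epsilon> * (\<bar>x k\<bar> * \<bar>y k\<bar>))" using e by (intro sum_mono) auto
  finally show "\<bar>(\<Sum>k<n. w k) - (\<Sum>k<n. x k * y k)\<bar> \<le> \<epsilon> * (\<Sum>k<n. \<bar>x k\<bar> * \<bar>y k\<bar>)"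
    by (simp add: sum_distrib_left)
  have "\<bar>w k\<bar> \<le> (1 + \<epsilon>) * (\<bar>x k\<bar> * \<bar>y k\<bar>)" if "k < n" for k
    using e[OF that] unfolding abs_mult[symmetric] distrib_right by linarith
  then have "(\<Sum>k<n. \<bar>w k\<bar>) \<le> (\<Sum>k<n. (1 + \<epsilon>) * (\<bar>x k\<bar> * \<bar>y k\<bar>))" by (intro sum_mono) auto
  then show "(\<Sum>k<n. \<bar>w k\<bar>) \<le> (1 + \<epsilon>) * (\<Sum>k<n. \<bar>x k\<bar> * \<bar>y k\<bar>)"
    by (simp add: sum_distrib_left)
qed

text \<open>The summation bound has exponent n and the rounded products add 1; hence
  \<open>n < N\<close>. With an additional summand \<open>a\<close>, as in
  \<open>fl_minus_dot_close\<close>, the exponent becomes n + 2.\<close>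

lemma fl_dot_close:
  assumes "fl_dot \<epsilon> n x y z" "n < N"
  shows "\<bar>z - (\<Sum>k<n. x k * y k)\<bar> \<le> \<gamma> * (\<Sum>k<n. \<bar>x k\<bar> * \<bar>y k\<bar>)"
proof -
  define S where "S = (\<Sum>k<n. \<bar>x k\<bar> * \<bar>y k\<bar>)"
  have S: "0 \<le> S" by (simp add: S_def sum_nonneg)
  obtain w where w: "\<forall>k<n. fl \<epsilon> (x k * y k) (w k)"
    and z: "fl_sum \<epsilon> (image_mset w (mset_set {..<n})) z"
    using assms(1) unfolding fl_dot_def by blast
  have "\<bar>z - (\<Sum>k<n. w k)\<bar> \<le> ((1 + \<epsilon>) ^ n - 1) * (\<Sum>k<n. \<bar>w k\<bar>)"
    using fl_sum_error[OF z \<epsilon>] by (simp add: sum_unfold_sum_mset image_mset.compositionality comp_def)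
  also have "\<dots> \<le> ((1 + \<epsilon>) ^ n - 1) * ((1 + \<epsilon>) * S)"
    using rounded_products(2)[OF w] \<epsilon> unfolding S_def by (intro mult_left_mono) auto
  finally have "\<bar>z - (\<Sum>k<n. x k * y k)\<bar> \<le> ((1 + \<epsilon>) ^ n - 1) * ((1 + \<epsilon>) * S) + \<epsilon> * S"
    using rounded_products(1)[OF w] unfolding S_def by linarith
  also have "\<dots> = ((1 + \<epsilon>) ^ Suc n - 1) * S" by (simp add: algebra_simps)
  also have "\<dots> \<le> \<gamma> * S" using assms(2) S by (intro mult_right_mono power_le) auto
  finally show ?thesis by (simp add: S_def)
qed

lemma fl_minus_dot_close:
  assumes "fl_minus_dot \<epsilon> n a x y z" "Suc n < N"
  shows "\<bar>z - (a - (\<Sum>k<n. x k * y k))\<bar> \<le> \<gamma> * (\<bar>a\<bar> + (\<Sum>k<n. \<bar>x k\<bar> * \<bar>y k\<bar>))"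
proof -
  define S where "S = (\<Sum>k<n. \<bar>x k\<bar> * \<bar>y k\<bar>)"
  have S: "0 \<le> S" by (simp add: S_def sum_nonneg)
  obtain w where w: "\<forall>k<n. fl \<epsilon> (x k * y k) (w k)"
    and z: "fl_sum \<epsilon> (add_mset a (image_mset (\<lambda>k. - w k) (mset_set {..<n}))) z"
    using assms(1) unfolding fl_minus_dot_def by blast
  have "\<bar>z - (a - (\<Sum>k<n. w k))\<bar> \<le> ((1 + \<epsilon>) ^ Suc n - 1) * (\<bar>a\<bar> + (\<Sum>k<n. \<bar>w k\<bar>))"
    using fl_sum_error[OF z \<epsilon>]
    by (simp add: sum_mset_image_lessThan sum_negf image_mset.compositionality comp_def)
  also have "\<dots> \<le> ((1 + \<epsilon>) ^ Suc n - 1) * ((1 + \<epsilon>) * (\<bar>a\<bar> + S))"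
  proof (rule mult_left_mono)
    \<comment> \<open>The term a is not a rounded product; it receives the factor 1 + \<epsilon>
      only to share a common factor with the others.\<close>
    have "\<bar>a\<bar> \<le> (1 + \<epsilon>) * \<bar>a\<bar>" using \<epsilon> by (simp add: algebra_simps)
    then show "\<bar>a\<bar> + (\<Sum>k<n. \<bar>w k\<bar>) \<le> (1 + \<epsilon>) * (\<bar>a\<bar> + S)"
      using rounded_products(2)[OF w] unfolding S_def distrib_left by linarith
  qed (use \<epsilon> one_le_power[of "1 + \<epsilon>" "Suc n"] in simp)
  finally have "\<bar>z - (a - (\<Sum>k<n. x k * y k))\<bar>
      \<le> ((1 + \<epsilon>) ^ Suc n - 1) * ((1 + \<epsilon>) * (\<bar>a\<bar> + S)) + \<epsilon> * S"
    using rounded_products(1)[OF w] unfolding S_def by linarith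
  also have "\<dots> \<le> ((1 + \<epsilon>) ^ Suc n - 1) * ((1 + \<epsilon>) * (\<bar>a\<bar> + S)) + \<epsilon> * (\<bar>a\<bar> + S)"
    using \<epsilon> by (simp add: mult_left_mono)
  also have "\<dots> = ((1 + \<epsilon>) ^ Suc (Suc n) - 1) * (\<bar>a\<bar> + S)" by (simp add: algebra_simps)
  also have "\<dots> \<le> \<gamma> * (\<bar>a\<bar> + S)" using assms(2) S by (intro mult_right_mono power_le) auto
  finally show ?thesis by (simp add: S_def)
qed

text \<open>Serves both the off-diagonal Cholesky entries and the triangular solve. The inner
  product costs \<gamma>, the division 2 \<gamma>. The error of the division is measured against the
  numerator z and not against q r, so the new unknown does not occur on the right; the
  column-by-column induction relies on this.\<close>

lemma substitution_close:
  assumes z: "fl_minus_dot \<epsilon> n a x y z" and q: "fl \<epsilon> (z / r) q" and "r \<noteq> 0" "Suc n < N"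
  shows "\<bar>(\<Sum>k<n. x k * y k) + q * r - a\<bar> \<le> 3 * \<gamma> * (\<bar>a\<bar> + (\<Sum>k<n. \<bar>x k\<bar> * \<bar>y k\<bar>))"
proof -
  define S where "S = (\<Sum>k<n. \<bar>x k\<bar> * \<bar>y k\<bar>)"
  define B where "B = \<bar>a\<bar> + S"
  have B: "0 \<le> B" by (simp add: B_def S_def sum_nonneg)
  have zB: "\<bar>z - (a - (\<Sum>k<n. x k * y k))\<bar> \<le> \<gamma> * B"
    using fl_minus_dot_close[OF z \<open>Suc n < N\<close>] by (simp add: B_def S_def)
  have "\<bar>\<Sum>k<n. x k * y k\<bar> \<le> S"
    unfolding S_def by (rule order_trans[OF sum_abs]) (simp add: abs_mult)
  moreover have "\<gamma> * B \<le> B" using \<gamma>_small \<gamma>_nonneg B by (simp add: mult_left_le_one_le)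
  ultimately have z2: "\<bar>z\<bar> \<le> 2 * B" using zB B_def by linarith
  have "\<bar>q * r - z\<bar> = \<bar>q - z / r\<bar> * \<bar>r\<bar>"
    using \<open>r \<noteq> 0\<close> by (simp add: left_diff_distrib flip: abs_mult)
  also have "\<dots> \<le> \<gamma> * \<bar>z / r\<bar> * \<bar>r\<bar>" by (rule mult_right_mono[OF fl_close[OF q]]) simp
  also have "\<dots> = \<gamma> * \<bar>z\<bar>" using \<open>r \<noteq> 0\<close> by (simp add: abs_divide)
  also have "\<dots> \<le> \<gamma> * (2 * B)" using z2 \<gamma>_nonneg by (rule mult_left_mono)
  finally show ?thesis using zB unfolding S_def[symmetric] B_def[symmetric] by linarith
qed

text \<open>Squaring the rounded root gives r^2 - z = z \<delta> (2 + \<delta>), so one relative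
  rounding counts about twice; 101/100 times 201/100 is rounded up to 4. The factor 1 + \<delta> is
  positive, so r inherits the sign of the root.\<close>

lemma pivot_close:
  assumes z: "fl_minus_dot \<epsilon> n a x x z" and r: "fl \<epsilon> (sqrt z) r" and "0 < z" "Suc n < N"
  shows "\<bar>(\<Sum>k<n. x k * x k) + r * r - a\<bar> \<le> 5 * \<gamma> * (\<bar>a\<bar> + (\<Sum>k<n. \<bar>x k\<bar> * \<bar>x k\<bar>))"
    and "0 < r"
proof -
  define S where "S = (\<Sum>k<n. \<bar>x k\<bar> * \<bar>x k\<bar>)"
  define B where "B = \<bar>a\<bar> + S"
  have B: "0 \<le> B" by (simp add: B_def S_def sum_nonneg)
  have zB: "\<bar>z - (a - (\<Sum>k<n. x k * x k))\<bar> \<le> \<gamma> * B"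
    using fl_minus_dot_close[OF z \<open>Suc n < N\<close>] by (simp add: B_def S_def)
  have "\<gamma> * B \<le> 1/100 * B" using \<gamma>_small B by (intro mult_right_mono)
  moreover have "\<bar>\<Sum>k<n. x k * x k\<bar> \<le> S"
    unfolding S_def by (rule order_trans[OF sum_abs]) (simp add: abs_mult)
  ultimately have z2: "z \<le> 101/100 * B" using zB B_def by linarith
  obtain \<delta> where "\<bar>\<delta>\<bar> \<le> \<epsilon>" and r_eq: "r = sqrt z * (1 + \<delta>)"
    using r unfolding fl_def by blast
  then have \<delta>: "\<bar>\<delta>\<bar> \<le> \<gamma>" using \<epsilon>_le_\<gamma> by linarith
  show "0 < r" unfolding r_eq using \<delta> \<gamma>_small \<open>0 < z\<close> by (intro mult_pos_pos) auto
  have "r * r - z = z * (\<delta> * (2 + \<delta>))"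
    unfolding r_eq using \<open>0 < z\<close> real_sqrt_mult_self[of z] by (simp add: algebra_simps)
  then have "\<bar>r * r - z\<bar> = z * (\<bar>\<delta>\<bar> * \<bar>2 + \<delta>\<bar>)" using \<open>0 < z\<close> by (simp add: abs_mult)
  also have "\<dots> \<le> 101/100 * B * (\<gamma> * (201/100))"
    using z2 \<delta> \<gamma>_small \<open>0 < z\<close> \<gamma>_nonneg B by (intro mult_mono) auto
  also have "\<dots> \<le> 4 * (\<gamma> * B)" using mult_nonneg_nonneg[OF \<gamma>_nonneg B] by (simp add: mult_ac)
  finally show "\<bar>(\<Sum>k<n. x k * x k) + r * r - a\<bar> \<le> 5 * \<gamma> * (\<bar>a\<bar> + (\<Sum>k<n. \<bar>x k\<bar> * \<bar>x k\<bar>))"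
    using zB unfolding S_def[symmetric] B_def[symmetric] by linarith
qed

text \<open>A completed factorization has positive pivots z, hence positive diagonal entries of R,
  and these are the divisors in the off-diagonal entries. Each entry is then treated on its own,
  without induction or positive definiteness of A.\<close>

lemma fl_chol_close:
  assumes "fl_chol \<epsilon> A R" "i \<le> j" "j < dim_row A" "Suc (dim_row A) < N"
  shows "\<bar>(\<Sum>k\<le>i. R $$ (k, i) * R $$ (k, j)) - A $$ (i, j)\<bar>
     \<le> 5 * \<gamma> * (\<bar>A $$ (i, j)\<bar> + (\<Sum>k<i. \<bar>R $$ (k, i)\<bar> * \<bar>R $$ (k, j)\<bar>))"
    and "0 < R $$ (j, j)"
proof -
  have pos: "0 < R $$ (j, j)" if "j < dim_row A" for j
    using assms(1,4) that pivot_close(2) unfolding fl_chol_def by (meson Suc_less_eq less_trans)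
  then show "0 < R $$ (j, j)" using assms(3) .
  show "\<bar>(\<Sum>k\<le>i. R $$ (k, i) * R $$ (k, j)) - A $$ (i, j)\<bar>
     \<le> 5 * \<gamma> * (\<bar>A $$ (i, j)\<bar> + (\<Sum>k<i. \<bar>R $$ (k, i)\<bar> * \<bar>R $$ (k, j)\<bar>))" (is "_ \<le> 5 * \<gamma> * ?B")
  proof (cases "i = j")
    case True
    obtain z where "0 < z" "fl_minus_dot \<epsilon> j (A $$ (j, j)) (\<lambda>k. R $$ (k, j)) (\<lambda>k. R $$ (k, j)) z"
      "fl \<epsilon> (sqrt z) (R $$ (j, j))"
      using assms unfolding fl_chol_def by blast
    from pivot_close(1)[OF this(2,3,1)] True assms show ?thesis by (simp add: sum_atMost_split)
  next
    case False
    then obtain z where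
      "fl_minus_dot \<epsilon> i (A $$ (i, j)) (\<lambda>k. R $$ (k, i)) (\<lambda>k. R $$ (k, j)) z"
      "fl \<epsilon> (z / R $$ (i, i)) (R $$ (i, j))"
      using assms unfolding fl_chol_def by (metis le_neq_implies_less)
    from substitution_close[OF this] pos[of i] assms
    have "\<bar>(\<Sum>k\<le>i. R $$ (k, i) * R $$ (k, j)) - A $$ (i, j)\<bar> \<le> 3 * \<gamma> * ?B"
      by (simp add: sum_atMost_split mult.commute)
    also have "\<dots> \<le> 5 * \<gamma> * ?B"
      using \<gamma>_nonneg by (intro mult_right_mono) (auto intro!: add_nonneg_nonneg sum_nonneg)
    finally show ?thesis .
  qed
qed

lemma fl_trsolve_close:
  assumes "fl_trsolve \<epsilon> V R Q" "i < dim_row V" "j < dim_col V" "Suc (dim_col V) < N"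
    and "R $$ (j, j) \<noteq> 0"
  shows "\<bar>(\<Sum>k\<le>j. Q $$ (i, k) * R $$ (k, j)) - V $$ (i, j)\<bar>
     \<le> 3 * \<gamma> * (\<bar>V $$ (i, j)\<bar> + (\<Sum>k<j. \<bar>Q $$ (i, k)\<bar> * \<bar>R $$ (k, j)\<bar>))"
proof -
  obtain z where
    "fl_minus_dot \<epsilon> j (V $$ (i, j)) (\<lambda>k. Q $$ (i, k)) (\<lambda>k. R $$ (k, j)) z"
    "fl \<epsilon> (z / R $$ (j, j)) (Q $$ (i, j))"
    using assms unfolding fl_trsolve_def by blast
  from substitution_close[OF this assms(5)] assms(3,4) show ?thesis by (simp add: sum_atMost_split)
qed

end

section \<open>Entrywise errors of one pass in the blocks after the first\<close>

lemma sub_mat_carrier [simp]: "sub_mat A i0 j0 r c \<in> carrier_mat r c"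
  and dim_row_sub_mat [simp]: "dim_row (sub_mat A i0 j0 r c) = r"
  and dim_col_sub_mat [simp]: "dim_col (sub_mat A i0 j0 r c) = c"
  and index_sub_mat [simp]:
    "i < r \<Longrightarrow> j < c \<Longrightarrow> sub_mat A i0 j0 r c $$ (i, j) = A $$ (i0 + i, j0 + j)"
  by (simp_all add: sub_mat_def)

lemma L2_set_subset: "finite B \<Longrightarrow> A \<subseteq> B \<Longrightarrow> L2_set f A \<le> L2_set f B"
  unfolding L2_set_def by (intro real_sqrt_le_mono sum_mono2) auto

lemma fl_chol_dim:
  assumes "fl_chol \<epsilon> A R" shows "dim_row A = dim_row R"
proof -
  have "R \<in> carrier_mat (dim_row A) (dim_row A)"
    using assms unfolding fl_chol_def by (elim conjE)
  then show ?thesis by (rule carrier_matD(1)[symmetric])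
qed

lemma sum_atMost_add: "(\<Sum>k\<le>b + i. f k) = (\<Sum>k<b. f k) + (\<Sum>k\<le>i. f (b + k) :: real)"
  for b i :: nat
  by (induction i) (simp_all flip: lessThan_Suc_atMost)

lemma sum_lessThan_add: "(\<Sum>k<b + i. f k) = (\<Sum>k<b. f k) + (\<Sum>k<i. f (b + k) :: real)"
  for b i :: nat
  by (induction i) simp_all

context rounding
begin

lemma fl_mult_close:
  assumes "fl_mult \<epsilon> A B C" "dim_col A < N" "i < dim_row A" "j < dim_col B"
  shows "\<bar>C $$ (i, j) - (\<Sum>k<dim_col A. A $$ (i, k) * B $$ (k, j))\<bar>
     \<le> \<gamma> * (\<Sum>k<dim_col A. \<bar>A $$ (i, k)\<bar> * \<bar>B $$ (k, j)\<bar>)"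
  using assms unfolding fl_mult_def by (intro fl_dot_close) auto

lemma fl_mult_transpose_close:
  assumes "fl_mult \<epsilon> (transpose_mat A) B C" "dim_row A < N" "i < dim_col A" "j < dim_col B"
  shows "\<bar>C $$ (i, j) - (\<Sum>k<dim_row A. A $$ (k, i) * B $$ (k, j))\<bar>
     \<le> \<gamma> * (nrm (dim_row A) (\<lambda>k. A $$ (k, i)) * nrm (dim_row A) (\<lambda>k. B $$ (k, j)))"
  using fl_mult_close[OF assms(1), of i j] assms(2-)
    mult_left_mono[OF L2_set_mult_ineq[of "\<lambda>k. A $$ (k, i)" "\<lambda>k. B $$ (k, j)" "{..<dim_row A}"] \<gamma>_nonneg]
  by simp

text \<open>One entry of a diagonal block: \<open>a\<close> stands for X^T X, \<open>g\<close> for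
  the part of R^T R from the rows above the block, \<open>C\<close> for the part from the block
  itself, and \<open>t\<close> for the sum in the Cholesky error. The chain C ~ H ~ P - G ~ a - g
  costs 10 + 1.01 + 1 on the first two products and 5 on the third; 13 covers all.\<close>

lemma gram_block_error:
  fixes a g P G H C x\<^sub>i x\<^sub>j r\<^sub>i r\<^sub>j t\<^sub>i t\<^sub>j :: real
  assumes P: "\<bar>P - a\<bar> \<le> \<gamma> * (x\<^sub>i * x\<^sub>j)" and a: "\<bar>a\<bar> \<le> x\<^sub>i * x\<^sub>j"
    and G: "\<bar>G - g\<bar> \<le> \<gamma> * (r\<^sub>i * r\<^sub>j)" and g: "\<bar>g\<bar> \<le> r\<^sub>i * r\<^sub>j"
    and H: "\<bar>H - (P - G)\<bar> \<le> \<gamma> * \<bar>P - G\<bar>"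
    and C: "\<bar>C - H\<bar> \<le> 5 * \<gamma> * (\<bar>H\<bar> + t)" and t: "0 \<le> t" "t \<le> t\<^sub>i * t\<^sub>j"
  shows "\<bar>g + C - a\<bar> \<le> 13 * \<gamma> * (x\<^sub>i * x\<^sub>j + r\<^sub>i * r\<^sub>j + t\<^sub>i * t\<^sub>j)"
proof -
  define x r T where "x = x\<^sub>i * x\<^sub>j" and "r = r\<^sub>i * r\<^sub>j" and "T = t\<^sub>i * t\<^sub>j"
  have nn: "0 \<le> x" "0 \<le> r" "0 \<le> T" using a g t unfolding x_def r_def T_def by linarith+
  have "\<gamma> * x \<le> 1/100 * x" "\<gamma> * r \<le> 1/100 * r"
    using \<gamma>_small nn by (intro mult_right_mono; simp)+
  then have PG: "\<bar>P - G\<bar> \<le> 101/100 * (x + r)"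
    using P G a g unfolding x_def[symmetric] r_def[symmetric] distrib_left by linarith
  have HPG: "\<bar>H - (P - G)\<bar> \<le> \<gamma> * (101/100 * (x + r))"
    using H mult_left_mono[OF PG \<gamma>_nonneg] by linarith
  also have "\<dots> \<le> 1/100 * (101/100 * (x + r))" using \<gamma>_small nn by (intro mult_right_mono) auto
  finally have "\<bar>H\<bar> \<le> 2 * (x + r)" using PG nn unfolding distrib_left by linarith
  then have "\<bar>H\<bar> + t \<le> 2 * (x + r) + T" using t(2) by (simp add: T_def)
  from mult_left_mono[OF this, of "5 * \<gamma>"] C \<gamma>_nonneg
  have "\<bar>C - H\<bar> \<le> 5 * \<gamma> * (2 * (x + r) + T)" by linarith
  moreover have "0 \<le> \<gamma> * x" "0 \<le> \<gamma> * r" "0 \<le> \<gamma> * T" using nn \<gamma>_nonneg by simp_all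
  ultimately show ?thesis using HPG P G unfolding x_def[symmetric] r_def[symmetric] T_def[symmetric]
      distrib_left mult.assoc by linarith
qed

text \<open>Here \<open>c\<close> collects the product of Q and R over previous blocks and
  \<open>d\<close> the part inside the current block, with W ~ c, V ~ x - W and d ~ V. The
  accumulated factors are 7 on |x|, 8.01 on B and 3 on D.\<close>

lemma residual_error:
  fixes x W V B C D :: real
  assumes W: "\<bar>W - c\<bar> \<le> \<gamma> * B" and c: "\<bar>c\<bar> \<le> B" and V: "\<bar>V - (x - W)\<bar> \<le> \<gamma> * \<bar>x - W\<bar>"
    and d: "\<bar>d - V\<bar> \<le> 3 * \<gamma> * (\<bar>V\<bar> + D)" and "0 \<le> D"
  shows "\<bar>c + d - x\<bar> \<le> 9 * \<gamma> * (\<bar>x\<bar> + B + D)"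
proof -
  have B: "0 \<le> B" using c by linarith
  have "\<gamma> * B \<le> 1/100 * B" using \<gamma>_small B by (intro mult_right_mono)
  then have xW: "\<bar>x - W\<bar> \<le> \<bar>x\<bar> + 101/100 * B" using W c by linarith
  have Vx: "\<bar>V - (x - W)\<bar> \<le> \<gamma> * (\<bar>x\<bar> + 101/100 * B)"
    using V mult_left_mono[OF xW \<gamma>_nonneg] by linarith
  also have "\<dots> \<le> 1/100 * (\<bar>x\<bar> + 101/100 * B)" using \<gamma>_small B by (intro mult_right_mono) auto
  finally have "\<bar>V\<bar> \<le> 2 * (\<bar>x\<bar> + B)" using xW B unfolding distrib_left by linarith
  then have "\<bar>V\<bar> + D \<le> 2 * (\<bar>x\<bar> + B) + D" by simp
  from mult_left_mono[OF this, of "3 * \<gamma>"] d \<gamma>_nonneg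
  have "\<bar>d - V\<bar> \<le> 3 * \<gamma> * (2 * (\<bar>x\<bar> + B) + D)" by linarith
  moreover have "0 \<le> \<gamma> * \<bar>x\<bar>" "0 \<le> \<gamma> * B" "0 \<le> \<gamma> * D" using \<gamma>_nonneg B \<open>0 \<le> D\<close> by simp_all
  ultimately show ?thesis using W Vx unfolding distrib_left mult.assoc by linarith
qed

context
  fixes IO s p X Q R m j \<xi>
  assumes pip: "fl_bcgs_pip \<epsilon> IO s p X Q R" and X: "X \<in> carrier_mat m (p * s)" and s: "0 < s"
    and j: "s \<le> j" "j < p * s" and large: "m + p * s + 1 < N"
    and \<xi>: "\<And>j. j < p * s \<Longrightarrow> nrm m (\<lambda>a. X $$ (a, j)) \<le> \<xi>"
begin

lemma fl_bcgs_pip_block: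
  defines "k \<equiv> j div s"
  defines "Xk \<equiv> sub_mat X 0 (k * s) m s"
    and "Qprev \<equiv> sub_mat Q 0 0 m (k * s)"
    and "Qk \<equiv> sub_mat Q 0 (k * s) m s"
    and "Rcol \<equiv> sub_mat R 0 (k * s) (k * s) s"
    and "Rkk \<equiv> sub_mat R (k * s) (k * s) s s"
  obtains P G H W V where "fl_mult \<epsilon> (transpose_mat Qprev) Xk Rcol"
    "fl_mult \<epsilon> (transpose_mat Xk) Xk P" "fl_mult \<epsilon> (transpose_mat Rcol) Rcol G"
    "fl_minus \<epsilon> P G H" "fl_chol \<epsilon> H Rkk" "fl_mult \<epsilon> Qprev Rcol W" "fl_minus \<epsilon> Xk W V"
    "fl_trsolve \<epsilon> V Rkk Qk"
proof -
  have "k \<in> {1..<p}" using j s by (simp add: k_def div_less_iff_less_mult div_greater_zero_iff Suc_le_eq)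
  with pip X have "fl_mult \<epsilon> (transpose_mat Qprev) Xk Rcol \<and>
     (\<exists>P G H. fl_mult \<epsilon> (transpose_mat Xk) Xk P \<and> fl_mult \<epsilon> (transpose_mat Rcol) Rcol G \<and>
        fl_minus \<epsilon> P G H \<and> fl_chol \<epsilon> H Rkk) \<and>
     (\<exists>W V. fl_mult \<epsilon> Qprev Rcol W \<and> fl_minus \<epsilon> Xk W V \<and> fl_trsolve \<epsilon> V Rkk Qk)"
    unfolding fl_bcgs_pip_def Let_def Xk_def Qprev_def Qk_def Rcol_def Rkk_def by auto
  then show ?thesis using that by blast
qed

lemma block_index:
  "j div s * s + j mod s = j" "j mod s < s" "j div s * s + s \<le> p * s" "j div s * s < N" "s + 1 < N" "m < N"
proof -
  show b: "j div s * s + j mod s = j" "j mod s < s" using s by simp_all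
  have "Suc (j div s) \<le> p" using j s by (simp add: Suc_le_eq div_less_iff_less_mult)
  then have "Suc (j div s) * s \<le> p * s" by (rule mult_right_mono) simp
  then show c: "j div s * s + s \<le> p * s" by simp
  show "j div s * s < N" "s + 1 < N" "m < N" using c large by simp_all
qed

lemma earlier_block: "i div s < j div s \<Longrightarrow> i < j div s * s"
  using s by (simp add: div_less_iff_less_mult)

lemma fl_bcgs_pip_proj:
  assumes "i div s < j div s"
  shows "\<bar>R $$ (i, j) - (\<Sum>a<m. Q $$ (a, i) * X $$ (a, j))\<bar> \<le> \<gamma> * \<xi> * nrm m (\<lambda>a. Q $$ (a, i))"
proof -
  obtain P G H W V where *: "fl_mult \<epsilon> (transpose_mat (sub_mat Q 0 0 m (j div s * s)))
      (sub_mat X 0 (j div s * s) m s) (sub_mat R 0 (j div s * s) (j div s * s) s)"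
    using fl_bcgs_pip_block by blast
  have "\<bar>R $$ (i, j) - (\<Sum>a<m. Q $$ (a, i) * X $$ (a, j))\<bar>
     \<le> \<gamma> * (nrm m (\<lambda>a. Q $$ (a, i)) * nrm m (\<lambda>a. X $$ (a, j)))"
    using fl_mult_transpose_close[OF *, of i "j mod s"] earlier_block[OF assms] block_index
    by (simp cong: L2_set_cong_simp)
  also have "\<dots> \<le> \<gamma> * (nrm m (\<lambda>a. Q $$ (a, i)) * \<xi>)"
    using \<xi>[OF j(2)] \<gamma>_nonneg by (intro mult_left_mono) auto
  finally show ?thesis by (simp add: mult_ac)
qed

text \<open>The bound still contains columns of R, split at the top of the diagonal block. The case
  i = j is used next to bound these columns by X.\<close>

lemma fl_bcgs_pip_gram_aux:
  assumes "i \<le> j" "i div s = j div s"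
  defines "b \<equiv> j div s * s"
  shows "\<bar>(\<Sum>k\<le>i. R $$ (k, i) * R $$ (k, j)) - (\<Sum>a<m. X $$ (a, i) * X $$ (a, j))\<bar> \<le> 13 * \<gamma> *
    (nrm m (\<lambda>a. X $$ (a, i)) * nrm m (\<lambda>a. X $$ (a, j))
     + nrm b (\<lambda>k. R $$ (k, i)) * nrm b (\<lambda>k. R $$ (k, j))
     + nrm (Suc (i mod s)) (\<lambda>k. R $$ (b + k, i)) * nrm (Suc (j mod s)) (\<lambda>k. R $$ (b + k, j)))"
proof -
  define i' j' where "i' = i mod s" and "j' = j mod s"
  have j': "b + j' = j" "j' < s" using block_index by (simp_all add: b_def j'_def)
  have i': "b + i' = i" using assms(2) s div_mult_mod_eq[of i s] by (simp add: b_def i'_def)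
  have ij: "i' \<le> j'" "i' < s" using i' j' assms(1) by linarith+
  have bN: "b < N" using block_index by (simp add: b_def)
  obtain P G H where
    P: "fl_mult \<epsilon> (transpose_mat (sub_mat X 0 b m s)) (sub_mat X 0 b m s) P" and
    G: "fl_mult \<epsilon> (transpose_mat (sub_mat R 0 b b s)) (sub_mat R 0 b b s) G" and
    H: "fl_minus \<epsilon> P G H" and C: "fl_chol \<epsilon> H (sub_mat R b b s s)"
    unfolding b_def using fl_bcgs_pip_block by blast
  have Gs: "G \<in> carrier_mat s s" using G by (simp add: fl_mult_def)
  have Hs: "H \<in> carrier_mat s s" using H Gs by (simp add: fl_minus_def)
  have 1: "\<bar>P $$ (i', j') - (\<Sum>a<m. X $$ (a, i) * X $$ (a, j))\<bar>
      \<le> \<gamma> * (nrm m (\<lambda>a. X $$ (a, i)) * nrm m (\<lambda>a. X $$ (a, j)))"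
    using fl_mult_transpose_close[OF P, of i' j'] ij j' i' block_index(6)
    by (simp cong: L2_set_cong_simp)
  have 2: "\<bar>G $$ (i', j') - (\<Sum>k<b. R $$ (k, i) * R $$ (k, j))\<bar>
      \<le> \<gamma> * (nrm b (\<lambda>k. R $$ (k, i)) * nrm b (\<lambda>k. R $$ (k, j)))"
    using fl_mult_transpose_close[OF G, of i' j'] ij j' i' bN
    by (simp cong: L2_set_cong_simp)
  have 3: "\<bar>H $$ (i', j') - (P $$ (i', j') - G $$ (i', j'))\<bar> \<le> \<gamma> * \<bar>P $$ (i', j') - G $$ (i', j')\<bar>"
    using H Gs ij j' unfolding fl_minus_def by (intro fl_close) auto
  have 4: "\<bar>(\<Sum>k\<le>i'. R $$ (b + k, i) * R $$ (b + k, j)) - H $$ (i', j')\<bar>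
      \<le> 5 * \<gamma> * (\<bar>H $$ (i', j')\<bar> + (\<Sum>k<i'. \<bar>R $$ (b + k, i)\<bar> * \<bar>R $$ (b + k, j)\<bar>))"
    using fl_chol_close(1)[OF C ij(1)] Hs ij j' i' block_index(5) by simp
  have "(\<Sum>k<i'. \<bar>R $$ (b + k, i)\<bar> * \<bar>R $$ (b + k, j)\<bar>)
      \<le> nrm i' (\<lambda>k. R $$ (b + k, i)) * nrm i' (\<lambda>k. R $$ (b + k, j))"
    by (rule L2_set_mult_ineq)
  \<comment> \<open>The Cholesky sum stops before row i', but including the diagonal row makes the
    two parts of column j add up to its whole norm when i = j.\<close>
  also have "\<dots> \<le> nrm (Suc i') (\<lambda>k. R $$ (b + k, i)) * nrm (Suc j') (\<lambda>k. R $$ (b + k, j))"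
    using ij by (intro mult_mono L2_set_subset) auto
  finally have 5: "(\<Sum>k<i'. \<bar>R $$ (b + k, i)\<bar> * \<bar>R $$ (b + k, j)\<bar>)
      \<le> nrm (Suc i') (\<lambda>k. R $$ (b + k, i)) * nrm (Suc j') (\<lambda>k. R $$ (b + k, j))" .
  have "(\<Sum>k\<le>i. R $$ (k, i) * R $$ (k, j)) =
      (\<Sum>k<b. R $$ (k, i) * R $$ (k, j)) + (\<Sum>k\<le>i'. R $$ (b + k, i) * R $$ (b + k, j))"
    using sum_atMost_add[of "\<lambda>k. R $$ (k, i) * R $$ (k, j)" b i'] i' by simp
  with gram_block_error[OF 1 L2_set_cauchy_schwarz 2 L2_set_cauchy_schwarz 3 4 _ 5]
  show ?thesis by (simp add: i'_def j'_def sum_nonneg)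
qed

text \<open>With i = j the previous bound reads |r^2 + t^2 - x^2| <= 0.13 (x^2 + r^2 + t^2). The
  terms in R are absorbed on the left, which leaves r^2 + t^2 <= 2 x^2, and 3/2 exceeds sqrt
  2.\<close>

lemma fl_bcgs_pip_R_column:
  defines "b \<equiv> j div s * s"
  shows "nrm b (\<lambda>k. R $$ (k, j)) \<le> 3/2 * nrm m (\<lambda>a. X $$ (a, j))"
    and "nrm (Suc (j mod s)) (\<lambda>k. R $$ (b + k, j)) \<le> 3/2 * nrm m (\<lambda>a. X $$ (a, j))"
proof -
  define x r t where "x = nrm m (\<lambda>a. X $$ (a, j))" and "r = nrm b (\<lambda>k. R $$ (k, j))"
    and "t = nrm (Suc (j mod s)) (\<lambda>k. R $$ (b + k, j))"
  have bj: "b + j mod s = j" using block_index by (simp add: b_def)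
  have "(\<Sum>k\<le>j. R $$ (k, j) * R $$ (k, j)) = r\<^sup>2 + t\<^sup>2"
    using sum_atMost_add[of "\<lambda>k. R $$ (k, j) * R $$ (k, j)" b "j mod s"] bj
    unfolding r_def t_def L2_set_sq lessThan_Suc_atMost by (simp add: power2_eq_square)
  moreover have "(\<Sum>a<m. X $$ (a, j) * X $$ (a, j)) = x\<^sup>2"
    unfolding x_def L2_set_sq by (simp add: power2_eq_square)
  ultimately have "\<bar>(r\<^sup>2 + t\<^sup>2) - x\<^sup>2\<bar> \<le> 13 * \<gamma> * (x\<^sup>2 + r\<^sup>2 + t\<^sup>2)"
    using fl_bcgs_pip_gram_aux[of j] unfolding b_def[symmetric] r_def[symmetric] t_def[symmetric]
      x_def[symmetric] power2_eq_square by simp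
  also have "\<dots> \<le> 13/100 * (x\<^sup>2 + r\<^sup>2 + t\<^sup>2)" using \<gamma>_small by (intro mult_right_mono) auto
  finally have "r\<^sup>2 + t\<^sup>2 \<le> 2 * x\<^sup>2"
    using zero_le_power2[of x] zero_le_power2[of r] zero_le_power2[of t]
    unfolding distrib_left by linarith
  then have "r\<^sup>2 \<le> (3/2 * x)\<^sup>2" "t\<^sup>2 \<le> (3/2 * x)\<^sup>2"
    using zero_le_power2[of r] zero_le_power2[of t] zero_le_power2[of x]
    unfolding power_mult_distrib power_divide by (simp; linarith)+
  then show "r \<le> 3/2 * x" and "t \<le> 3/2 * x"
    using power2_le_imp_le[of _ "3/2 * x"] by (simp_all add: x_def)
qed

text \<open>The product with previous blocks and the substitution inside the block together account
  for all k < j. The entrywise bound survives taking norms because its right side is a combination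
  of absolute values of columns, to which the triangle inequality applies.\<close>

lemma fl_bcgs_pip_residual:
  "nrm m (\<lambda>a. (\<Sum>k\<le>j. Q $$ (a, k) * R $$ (k, j)) - X $$ (a, j))
     \<le> 9 * \<gamma> * (\<xi> + (\<Sum>k<j. nrm m (\<lambda>a. Q $$ (a, k)) * \<bar>R $$ (k, j)\<bar>))"
proof -
  define b j' where "b = j div s * s" and "j' = j mod s"
  have j': "b + j' = j" "j' < s" using block_index by (simp_all add: b_def j'_def)
  have bN: "b < N" using block_index by (simp add: b_def)
  obtain H W V where C: "fl_chol \<epsilon> H (sub_mat R b b s s)"
    and W: "fl_mult \<epsilon> (sub_mat Q 0 0 m b) (sub_mat R 0 b b s) W"
    and V: "fl_minus \<epsilon> (sub_mat X 0 b m s) W V"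
    and S: "fl_trsolve \<epsilon> V (sub_mat R b b s s) (sub_mat Q 0 b m s)"
    unfolding b_def using fl_bcgs_pip_block by blast
  have Ws: "W \<in> carrier_mat m s" using W by (simp add: fl_mult_def)
  have Vs: "V \<in> carrier_mat m s" using V Ws by (simp add: fl_minus_def)
  have Hs: "dim_row H = s" using fl_chol_dim[OF C] by simp
  have pos: "0 < R $$ (j, j)" using fl_chol_close(2)[OF C order_refl, of j'] Hs j' block_index(5) by simp
  have entry: "\<bar>(\<Sum>k\<le>j. Q $$ (a, k) * R $$ (k, j)) - X $$ (a, j)\<bar>
      \<le> 9 * \<gamma> * (\<bar>X $$ (a, j)\<bar> + (\<Sum>k<j. \<bar>R $$ (k, j)\<bar> * \<bar>Q $$ (a, k)\<bar>))" if a: "a < m" for a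
  proof -
    have 1: "\<bar>W $$ (a, j') - (\<Sum>k<b. Q $$ (a, k) * R $$ (k, j))\<bar>
        \<le> \<gamma> * (\<Sum>k<b. \<bar>Q $$ (a, k)\<bar> * \<bar>R $$ (k, j)\<bar>)"
      using fl_mult_close[OF W, of a j'] a j' bN by simp
    have 2: "\<bar>\<Sum>k<b. Q $$ (a, k) * R $$ (k, j)\<bar> \<le> (\<Sum>k<b. \<bar>Q $$ (a, k)\<bar> * \<bar>R $$ (k, j)\<bar>)"
      by (rule order_trans[OF sum_abs]) (simp add: abs_mult)
    have "fl \<epsilon> (sub_mat X 0 b m s $$ (a, j') - W $$ (a, j')) (V $$ (a, j'))"
      using V Ws a j' unfolding fl_minus_def by auto
    then have 3: "\<bar>V $$ (a, j') - (X $$ (a, j) - W $$ (a, j'))\<bar> \<le> \<gamma> * \<bar>X $$ (a, j) - W $$ (a, j')\<bar>"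
      using a j' by (intro fl_close) simp
    have 4: "\<bar>(\<Sum>k\<le>j'. Q $$ (a, b + k) * R $$ (b + k, j)) - V $$ (a, j')\<bar>
        \<le> 3 * \<gamma> * (\<bar>V $$ (a, j')\<bar> + (\<Sum>k<j'. \<bar>Q $$ (a, b + k)\<bar> * \<bar>R $$ (b + k, j)\<bar>))"
      using fl_trsolve_close[OF S, of a j'] Vs a j' pos block_index(5) by simp
    have "(\<Sum>k\<le>j. Q $$ (a, k) * R $$ (k, j)) = (\<Sum>k<b. Q $$ (a, k) * R $$ (k, j))
        + (\<Sum>k\<le>j'. Q $$ (a, b + k) * R $$ (b + k, j))"
      using sum_atMost_add[of "\<lambda>k. Q $$ (a, k) * R $$ (k, j)" b j'] j' by simp
    moreover have "(\<Sum>k<j. \<bar>R $$ (k, j)\<bar> * \<bar>Q $$ (a, k)\<bar>) = (\<Sum>k<b. \<bar>Q $$ (a, k)\<bar> * \<bar>R $$ (k, j)\<bar>)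
        + (\<Sum>k<j'. \<bar>Q $$ (a, b + k)\<bar> * \<bar>R $$ (b + k, j)\<bar>)"
      using sum_lessThan_add[of "\<lambda>k. \<bar>R $$ (k, j)\<bar> * \<bar>Q $$ (a, k)\<bar>" b j'] j' by (simp add: mult.commute)
    ultimately show ?thesis
      using residual_error[OF 1 2 3 4] by (simp add: sum_nonneg add.assoc)
  qed
  have "nrm m (\<lambda>a. (\<Sum>k\<le>j. Q $$ (a, k) * R $$ (k, j)) - X $$ (a, j))
      \<le> nrm m (\<lambda>a. 9 * \<gamma> * (\<bar>X $$ (a, j)\<bar> + (\<Sum>k<j. \<bar>R $$ (k, j)\<bar> * \<bar>Q $$ (a, k)\<bar>)))"
    using entry by (intro L2_set_abs_mono) auto
  also have "\<dots> = 9 * \<gamma> * nrm m (\<lambda>a. \<bar>X $$ (a, j)\<bar> + (\<Sum>k<j. \<bar>R $$ (k, j)\<bar> * \<bar>Q $$ (a, k)\<bar>))"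
    using \<gamma>_nonneg by (simp add: L2_set_scale)
  also have "\<dots> \<le> 9 * \<gamma> * (\<xi> + (\<Sum>k<j. nrm m (\<lambda>a. Q $$ (a, k)) * \<bar>R $$ (k, j)\<bar>))"
  proof (rule mult_left_mono)
    have "nrm m (\<lambda>a. \<Sum>k<j. \<bar>R $$ (k, j)\<bar> * \<bar>Q $$ (a, k)\<bar>)
        \<le> (\<Sum>k<j. \<bar>\<bar>R $$ (k, j)\<bar>\<bar> * nrm m (\<lambda>a. \<bar>Q $$ (a, k)\<bar>))"
      by (rule L2_set_sum_le)
    then show "nrm m (\<lambda>a. \<bar>X $$ (a, j)\<bar> + (\<Sum>k<j. \<bar>R $$ (k, j)\<bar> * \<bar>Q $$ (a, k)\<bar>))
        \<le> \<xi> + (\<Sum>k<j. nrm m (\<lambda>a. Q $$ (a, k)) * \<bar>R $$ (k, j)\<bar>)"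
      using \<xi>[OF j(2)] L2_set_triangle_ineq[of "\<lambda>a. \<bar>X $$ (a, j)\<bar>"
          "\<lambda>a. \<Sum>k<j. \<bar>R $$ (k, j)\<bar> * \<bar>Q $$ (a, k)\<bar>" "{..<m}"]
      by (simp add: mult.commute)
  qed (use \<gamma>_nonneg in simp)
  finally show ?thesis .
qed

end

text \<open>Stated outside the context of a fixed column because the bound on the columns of R is
  applied to i as well as to j.\<close>

lemma fl_bcgs_pip_gram:
  assumes pip: "fl_bcgs_pip \<epsilon> IO s p X Q R" and X: "X \<in> carrier_mat m (p * s)" and s: "0 < s"
    and j: "s \<le> j" "j < p * s" and large: "m + p * s + 1 < N"
    and \<xi>: "\<And>j. j < p * s \<Longrightarrow> nrm m (\<lambda>a. X $$ (a, j)) \<le> \<xi>"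
    and i: "i \<le> j" "i div s = j div s"
  shows "\<bar>(\<Sum>k\<le>i. R $$ (k, i) * R $$ (k, j)) - (\<Sum>a<m. X $$ (a, i) * X $$ (a, j))\<bar> \<le> 72 * \<gamma> * \<xi>\<^sup>2"
proof -
  define x where "x i = nrm m (\<lambda>a. X $$ (a, i))" for i
  \<comment> \<open>Sharing the block of j keeps i out of the first block, so the estimates for
    later columns apply to it too.\<close>
  have "1 \<le> i div s" using i j s by (simp add: div_greater_zero_iff Suc_le_eq)
  then have ib: "s \<le> i" "i < p * s" using i j s div_less[of i s] by (auto simp: not_less[symmetric])
  have \<xi>0: "0 \<le> \<xi>" using \<xi>[OF j(2)] L2_set_nonneg order_trans by blast
  note Ri = fl_bcgs_pip_R_column[OF pip X s ib large \<xi>, folded x_def, unfolded i(2)]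
  note Rj = fl_bcgs_pip_R_column[OF pip X s j large \<xi>, folded x_def]
  have x: "0 \<le> x i" "0 \<le> x j" "x i \<le> \<xi>" "x j \<le> \<xi>" using \<xi> ib j by (simp_all add: x_def)
  have xx: "x i * x j \<le> \<xi> * \<xi>" using x \<xi>0 by (intro mult_mono)
  have "\<bar>(\<Sum>k\<le>i. R $$ (k, i) * R $$ (k, j)) - (\<Sum>a<m. X $$ (a, i) * X $$ (a, j))\<bar> \<le> 13 * \<gamma> *
    (x i * x j + nrm (j div s * s) (\<lambda>k. R $$ (k, i)) * nrm (j div s * s) (\<lambda>k. R $$ (k, j))
     + nrm (Suc (i mod s)) (\<lambda>k. R $$ (j div s * s + k, i))
       * nrm (Suc (j mod s)) (\<lambda>k. R $$ (j div s * s + k, j)))"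
    using fl_bcgs_pip_gram_aux[OF pip X s j large \<xi> i] by (simp add: x_def)
  also have "\<dots> \<le> 13 * \<gamma> * (x i * x j + (3/2 * x i) * (3/2 * x j) + (3/2 * x i) * (3/2 * x j))"
    using Ri Rj x \<gamma>_nonneg by (intro mult_left_mono add_mono mult_mono) auto
  \<comment> \<open>The value is 13 (1 + 9/4 + 9/4), rounded up to 72 below.\<close>
  also have "\<dots> = 143/2 * \<gamma> * (x i * x j)" by simp
  also have "\<dots> \<le> 143/2 * \<gamma> * (\<xi> * \<xi>)" using xx \<gamma>_nonneg by (intro mult_left_mono) auto
  also have "\<dots> \<le> 72 * \<gamma> * (\<xi> * \<xi>)" using \<gamma>_nonneg by (intro mult_right_mono) auto
  finally show ?thesis by (simp add: power2_eq_square)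
qed

end

subsection \<open>Spectral norm and condition number\<close>

abbreviation ent :: "real mat \<Rightarrow> nat \<Rightarrow> nat \<Rightarrow> real" where
  "ent A \<equiv> (\<lambda>i j. A $$ (i, j))"

lemma scalar_prod_sum: "w \<in> carrier_vec n \<Longrightarrow> scalar_prod v w = (\<Sum>i<n. v $ i * w $ i)"
  by (simp add: scalar_prod_def lessThan_atLeast0)

lemma vec_norm2_nrm: "v \<in> carrier_vec n \<Longrightarrow> vec_norm2 v = nrm n (\<lambda>i. v $ i)"
  by (simp add: vec_norm2_def L2_set_def scalar_prod_sum power2_eq_square)

lemma vec_norm2_mult:
  assumes "A \<in> carrier_mat m n" "v \<in> carrier_vec n"
  shows "vec_norm2 (A *\<^sub>v v) = nrm m (mv n (ent A) (\<lambda>i. v $ i))"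
proof -
  have "vec_norm2 (A *\<^sub>v v) = nrm m (\<lambda>i. (A *\<^sub>v v) $ i)"
    using assms by (intro vec_norm2_nrm) auto
  also have "\<dots> = nrm m (mv n (ent A) (\<lambda>i. v $ i))"
    using assms by (intro L2_set_cong) (auto simp: mv_def scalar_prod_sum)
  finally show ?thesis .
qed

lemma nrm_vec: "nrm n (\<lambda>i. vec n v $ i) = nrm n v" "mv n A (\<lambda>i. vec n v $ i) = mv n A v"
  by (auto simp: mv_def intro!: L2_set_cong)

lemma nrm_scale: "nrm n (\<lambda>i. c * v i) = \<bar>c\<bar> * nrm n v" "mv n A (\<lambda>i. c * v i) = (\<lambda>i. c * mv n A v i)"
  by (simp_all add: L2_set_scale mv_def sum_distrib_left mult_ac)

lemma spectral_norm_eq: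
  assumes "A \<in> carrier_mat m n"
  shows "spectral_norm A = Sup {nrm m (mv n (ent A) v) | v. nrm n v = 1}"
proof -
  have "{vec_norm2 (A *\<^sub>v v) | v. v \<in> carrier_vec (dim_col A) \<and> vec_norm2 v = 1}
      = {nrm m (mv n (ent A) v) | v. nrm n v = 1}" (is "?L = ?R")
  proof
    show "?L \<subseteq> ?R"
    proof
      fix x assume "x \<in> ?L"
      then obtain v where v: "v \<in> carrier_vec n" "vec_norm2 v = 1" "x = vec_norm2 (A *\<^sub>v v)"
        using assms by auto
      then have "nrm n (\<lambda>i. v $ i) = 1" "x = nrm m (mv n (ent A) (\<lambda>i. v $ i))"
        using vec_norm2_nrm[OF v(1)] vec_norm2_mult[OF assms v(1)] by simp_all
      then show "x \<in> ?R" by blast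
    qed
    show "?R \<subseteq> ?L"
    proof
      fix x assume "x \<in> ?R"
      then obtain v where v: "nrm n v = 1" "x = nrm m (mv n (ent A) v)" by blast
      then have "vec_norm2 (vec n v) = 1" "x = vec_norm2 (A *\<^sub>v vec n v)"
        using vec_norm2_mult[OF assms, of "vec n v"] vec_norm2_nrm[of "vec n v" n] by (simp_all add: nrm_vec)
      then show "x \<in> ?L" using assms by auto
    qed
  qed
  then show ?thesis by (simp add: spectral_norm_def)
qed

lemma spectral_norm_ge:
  assumes "A \<in> carrier_mat m n"
  shows "nrm m (mv n (ent A) v) \<le> spectral_norm A * nrm n v"
proof (cases "nrm n v = 0")
  case True
  then have "\<forall>j<n. v j = 0" by (simp add: L2_set_eq_0_iff)
  then show ?thesis using True by (simp add: mv_def L2_set_def)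
next
  case False
  \<comment> \<open>Only serves to show that the set under the supremum is bounded, so the sum of
    all column norms is good enough.\<close>
  define c where "c = (\<Sum>j<n. nrm m (\<lambda>i. ent A i j))"
  have c: "nrm m (\<lambda>i. ent A i j) \<le> c" if "j < n" for j
    unfolding c_def using that by (intro member_le_sum) auto
  have bdd: "bdd_above {nrm m (mv n (ent A) v) | v. nrm n v = 1}"
  proof (rule bdd_aboveI)
    fix x assume "x \<in> {nrm m (mv n (ent A) v) | v. nrm n v = 1}"
    then obtain v where v: "nrm n v = 1" "x = nrm m (mv n (ent A) v)" by blast
    have "nrm m (mv n (ent A) v) \<le> real n * c * nrm n v" by (rule nrm_mv_le, rule c)
    then show "x \<le> real n * c" using v by simp
  qed
  define w where "w = (\<lambda>i. (1 / nrm n v) * v i)"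
  have "nrm n w = 1" using False unfolding w_def nrm_scale by simp
  then have "nrm m (mv n (ent A) w) \<le> spectral_norm A"
    unfolding spectral_norm_eq[OF assms] by (intro cSup_upper bdd) auto
  then have "nrm m (mv n (ent A) v) / nrm n v \<le> spectral_norm A"
    unfolding w_def nrm_scale by simp
  moreover have "0 < nrm n v" using False by (simp add: less_le)
  ultimately show ?thesis by (simp add: pos_divide_le_eq)
qed

text \<open>A supremum is governed by an upper bound only if the set is nonempty; a unit vector
  exists because n > 0.\<close>

lemma spectral_norm_le:
  assumes "A \<in> carrier_mat m n" "0 < n" "\<And>v. nrm m (mv n (ent A) v) \<le> c * nrm n v"
  shows "spectral_norm A \<le> c"
  unfolding spectral_norm_eq[OF assms(1)]
proof (rule cSup_least)
  show "{nrm m (mv n (ent A) v) | v. nrm n v = 1} \<noteq> {}" using nrm_unit[OF assms(2)] by blast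
next
  fix x assume "x \<in> {nrm m (mv n (ent A) v) | v. nrm n v = 1}"
  then obtain v where "nrm n v = 1" "x = nrm m (mv n (ent A) v)" by blast
  then show "x \<le> c" using assms(3)[of v] by simp
qed

lemma spectral_norm_nonneg:
  assumes "A \<in> carrier_mat m n" "0 < n" shows "0 \<le> spectral_norm A"
proof -
  let ?e = "\<lambda>i. if i = 0 then 1 else 0 :: real"
  have "0 \<le> nrm m (mv n (ent A) ?e)" by simp
  also have "\<dots> \<le> spectral_norm A" using spectral_norm_ge[OF assms(1), of ?e] nrm_unit[OF assms(2)] by simp
  finally show ?thesis .
qed

lemma spectral_norm_le_columns:
  assumes "A \<in> carrier_mat m n" "0 < n" "\<And>j. j < n \<Longrightarrow> nrm m (\<lambda>i. A $$ (i, j)) \<le> c"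
  shows "spectral_norm A \<le> real n * c"
  by (rule spectral_norm_le[OF assms(1,2)], rule nrm_mv_le, rule assms(3))

text \<open>Vectors are functions on the naturals, so the sphere lives in the product topology.
  Forcing the coordinates from n on to be 0 makes it a closed subset of a product of compact sets,
  and Tychonoff applies.\<close>

lemma compact_unit_sphere: "compact {v. (\<forall>i\<ge>n. v i = 0) \<and> nrm n v = 1}"
proof -
  define B where "B i = (if i < n then {-1..1::real} else {0})" for i
  have "compactin (product_topology (\<lambda>_. euclidean) UNIV) (PiE UNIV B)"
    unfolding compactin_PiE by (auto simp: B_def)
  then have "compact (PiE UNIV B)" by (simp add: euclidean_product_topology)
  moreover have "closed {v :: nat \<Rightarrow> real. (\<Sum>i<n. (v i)\<^sup>2) = 1}"
    by (intro closed_Collect_eq continuous_intros continuous_on_product_coordinates)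
  ultimately have "compact (PiE UNIV B \<inter> {v. (\<Sum>i<n. (v i)\<^sup>2) = 1})" by (rule compact_Int_closed)
  also have "PiE UNIV B \<inter> {v. (\<Sum>i<n. (v i)\<^sup>2) = 1} = {v. (\<forall>i\<ge>n. v i = 0) \<and> nrm n v = 1}"
  proof (intro equalityI subsetI)
    fix v assume v: "v \<in> {v. (\<forall>i\<ge>n. v i = 0) \<and> nrm n v = 1}"
    then have "\<bar>v i\<bar> \<le> 1" if "i < n" for i using member_le_nrm[OF that, of v] by simp
    with v show "v \<in> PiE UNIV B \<inter> {v. (\<Sum>i<n. (v i)\<^sup>2) = 1}"
      by (auto simp: B_def PiE_iff abs_le_iff not_less L2_set_def)
  next
    fix v assume v: "v \<in> PiE UNIV B \<inter> {v. (\<Sum>i<n. (v i)\<^sup>2) = 1}"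
    then have "v i \<in> B i" for i by (simp add: PiE_iff)
    then have "v i = 0" if "i \<ge> n" for i using that by (metis B_def not_less singletonD)
    with v show "v \<in> {v. (\<forall>i\<ge>n. v i = 0) \<and> nrm n v = 1}" by (simp add: L2_set_def)
  qed
  finally show ?thesis .
qed

section \<open>Extremal singular values by way of the quadratic form\<close>

definition quad :: "nat \<Rightarrow> (nat \<Rightarrow> nat \<Rightarrow> real) \<Rightarrow> (nat \<Rightarrow> real) \<Rightarrow> real" where
  "quad n M v = (\<Sum>i<n. v i * mv n M v i)"

lemma quad_add:
  assumes "\<And>i j. i < n \<Longrightarrow> j < n \<Longrightarrow> M i j = M j i"
  shows "quad n M (\<lambda>i. v i + t * u i) = quad n M v + 2 * t * (\<Sum>i<n. u i * mv n M v i) + t\<^sup>2 * quad n M u"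
proof -
  have "(\<Sum>i<n. v i * mv n M u i) = (\<Sum>i<n. \<Sum>j<n. v i * M i j * u j)"
    by (simp add: mv_def sum_distrib_left mult_ac)
  also have "\<dots> = (\<Sum>j<n. \<Sum>i<n. v i * M i j * u j)" by (rule sum.swap)
  also have "\<dots> = (\<Sum>j<n. \<Sum>i<n. u j * M j i * v i)"
    using assms by (intro sum.cong refl) (auto simp: mult_ac)
  also have "\<dots> = (\<Sum>i<n. u i * mv n M v i)"
    by (simp add: mv_def sum_distrib_left mult_ac)
  finally have sym: "(\<Sum>i<n. v i * mv n M u i) = (\<Sum>i<n. u i * mv n M v i)" .
  have "mv n M (\<lambda>i. v i + t * u i) i = mv n M v i + t * mv n M u i" for i
    by (simp add: mv_def sum.distrib sum_distrib_left distrib_left mult_ac)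
  then have "quad n M (\<lambda>i. v i + t * u i) = quad n M v + t * (\<Sum>i<n. v i * mv n M u i)
      + t * (\<Sum>i<n. u i * mv n M v i) + t\<^sup>2 * quad n M u"
    by (simp add: quad_def sum.distrib sum_distrib_left algebra_simps power2_eq_square)
  then show ?thesis unfolding sym by simp
qed

lemma quad_eigenvector:
  assumes "\<And>i. i < n \<Longrightarrow> mv n M v i = \<mu> * v i"
  shows "quad n M v = \<mu> * (nrm n v)\<^sup>2"
  unfolding quad_def L2_set_sq using assms
  by (simp add: sum_distrib_left power2_eq_square mult.left_commute)

text \<open>Let v minimize the form on the sphere, with value \<mu>, and let g = M v - \<mu> v.
  Along v + t g the form minus \<mu> times the squared norm equals t (2 |g|^2 + t c), which is
  nonnegative for all t. Small negative t would violate this unless g = 0.\<close>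

lemma rayleigh_minimum:
  assumes n: "0 < n" and sym: "\<And>i j. i < n \<Longrightarrow> j < n \<Longrightarrow> M i j = M j i"
  shows "\<exists>\<mu> v. nrm n v = 1 \<and> (\<forall>i<n. mv n M v i = \<mu> * v i) \<and>
    (\<forall>w. \<mu> * (nrm n w)\<^sup>2 \<le> quad n M w)"
proof -
  let ?S = "{v. (\<forall>i\<ge>n. v i = 0) \<and> nrm n v = 1}"
  have ne: "?S \<noteq> {}" using nrm_unit[OF n] n by (auto intro!: exI[of _ "\<lambda>i. if i = 0 then 1 else 0"])
  have cont: "continuous_on ?S (quad n M)"
    unfolding quad_def[abs_def] mv_def
    by (intro continuous_intros continuous_on_subset[OF continuous_on_product_coordinates]) auto
  obtain v where v: "v \<in> ?S" and min: "\<forall>w\<in>?S. quad n M v \<le> quad n M w"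
    using continuous_attains_inf[OF compact_unit_sphere ne cont] by (elim bexE)
  define \<mu> where "\<mu> = quad n M v"
  have low: "\<mu> * (nrm n w)\<^sup>2 \<le> quad n M w" for w
  proof (cases "nrm n w = 0")
    case True
    then have "\<forall>i<n. w i = 0" by (simp add: L2_set_eq_0_iff)
    then show ?thesis using True by (simp add: quad_def)
  next
    case False
    define c where "c = 1 / nrm n w"
    define u where "u i = (if i < n then c * w i else 0)" for i
    have mvu: "mv n M u = (\<lambda>i. c * mv n M w i)"
      by (simp add: mv_def u_def sum_distrib_left mult_ac)
    have "nrm n u = nrm n (\<lambda>i. c * w i)" by (intro L2_set_cong) (auto simp: u_def)
    also have "\<dots> = 1" unfolding L2_set_scale using False by (simp add: c_def)
    finally have "u \<in> ?S" by (simp add: u_def)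
    from bspec[OF min this] have "\<mu> \<le> quad n M u" by (simp add: \<mu>_def)
    also have "\<dots> = c\<^sup>2 * quad n M w"
      unfolding quad_def mvu by (simp add: u_def sum_distrib_left power2_eq_square mult_ac)
    finally have "\<mu> \<le> quad n M w / (nrm n w)\<^sup>2" by (simp add: c_def power_divide)
    moreover have "0 < (nrm n w)\<^sup>2" using False by simp
    ultimately show ?thesis by (simp add: pos_le_divide_eq)
  qed
  define g where "g i = mv n M v i - \<mu> * v i" for i
  define a where "a = (nrm n g)\<^sup>2"
  define c where "c = quad n M g - \<mu> * a"
  have v1: "nrm n v = 1" using v by simp
  have pos: "0 \<le> t * (2 * a + t * c)" for t
  proof -
    have "(nrm n (\<lambda>i. v i + t * g i))\<^sup>2 = 1 + 2 * t * (\<Sum>i<n. v i * g i) + t\<^sup>2 * a"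
      using L2_set_sq_diff[of v "\<lambda>i. t * g i" "{..<n}"] v1
      by (simp add: L2_set_scale power_mult_distrib a_def sum_distrib_left mult_ac)
    moreover have "quad n M (\<lambda>i. v i + t * g i) = \<mu> + 2 * t * (\<Sum>i<n. g i * mv n M v i) + t\<^sup>2 * quad n M g"
      using quad_add[OF sym] by (simp add: \<mu>_def)
    moreover have "(\<Sum>i<n. g i * mv n M v i) = a + \<mu> * (\<Sum>i<n. v i * g i)"
    proof -
      have "(\<Sum>i<n. g i * mv n M v i) = (\<Sum>i<n. g i * g i + \<mu> * (v i * g i))"
        by (intro sum.cong) (simp_all add: g_def algebra_simps)
      then show ?thesis unfolding sum.distrib sum_distrib_left a_def L2_set_sq
        by (simp add: power2_eq_square)
    qed
    ultimately show ?thesis using low[of "\<lambda>i. v i + t * g i"]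
      by (simp add: c_def algebra_simps power2_eq_square)
  qed
  have "a = 0"
  proof (rule ccontr)
    assume "a \<noteq> 0"
    then have a: "0 < a" by (simp add: a_def)
    \<comment> \<open>Negative, and small enough that |t c| <= a, so 2 a + t c stays positive; the
      added 1 covers c = 0.\<close>
    define t where "t = - (a / (\<bar>c\<bar> + 1))"
    have t: "t < 0" using a by (simp add: t_def add_nonneg_pos)
    have "\<bar>t * c\<bar> = a * (\<bar>c\<bar> / (\<bar>c\<bar> + 1))" using a by (simp add: t_def abs_mult)
    also have "\<dots> \<le> a * 1" using a by (intro mult_left_mono) auto
    finally have "0 < 2 * a + t * c" using a by linarith
    from mult_neg_pos[OF t this] pos[of t] show False by linarith
  qed
  then have "\<forall>i<n. g i = 0" by (simp add: a_def L2_set_eq_0_iff)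
  then have "\<forall>i<n. mv n M v i = \<mu> * v i" by (simp add: g_def)
  with v1 low show ?thesis by (intro exI[of _ \<mu>] exI[of _ v] conjI) simp_all
qed

lemma gram_entry:
  assumes "A \<in> carrier_mat m n" "i < n" "j < n"
  shows "(transpose_mat A * A) $$ (i, j) = (\<Sum>a<m. A $$ (a, i) * A $$ (a, j))"
  using assms by (simp add: scalar_prod_def lessThan_atLeast0)

lemma mult_mat_vec_sum:
  "A \<in> carrier_mat m n \<Longrightarrow> v \<in> carrier_vec n \<Longrightarrow> i < m \<Longrightarrow> (A *\<^sub>v v) $ i = (\<Sum>j<n. A $$ (i, j) * v $ j)"
  by (simp add: scalar_prod_sum)

lemma gram_mult_vec:
  assumes "A \<in> carrier_mat m n" "v \<in> carrier_vec n" "i < n"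
  shows "(transpose_mat A * A *\<^sub>v v) $ i = mv n (\<lambda>i j. \<Sum>a<m. A $$ (a, i) * A $$ (a, j)) (\<lambda>i. v $ i) i"
proof -
  have "(transpose_mat A * A *\<^sub>v v) $ i = (\<Sum>j<n. (transpose_mat A * A) $$ (i, j) * v $ j)"
    by (rule mult_mat_vec_sum) (use assms in auto)
  also have "\<dots> = (\<Sum>j<n. (\<Sum>a<m. A $$ (a, i) * A $$ (a, j)) * v $ j)"
    using assms by (intro sum.cong refl) (simp only: lessThan_iff gram_entry)
  finally show ?thesis by (simp add: mv_def)
qed

text \<open>The case of \<open>gram_diff\<close> in which the second matrix has no rows.\<close>

lemma quad_gram: "quad n (\<lambda>i j. \<Sum>a<m. A a i * A a j) v = (nrm m (mv n A v))\<^sup>2"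
  using gram_diff[where l = m and A = A and m = 0 and n = n and v = v]
  by (simp add: quad_def mv_def L2_set_def sum_distrib_left mult_ac)

lemma singular_value_iff:
  assumes A: "A \<in> carrier_mat m n"
  shows "\<sigma> \<in> singular_values A \<longleftrightarrow> 0 \<le> \<sigma> \<and> (\<exists>v. nrm n v \<noteq> 0 \<and>
    (\<forall>i<n. mv n (\<lambda>i j. \<Sum>a<m. A $$ (a, i) * A $$ (a, j)) v i = \<sigma>\<^sup>2 * v i))"
    (is "_ \<longleftrightarrow> 0 \<le> \<sigma> \<and> (\<exists>v. ?P v)")
proof -
  have dims: "dim_row (transpose_mat A * A) = n" using A by simp
  have "(\<exists>v. ?P v) \<longleftrightarrow> eigenvalue (transpose_mat A * A) (\<sigma>\<^sup>2)"
  proof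
    assume "\<exists>v. ?P v"
    then obtain v where v: "?P v" by blast
    have "eigenvector (transpose_mat A * A) (vec n v) (\<sigma>\<^sup>2)"
      unfolding eigenvector_def dims
    proof (intro conjI)
      show "vec n v \<noteq> 0\<^sub>v n"
      proof
        assume "vec n v = 0\<^sub>v n"
        then have "\<forall>i<n. v i = 0" by (metis index_vec index_zero_vec(1))
        then show False using v by (simp add: L2_set_def)
      qed
      show "transpose_mat A * A *\<^sub>v vec n v = \<sigma>\<^sup>2 \<cdot>\<^sub>v vec n v"
      proof (rule eq_vecI)
        fix i assume "i < dim_vec (\<sigma>\<^sup>2 \<cdot>\<^sub>v vec n v)"
        then have i: "i < n" by simp
        show "(transpose_mat A * A *\<^sub>v vec n v) $ i = (\<sigma>\<^sup>2 \<cdot>\<^sub>v vec n v) $ i"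
          using v i gram_mult_vec[OF A vec_carrier i] by (simp add: nrm_vec)
      qed (use A in simp)
    qed simp
    then show "eigenvalue (transpose_mat A * A) (\<sigma>\<^sup>2)" unfolding eigenvalue_def by blast
  next
    assume "eigenvalue (transpose_mat A * A) (\<sigma>\<^sup>2)"
    then obtain v where v: "v \<in> carrier_vec n" "v \<noteq> 0\<^sub>v n"
        "transpose_mat A * A *\<^sub>v v = \<sigma>\<^sup>2 \<cdot>\<^sub>v v"
      unfolding eigenvalue_def eigenvector_def dims by blast
    have "nrm n (\<lambda>i. v $ i) \<noteq> 0"
    proof
      assume "nrm n (\<lambda>i. v $ i) = 0"
      then have "\<forall>i<n. v $ i = 0" by (simp add: L2_set_eq_0_iff)
      then have "v = 0\<^sub>v n" using v(1) by (intro eq_vecI) auto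
      then show False using v(2) by blast
    qed
    moreover have "mv n (\<lambda>i j. \<Sum>a<m. A $$ (a, i) * A $$ (a, j)) (\<lambda>i. v $ i) i = \<sigma>\<^sup>2 * v $ i" if "i < n" for i
      using gram_mult_vec[OF A v(1) that] v that by simp
    ultimately show "\<exists>v. ?P v" by blast
  qed
  then show ?thesis unfolding singular_values_def by simp
qed

lemma singular_value_attained:
  assumes A: "A \<in> carrier_mat m n" and "\<sigma> \<in> singular_values A"
  obtains v where "0 < nrm n v" "nrm m (mv n (ent A) v) = \<sigma> * nrm n v"
proof -
  obtain v where v: "0 \<le> \<sigma>" "nrm n v \<noteq> 0"
    "\<forall>i<n. mv n (\<lambda>i j. \<Sum>a<m. A $$ (a, i) * A $$ (a, j)) v i = \<sigma>\<^sup>2 * v i"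
    using assms(2) unfolding singular_value_iff[OF A] by blast
  have "(nrm m (mv n (ent A) v))\<^sup>2 = (\<sigma> * nrm n v)\<^sup>2"
    unfolding quad_gram[symmetric] power_mult_distrib using v(3) by (intro quad_eigenvector) auto
  then have "nrm m (mv n (ent A) v) = \<sigma> * nrm n v" using v(1) by (simp add: power2_eq_iff_nonneg)
  moreover have "0 < nrm n v" using v(2) by (simp add: less_le)
  ultimately show thesis using that by blast
qed

text \<open>Their squares are roots of the characteristic polynomial, and squaring is injective on
  nonnegative reals. Finiteness gives \<open>Min\<close> and \<open>Max\<close> in
  \<open>cond2\<close> their meaning.\<close>

lemma singular_values_finite:
  assumes A: "A \<in> carrier_mat m n" shows "finite (singular_values A)"
proof -
  let ?M = "transpose_mat A * A"
  have M: "?M \<in> carrier_mat n n" using A by simp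
  have "finite {x. poly (char_poly ?M) x = 0}"
    using degree_monic_char_poly[OF M] by (intro poly_roots_finite) auto
  then have "finite {x. eigenvalue ?M x}" by (simp add: eigenvalue_root_char_poly[OF M])
  then have "finite ((\<lambda>x. x\<^sup>2) -` {x. eigenvalue ?M x} \<inter> {0..})"
    by (rule finite_vimage_IntI) (auto simp: inj_on_def power2_eq_iff_nonneg)
  then show ?thesis by (rule rev_finite_subset) (auto simp: singular_values_def)
qed

lemma smallest_singular_value:
  assumes A: "A \<in> carrier_mat m n" and n: "0 < n"
  obtains \<sigma> where "\<sigma> \<in> singular_values A" "\<And>w. \<sigma> * nrm n w \<le> nrm m (mv n (ent A) w)"
proof -
  let ?M = "\<lambda>i j. \<Sum>a<m. A $$ (a, i) * A $$ (a, j)"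
  have sym: "?M i j = ?M j i" for i j by (simp add: mult.commute)
  obtain \<mu> v where v: "nrm n v = 1" "\<forall>i<n. mv n ?M v i = \<mu> * v i"
    "\<forall>w. \<mu> * (nrm n w)\<^sup>2 \<le> quad n ?M w"
    using rayleigh_minimum[OF n, of ?M, OF sym] by (elim exE conjE) (rule that)
  have "quad n ?M v = \<mu> * (nrm n v)\<^sup>2"
    by (rule quad_eigenvector) (use v(2) in simp)
  then have \<mu>: "0 \<le> \<mu>" using v(1) zero_le_power2[of "nrm m (mv n (ent A) v)"] unfolding quad_gram by simp
  show thesis
  proof (rule that[of "sqrt \<mu>"])
    show "sqrt \<mu> \<in> singular_values A" unfolding singular_value_iff[OF A] using v(1,2) \<mu> by (intro conjI exI[of _ v]) auto
    show "sqrt \<mu> * nrm n w \<le> nrm m (mv n (ent A) w)" for w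
    proof (rule power2_le_imp_le)
      show "(sqrt \<mu> * nrm n w)\<^sup>2 \<le> (nrm m (mv n (ent A) w))\<^sup>2"
        using spec[OF v(3), of w] \<mu> unfolding quad_gram by (simp add: power_mult_distrib)
    qed simp
  qed
qed

text \<open>The maximum of the form of A^T A is the minimum of the form of -A^T A, so
  \<open>rayleigh_minimum\<close> serves again.\<close>

lemma largest_singular_value:
  assumes A: "A \<in> carrier_mat m n" and n: "0 < n"
  obtains \<sigma> where "\<sigma> \<in> singular_values A" "\<And>w. nrm m (mv n (ent A) w) \<le> \<sigma> * nrm n w"
proof -
  let ?M = "\<lambda>i j. \<Sum>a<m. A $$ (a, i) * A $$ (a, j)"
  have neg: "mv n (\<lambda>i j. - ?M i j) v i = - mv n ?M v i" for v i by (simp add: mv_def sum_negf)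
  then have qneg: "quad n (\<lambda>i j. - ?M i j) v = - quad n ?M v" for v by (simp add: quad_def sum_negf)
  have sym: "- ?M i j = - ?M j i" for i j by (simp add: mult.commute)
  obtain \<mu> v where v: "nrm n v = 1" "\<forall>i<n. mv n (\<lambda>i j. - ?M i j) v i = \<mu> * v i"
    "\<forall>w. \<mu> * (nrm n w)\<^sup>2 \<le> quad n (\<lambda>i j. - ?M i j) w"
    using rayleigh_minimum[OF n, of "\<lambda>i j. - ?M i j", OF sym] by (elim exE conjE) (rule that)
  have v2: "mv n ?M v i = (- \<mu>) * v i" if "i < n" for i using v(2) that neg[of v i] by simp
  have "quad n ?M v = (- \<mu>) * (nrm n v)\<^sup>2"
    using v2 by (rule quad_eigenvector)
  then have \<mu>: "0 \<le> - \<mu>" using v(1) zero_le_power2[of "nrm m (mv n (ent A) v)"] unfolding quad_gram by simp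
  show thesis
  proof (rule that[of "sqrt (- \<mu>)"])
    show "sqrt (- \<mu>) \<in> singular_values A" unfolding singular_value_iff[OF A] using v(1) v2 \<mu> by (intro conjI exI[of _ v]) auto
    show "nrm m (mv n (ent A) w) \<le> sqrt (- \<mu>) * nrm n w" for w
    proof (rule power2_le_imp_le)
      show "(nrm m (mv n (ent A) w))\<^sup>2 \<le> (sqrt (- \<mu>) * nrm n w)\<^sup>2"
        using spec[OF v(3), of w] \<mu> unfolding qneg quad_gram by (simp add: power_mult_distrib)
    qed (use \<mu> in simp)
  qed
qed

text \<open>From a finite condition number only this is extracted: a positive lower bound \<sigma>
  of A whose ratio to the spectral norm does not exceed \<open>cond2 A\<close>.\<close>

lemma cond2_finite:
  assumes A: "A \<in> carrier_mat m n" and n: "0 < n" and fin: "cond2 A \<noteq> \<infinity>"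
  obtains \<sigma> where "0 < \<sigma>" "\<And>v. \<sigma> * nrm n v \<le> nrm m (mv n (ent A) v)"
    "ereal (spectral_norm A / \<sigma>) \<le> cond2 A"
proof -
  obtain \<sigma> where \<sigma>: "\<sigma> \<in> singular_values A" "\<And>w. \<sigma> * nrm n w \<le> nrm m (mv n (ent A) w)"
    using smallest_singular_value[OF A n] by blast
  obtain \<beta> where \<beta>: "\<beta> \<in> singular_values A" "\<And>w. nrm m (mv n (ent A) w) \<le> \<beta> * nrm n w"
    using largest_singular_value[OF A n] by blast
  note finS = singular_values_finite[OF A]
  have Min: "Min (singular_values A) \<in> singular_values A" using finS \<sigma>(1) by (intro Min_in) auto
  then have "Min (singular_values A) \<ge> 0" by (simp add: singular_values_def)
  moreover have ne: "Min (singular_values A) \<noteq> 0" using fin by (auto simp: cond2_def)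
  ultimately have pos: "0 < Min (singular_values A)" by simp
  have le: "Min (singular_values A) \<le> \<sigma>" "\<beta> \<le> Max (singular_values A)" using finS \<sigma>(1) \<beta>(1) by simp_all
  have "spectral_norm A \<le> Max (singular_values A)"
    using spectral_norm_le[OF A n \<beta>(2)] le(2) by simp
  then have "spectral_norm A / \<sigma> \<le> Max (singular_values A) / Min (singular_values A)"
    using pos le spectral_norm_nonneg[OF A n] by (intro frac_le) auto
  then show thesis using that[of \<sigma>] pos le \<sigma>(2) ne by (simp add: cond2_def)
qed

text \<open>Every singular value is attained as a stretching factor of some vector and hence lies in
  [a, b]. This is how the first blocks of X and of U are shown to be admissible inputs of the
  routine.\<close>

lemma cond2_le:
  assumes A: "A \<in> carrier_mat m n" and n: "0 < n" and a: "0 < a"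
    and low: "\<And>v. a * nrm n v \<le> nrm m (mv n (ent A) v)"
    and up: "\<And>v. nrm m (mv n (ent A) v) \<le> b * nrm n v"
  shows "cond2 A \<le> ereal (b / a)"
proof -
  obtain \<sigma> where "\<sigma> \<in> singular_values A" using smallest_singular_value[OF A n] by blast
  then have S: "Min (singular_values A) \<in> singular_values A" "Max (singular_values A) \<in> singular_values A"
    using singular_values_finite[OF A] by (auto intro!: Min_in Max_in)
  have range: "a \<le> \<sigma> \<and> \<sigma> \<le> b" if \<sigma>: "\<sigma> \<in> singular_values A" for \<sigma>
  proof -
    obtain v where v: "0 < nrm n v" "nrm m (mv n (ent A) v) = \<sigma> * nrm n v"
      using singular_value_attained[OF A \<sigma>] by blast
    then show ?thesis using low[of v] up[of v] by simp
  qed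
  have "Max (singular_values A) / Min (singular_values A) \<le> b / a"
    using range[OF S(1)] range[OF S(2)] a by (intro frac_le) auto
  then show ?thesis using range[OF S(1)] a by (simp add: cond2_def)
qed

subsection \<open>Accuracy of one pass\<close>

lemma triangular_sum:
  fixes f :: "nat \<Rightarrow> real"
  assumes "\<And>k. i < k \<Longrightarrow> k < n \<Longrightarrow> f k = 0" "i < n"
  shows "(\<Sum>k<n. f k) = (\<Sum>k\<le>i. f k)"
  using assms by (intro sum.mono_neutral_right) (auto simp: not_le)

text \<open>The residual bound of the routine contains the norm t of its own output Q, while t is in
  turn bounded through the residual: t <= 3/2 (1 + \<delta> / \<sigma>) with \<delta> = \<theta>
  \<xi> (1 + 3/2 t). Because 20 \<theta> \<xi> <= \<sigma>, the feedback factor is below 1 and the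
  inequality solves to t <= 2, which makes \<delta> at most 4 \<theta> \<xi>.\<close>

lemma first_block_accurate:
  assumes X: "X \<in> carrier_mat m s" and Q: "Q \<in> carrier_mat m s" and R: "R \<in> carrier_mat s s"
    and s: "0 < s" and ut: "upper_triangular R"
    and dE: "dE \<in> carrier_mat s s" "transpose_mat R * R = transpose_mat X * X + dE"
      "spectral_norm dE \<le> bE * (spectral_norm X)\<^sup>2"
    and dD: "dD \<in> carrier_mat m s" "Q * R = X + dD"
      "spectral_norm dD \<le> bD * (spectral_norm X + spectral_norm Q * spectral_norm R)"
    and \<theta>: "bE \<le> \<theta>" "bD \<le> \<theta>" "0 \<le> \<theta>" "\<theta> \<le> 1" and \<sigma>: "0 < \<sigma>"
    and low: "\<And>v. \<sigma> * nrm s v \<le> nrm m (mv s (ent X) v)"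
    and up: "\<And>v. nrm m (mv s (ent X) v) \<le> \<xi> * nrm s v"
    and small: "20 * \<theta> * \<xi>\<^sup>2 \<le> \<sigma>\<^sup>2"
  shows "i < s \<Longrightarrow> j < s \<Longrightarrow>
      \<bar>(\<Sum>k<s. R $$ (k, i) * R $$ (k, j)) - (\<Sum>a<m. X $$ (a, i) * X $$ (a, j))\<bar> \<le> \<theta> * \<xi>\<^sup>2"
    and "j < s \<Longrightarrow> nrm m (\<lambda>a. Q $$ (a, j)) \<le> 2"
    and "j < s \<Longrightarrow> nrm m (\<lambda>a. (\<Sum>k<s. Q $$ (a, k) * R $$ (k, j)) - X $$ (a, j)) \<le> 4 * \<theta> * \<xi>"
proof -
  have e0: "nrm s (\<lambda>i. if i = 0 then 1 else 0) = 1" using nrm_unit[OF s] .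
  have \<sigma>\<xi>: "\<sigma> \<le> \<xi>"
    using low[of "\<lambda>i. if i = 0 then 1 else 0"] up[of "\<lambda>i. if i = 0 then 1 else 0"] e0 by simp
  have \<xi>: "0 < \<xi>" using \<sigma> \<sigma>\<xi> by linarith
  define x t r where "x = spectral_norm X" and "t = spectral_norm Q" and "r = spectral_norm R"
  have x: "0 \<le> x" "x \<le> \<xi>" using spectral_norm_nonneg[OF X s] spectral_norm_le[OF X s up] by (simp_all add: x_def)
  have t: "0 \<le> t" using spectral_norm_nonneg[OF Q s] by (simp add: t_def)
  have r0: "0 \<le> r" using spectral_norm_nonneg[OF R s] by (simp add: r_def)
  have E: "dE $$ (i, j) = (\<Sum>k<s. R $$ (k, i) * R $$ (k, j)) - (\<Sum>a<m. X $$ (a, i) * X $$ (a, j))"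
    if "i < s" "j < s" for i j
  proof -
    have "(transpose_mat R * R) $$ (i, j) = (transpose_mat X * X) $$ (i, j) + dE $$ (i, j)"
      unfolding dE(2) using dE(1) X that by simp
    then show ?thesis using gram_entry[OF R that] gram_entry[OF X that] by simp
  qed
  have "spectral_norm dE \<le> bE * x\<^sup>2" using dE(3) by (simp add: x_def)
  also have "\<dots> \<le> \<theta> * \<xi>\<^sup>2" using \<theta> x by (intro mult_mono power_mono) auto
  finally have nE: "spectral_norm dE \<le> \<theta> * \<xi>\<^sup>2" .
  have dEv: "nrm s (mv s (ent dE) v) \<le> \<theta> * \<xi>\<^sup>2 * nrm s v" for v
    by (rule order_trans[OF spectral_norm_ge[OF dE(1)] mult_right_mono[OF nE]]) simp
  show Eij: "\<bar>(\<Sum>k<s. R $$ (k, i) * R $$ (k, j)) - (\<Sum>a<m. X $$ (a, i) * X $$ (a, j))\<bar> \<le> \<theta> * \<xi>\<^sup>2"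
    if "i < s" "j < s" for i j
    using column_le[OF dEv that(2)] member_le_nrm[OF that(1), of "\<lambda>i. dE $$ (i, j)"] E[OF that] by simp
  have gram: "\<bar>(nrm s (mv s (ent R) v))\<^sup>2 - (nrm m (mv s (ent X) v))\<^sup>2\<bar> \<le> \<theta> * \<xi>\<^sup>2 * (nrm s v)\<^sup>2" for v
  proof -
    have "(nrm s (mv s (ent R) v))\<^sup>2 - (nrm m (mv s (ent X) v))\<^sup>2
        = (\<Sum>i<s. \<Sum>j<s. v i * v j * dE $$ (i, j))"
      unfolding gram_diff using E by (intro sum.cong refl) simp
    also have "\<dots> = (\<Sum>i<s. v i * mv s (ent dE) v i)"
      by (simp add: mv_def sum_distrib_left mult_ac)
    finally have "\<bar>(nrm s (mv s (ent R) v))\<^sup>2 - (nrm m (mv s (ent X) v))\<^sup>2\<bar> \<le> nrm s v * nrm s (mv s (ent dE) v)"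
      using L2_set_cauchy_schwarz[of v "mv s (ent dE) v" "{..<s}"] by simp
    also have "\<dots> \<le> nrm s v * (\<theta> * \<xi>\<^sup>2 * nrm s v)" using dEv by (intro mult_left_mono) auto
    finally show ?thesis by (simp add: power2_eq_square mult_ac)
  qed
  have Rup: "nrm s (mv s (ent R) v) \<le> 3/2 * \<xi> * nrm s v" for v
  proof (rule power2_le_imp_le)
    have "(nrm m (mv s (ent X) v))\<^sup>2 \<le> \<xi>\<^sup>2 * (nrm s v)\<^sup>2"
      using power_mono[OF up[of v], of 2] by (simp add: power_mult_distrib)
    moreover have "\<theta> * (\<xi>\<^sup>2 * (nrm s v)\<^sup>2) \<le> 1 * (\<xi>\<^sup>2 * (nrm s v)\<^sup>2)"
      using \<theta> by (intro mult_right_mono) auto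
    ultimately have "(nrm s (mv s (ent R) v))\<^sup>2 \<le> 2 * (\<xi>\<^sup>2 * (nrm s v)\<^sup>2)"
      using gram[of v] unfolding mult.assoc by linarith
    moreover have "0 \<le> \<xi>\<^sup>2 * (nrm s v)\<^sup>2" by simp
    ultimately show "(nrm s (mv s (ent R) v))\<^sup>2 \<le> (3/2 * \<xi> * nrm s v)\<^sup>2"
      unfolding power_mult_distrib power_divide mult.assoc by (simp; linarith)
  qed (use \<xi> in simp)
  have r: "r \<le> 3/2 * \<xi>" using spectral_norm_le[OF R s Rup] by (simp add: r_def)
  \<comment> \<open>t is the norm of a given matrix, hence a fixed real number; inserting it here
    and solving for it afterwards is not circular.\<close>
  define \<delta> where "\<delta> = \<theta> * (\<xi> + t * (3/2 * \<xi>))"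
  have "0 \<le> x + t * r" using x t r0 by simp
  then have "bD * (x + t * r) \<le> \<theta> * (x + t * r)" using \<theta> by (intro mult_right_mono)
  also have "\<dots> \<le> \<delta>" unfolding \<delta>_def
    using \<theta> x t r by (intro mult_left_mono add_mono) auto
  finally have nD: "spectral_norm dD \<le> \<delta>" using dD(3) by (simp add: x_def t_def r_def)
  have res: "nrm m (mv s (ent dD) v) \<le> \<delta> * nrm s v" for v
    by (rule order_trans[OF spectral_norm_ge[OF dD(1)] mult_right_mono[OF nD]]) simp
  have \<delta>0: "0 \<le> \<delta>" using \<theta> \<xi> t by (simp add: \<delta>_def)
  have QR: "(\<Sum>k<s. Q $$ (a, k) * R $$ (k, j)) = X $$ (a, j) + dD $$ (a, j)" if "a < m" "j < s" for a j
  proof -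
    have "(Q * R) $$ (a, j) = X $$ (a, j) + dD $$ (a, j)" unfolding dD(2) using dD(1) X that by simp
    then show ?thesis using Q R that by (simp add: scalar_prod_def lessThan_atLeast0)
  qed
  have tri: "\<And>i j. i < s \<Longrightarrow> j < i \<Longrightarrow> R $$ (i, j) = 0" using ut R by auto
  have e: "2 * (\<theta> * \<xi>\<^sup>2) \<le> \<sigma>\<^sup>2" using small \<theta> zero_le_power2[of \<xi>] mult_nonneg_nonneg[of \<theta> "\<xi>\<^sup>2"]
    unfolding mult.assoc by linarith
  have Qw: "nrm m (mv s (ent Q) w) \<le> 3/2 * (1 + \<delta> / \<sigma>) * nrm s w" for w
    by (rule orthogonality_of_residual(1)[OF \<sigma> \<delta>0 low up tri gram e QR res])
  have t1: "t \<le> 3/2 * (1 + \<delta> / \<sigma>)" unfolding t_def by (rule spectral_norm_le[OF Q s Qw])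
  have "20 * (\<theta> * \<xi>) * \<sigma> \<le> 20 * (\<theta> * \<xi>) * \<xi>" using \<sigma>\<xi> \<theta> \<xi> by (intro mult_left_mono) auto
  also have "\<dots> \<le> \<sigma> * \<sigma>" using small by (simp add: power2_eq_square)
  finally have th: "20 * (\<theta> * \<xi>) \<le> \<sigma>" using \<sigma> by simp
  have "\<delta> = (\<theta> * \<xi>) * (1 + 3/2 * t)" by (simp add: \<delta>_def algebra_simps)
  also have "\<dots> \<le> \<sigma> / 20 * (1 + 3/2 * t)" using th t by (intro mult_right_mono) auto
  finally have "\<delta> / \<sigma> \<le> (1 + 3/2 * t) / 20" using \<sigma> by (simp add: field_simps)
  then have t2: "t \<le> 2" using t1 by (simp add: field_simps)
  show "nrm m (\<lambda>a. Q $$ (a, j)) \<le> 2" if "j < s" for j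
    using column_le[OF spectral_norm_ge[OF Q] that] t2 by (simp add: t_def)
  have "\<delta> = (\<theta> * \<xi>) * (1 + 3/2 * t)" by (simp add: \<delta>_def algebra_simps)
  also have "\<dots> \<le> (\<theta> * \<xi>) * 4" using t2 \<theta> \<xi> by (intro mult_left_mono) auto
  finally have \<delta>4: "\<delta> \<le> 4 * \<theta> * \<xi>" by simp
  show "nrm m (\<lambda>a. (\<Sum>k<s. Q $$ (a, k) * R $$ (k, j)) - X $$ (a, j)) \<le> 4 * \<theta> * \<xi>" if "j < s" for j
  proof -
    have "nrm m (\<lambda>a. (\<Sum>k<s. Q $$ (a, k) * R $$ (k, j)) - X $$ (a, j)) = nrm m (\<lambda>a. dD $$ (a, j))"
      using QR[OF _ that] by (intro L2_set_cong) auto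
    also have "\<dots> \<le> \<delta>" by (rule column_le[OF res that])
    finally show ?thesis using \<delta>4 by simp
  qed
qed

lemma io_accurateD:
  assumes "io_accurate m s K bE bD IO" "X \<in> carrier_mat m s" "cond2 X \<le> K" "IO X = (Q, R)"
  obtains dE dD where "upper_triangular R"
    "dE \<in> carrier_mat s s" "transpose_mat R * R = transpose_mat X * X + dE"
    "spectral_norm dE \<le> bE * (spectral_norm X)\<^sup>2"
    "dD \<in> carrier_mat m s" "Q * R = X + dD"
    "spectral_norm dD \<le> bD * (spectral_norm X + spectral_norm Q * spectral_norm R)"
proof -
  have "\<exists>Q' R'. IO X = (Q', R') \<and> Q' \<in> carrier_mat m s \<and> R' \<in> carrier_mat s s \<and> upper_triangular R' \<and>
      (\<exists>dE\<in>carrier_mat s s. transpose_mat R' * R' = transpose_mat X * X + dE \<and>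
        spectral_norm dE \<le> bE * (spectral_norm X)\<^sup>2) \<and>
      (\<exists>dD\<in>carrier_mat m s. Q' * R' = X + dD \<and>
        spectral_norm dD \<le> bD * (spectral_norm X + spectral_norm Q' * spectral_norm R'))"
    by (rule mp[OF bspec[OF assms(1)[unfolded io_accurate_def] assms(2)] assms(3)])
  then obtain Q' R' dE dD where *: "IO X = (Q', R')" "upper_triangular R'"
    "dE \<in> carrier_mat s s" "transpose_mat R' * R' = transpose_mat X * X + dE"
    "spectral_norm dE \<le> bE * (spectral_norm X)\<^sup>2"
    "dD \<in> carrier_mat m s" "Q' * R' = X + dD"
    "spectral_norm dD \<le> bD * (spectral_norm X + spectral_norm Q' * spectral_norm R')"
    by (elim exE conjE bexE) (rule that)
  have "Q' = Q" "R' = R" using *(1) assms(4) by simp_all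
  then show thesis using that * by simp
qed

lemma mv_sub_mat_first:
  assumes "s \<le> n"
  shows "nrm m (mv s (ent (sub_mat A 0 0 m s)) v) = nrm m (mv n (ent A) (\<lambda>j. if j < s then v j else 0))"
  unfolding mv_restrict[OF assms] by (intro L2_set_cong) (auto simp: mv_def)

context rounding
begin

text \<open>Three sources of zeros: the routine in the first diagonal block, Cholesky in the later
  diagonal blocks, and the blocks explicitly set to zero below them.\<close>

lemma fl_bcgs_pip_triangular:
  assumes pip: "fl_bcgs_pip \<epsilon> IO s p X Q R" and X: "X \<in> carrier_mat m (p * s)" and s: "0 < s"
    and large: "m + p * s + 1 < N" and first: "upper_triangular (sub_mat R 0 0 s s)"
    and ji: "j < i" "i < p * s"
  shows "R $$ (i, j) = 0"
proof (cases "i div s = j div s")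
  case True
  define b where "b = i div s * s"
  have i: "b + i mod s = i" and j: "b + j mod s = j"
    using div_mult_mod_eq[of i s] div_mult_mod_eq[of j s] True by (simp_all add: b_def)
  then have ji': "j mod s < i mod s" "i mod s < s" using ji s by (linarith, simp)
  show ?thesis
  proof (cases "i < s")
    case True
    then show ?thesis using upper_triangularD[OF first ji(1)] ji(1) by simp
  next
    case False
    then have si: "s \<le> i" by simp
    \<comment> \<open>Any common bound on the column norms would do; it is needed only to access the
      block relations.\<close>
    define \<xi> where "\<xi> = (\<Sum>j<p * s. nrm m (\<lambda>a. X $$ (a, j)))"
    have "nrm m (\<lambda>a. X $$ (a, j)) \<le> \<xi>" if "j < p * s" for j
      unfolding \<xi>_def using that by (intro member_le_sum) auto
    from fl_bcgs_pip_block[OF pip X s si ji(2) large this]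
    obtain H where "fl_chol \<epsilon> H (sub_mat R b b s s)" unfolding b_def by blast
    then have "upper_triangular (sub_mat R b b s s)" unfolding fl_chol_def by (elim conjE)
    then have "sub_mat R b b s s $$ (i mod s, j mod s) = 0"
      by (rule upper_triangularD) (use ji' in simp_all)
    then show ?thesis using ji' i j by simp
  qed
next
  case False
  then have lk: "j div s < i div s" using ji by (simp add: div_le_mono le_neq_trans)
  have kp: "i div s < p" using ji s by (simp add: div_less_iff_less_mult)
  have "sub_mat R (i div s * s) (j div s * s) s s = 0\<^sub>m s s"
    using pip lk kp unfolding fl_bcgs_pip_def Let_def by blast
  then have "sub_mat R (i div s * s) (j div s * s) s s $$ (i mod s, j mod s) = 0\<^sub>m s s $$ (i mod s, j mod s)"
    by simp
  then show ?thesis using s by simp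
qed

text \<open>The bridge from floating point to the locale. The largest kernel constant is the 72 of
  the Gram estimate, so 72 \<gamma> <= \<theta> covers the 9 of the residual and the 1 of the
  projection as well.\<close>

lemma fl_bcgs_pip_perturbed:
  assumes pip: "fl_bcgs_pip \<epsilon> IO s p X Q R" and X: "X \<in> carrier_mat m (p * s)" and s: "0 < s" and p: "0 < p"
    and large: "m + p * s + 1 < N"
    and io: "io_accurate m s K bE bD IO" and K: "cond2 (sub_mat X 0 0 m s) \<le> K"
    and \<theta>: "bE \<le> \<theta>" "bD \<le> \<theta>" "72 * \<gamma> \<le> \<theta>" "\<theta> \<le> 1"
    and \<sigma>: "0 < \<sigma>" and low: "\<And>v. \<sigma> * nrm (p * s) v \<le> nrm m (mv (p * s) (ent X) v)"
    and up: "\<And>v. nrm m (mv (p * s) (ent X) v) \<le> \<xi> * nrm (p * s) v"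
    and small: "60 * real (p * s) ^ 3 * \<theta> * \<xi>\<^sup>2 \<le> \<sigma>\<^sup>2"
  shows "perturbed_gram_schmidt (ent X) (ent Q) (ent R) m (p * s) s \<theta> \<sigma> \<xi>"
proof -
  define n where "n = p * s"
  have n: "0 < n" "s \<le> n" using s p by (auto simp: n_def)
  note low = low[folded n_def] and up = up[folded n_def]
  have col: "nrm m (\<lambda>a. X $$ (a, j)) \<le> \<xi>" if "j < p * s" for j
    by (rule column_le[OF up]) (use that n_def in simp)
  have \<xi>: "0 \<le> \<xi>" using order_trans[OF L2_set_nonneg col[of 0]] n by (simp add: n_def)
  have \<theta>0: "0 \<le> \<theta>" using \<theta>(3) \<gamma>_nonneg by linarith
  let ?X = "sub_mat X 0 0 m s" and ?Q = "sub_mat Q 0 0 m s" and ?R = "sub_mat R 0 0 s s"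
  have IO: "IO ?X = (?Q, ?R)" using pip X unfolding fl_bcgs_pip_def Let_def by auto
  obtain dE dD where ut: "upper_triangular ?R"
    and dE: "dE \<in> carrier_mat s s" "transpose_mat ?R * ?R = transpose_mat ?X * ?X + dE"
      "spectral_norm dE \<le> bE * (spectral_norm ?X)\<^sup>2"
    and dD: "dD \<in> carrier_mat m s" "?Q * ?R = ?X + dD"
      "spectral_norm dD \<le> bD * (spectral_norm ?X + spectral_norm ?Q * spectral_norm ?R)"
    by (rule io_accurateD[OF io sub_mat_carrier K IO])
  have low1: "\<sigma> * nrm s v \<le> nrm m (mv s (ent ?X) v)"
    and up1: "nrm m (mv s (ent ?X) v) \<le> \<xi> * nrm s v" for v
    unfolding mv_sub_mat_first[OF n(2)] nrm_restrict[OF n(2), symmetric] by (rule low, rule up)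
  have "1 \<le> real n ^ 3" using n by (intro one_le_power) simp
  then have "20 * (\<theta> * \<xi>\<^sup>2) \<le> 60 * real n ^ 3 * (\<theta> * \<xi>\<^sup>2)"
    using \<theta>0 by (intro mult_right_mono) (linarith, simp)
  then have small1: "20 * \<theta> * \<xi>\<^sup>2 \<le> \<sigma>\<^sup>2" using small unfolding n_def mult.assoc by linarith
  note first = first_block_accurate[OF sub_mat_carrier sub_mat_carrier sub_mat_carrier s ut dE dD
    \<theta>(1,2) \<theta>0 \<theta>(4) \<sigma> low1 up1 small1]
  have tri: "R $$ (i, j) = 0" if "j < i" "i < p * s" for i j
    by (rule fl_bcgs_pip_triangular[OF pip X s large ut that])
  have \<gamma>\<theta>: "9 * \<gamma> \<le> \<theta>" "\<gamma> \<le> \<theta>" using \<theta>(3) \<gamma>_nonneg by linarith+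
  show ?thesis
  proof (unfold_locales, goal_cases)
    \<comment> \<open>The numbered cases 9 to 13 are \<open>gram\<close>, \<open>proj\<close>,
      \<open>first_res\<close>, \<open>first_bound\<close> and \<open>res\<close>.\<close>
    case (9 i j)
    show ?case
    proof (cases "j < s")
      case True
      have "R $$ (k, i) * R $$ (k, j) = 0" if "i < k" "k < s" for k
      proof -
        have "k < p * s" using that(2) n(2) unfolding n_def by linarith
        then show ?thesis using tri[OF that(1)] by simp
      qed
      then have "(\<Sum>k<s. R $$ (k, i) * R $$ (k, j)) = (\<Sum>k\<le>i. R $$ (k, i) * R $$ (k, j))"
        using True 9(1) by (intro triangular_sum) simp_all
      then show ?thesis using first(1)[of i j] True 9 by simp
    next
      case False
      have "72 * \<gamma> * \<xi>\<^sup>2 \<le> \<theta> * \<xi>\<^sup>2" using \<theta>(3) by (intro mult_right_mono) auto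
      then show ?thesis using fl_bcgs_pip_gram[OF pip X s _ 9(2) large col 9(1,3)] False by simp
    qed
  next
    case (10 j i)
    \<comment> \<open>A block with a predecessor is not the first one, so column j is covered by the
      estimates for later blocks.\<close>
    then have "0 < j div s" by linarith
    then have "s \<le> j" by (simp add: div_greater_zero_iff)
    from fl_bcgs_pip_proj[OF pip X s this 10(1) large col 10(2)]
    have "\<bar>R $$ (i, j) - (\<Sum>a<m. Q $$ (a, i) * X $$ (a, j))\<bar> \<le> \<gamma> * \<xi> * nrm m (\<lambda>a. Q $$ (a, i))" .
    also have "\<dots> \<le> \<theta> * \<xi> * nrm m (\<lambda>a. Q $$ (a, i))" using \<gamma>\<theta> \<xi> by (intro mult_right_mono) auto
    finally show ?case .
  next
    case (11 j)
    then show ?case using first(3)[of j] by (simp cong: L2_set_cong_simp)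
  next
    case (12 j)
    then show ?case using first(2)[of j] by (simp cong: L2_set_cong_simp)
  next
    case (13 j)
    have "9 * \<gamma> * (\<xi> + (\<Sum>k<j. nrm m (\<lambda>a. Q $$ (a, k)) * \<bar>R $$ (k, j)\<bar>))
        \<le> \<theta> * (\<xi> + (\<Sum>k<j. nrm m (\<lambda>a. Q $$ (a, k)) * \<bar>R $$ (k, j)\<bar>))"
      using \<gamma>\<theta> \<xi> by (intro mult_right_mono add_nonneg_nonneg sum_nonneg) auto
    then show ?case using fl_bcgs_pip_residual[OF pip X s 13 large col] by linarith
  qed (use \<sigma> \<theta>0 \<theta> n low up tri small in \<open>simp_all add: n_def\<close>)
qed

end

subsection \<open>Polynomials in the dimensions\<close>

lemma dim_poly_const: "0 \<le> k \<Longrightarrow> dim_poly d (\<lambda>_ _. k)"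
  unfolding dim_poly_def
proof (intro exI[of _ "\<lambda>i j. if i = 0 \<and> j = 0 then k else 0"] conjI allI)
  fix m n :: nat
  have "(\<Sum>i\<le>d. \<Sum>j\<le>d. (if i = 0 \<and> j = 0 then k else 0) * real m ^ i * real n ^ j)
      = (\<Sum>i\<le>d. if i = 0 then k else 0)"
    by (intro sum.cong refl) (auto simp: if_distrib[of "\<lambda>x. x * _"] cong: if_cong)
  then show "k = (\<Sum>i\<le>d. \<Sum>j\<le>d. (if i = 0 \<and> j = 0 then k else 0) * real m ^ i * real n ^ j)" by simp
qed simp

lemma dim_poly_add:
  assumes "dim_poly d f" "dim_poly d g" shows "dim_poly d (\<lambda>m n. f m n + g m n)"
proof -
  obtain a b where "\<forall>i j. 0 \<le> a i j" "\<forall>m n. f m n = (\<Sum>i\<le>d. \<Sum>j\<le>d. a i j * real m ^ i * real n ^ j)"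
    "\<forall>i j. 0 \<le> b i j" "\<forall>m n. g m n = (\<Sum>i\<le>d. \<Sum>j\<le>d. b i j * real m ^ i * real n ^ j)"
    using assms unfolding dim_poly_def by blast
  then show ?thesis unfolding dim_poly_def
    by (intro exI[of _ "\<lambda>i j. a i j + b i j"]) (simp add: sum.distrib distrib_right)
qed

lemma dim_poly_scale:
  assumes "dim_poly d f" "0 \<le> k" shows "dim_poly d (\<lambda>m n. k * f m n)"
proof -
  obtain a where "\<forall>i j. 0 \<le> a i j" "\<forall>m n. f m n = (\<Sum>i\<le>d. \<Sum>j\<le>d. a i j * real m ^ i * real n ^ j)"
    using assms(1) unfolding dim_poly_def by blast
  then show ?thesis unfolding dim_poly_def using assms(2)
    by (intro exI[of _ "\<lambda>i j. k * a i j"]) (simp add: sum_distrib_left mult.assoc)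
qed

lemma dim_poly_mono:
  assumes "dim_poly d f" "d \<le> e" shows "dim_poly e f"
proof -
  obtain a where a: "\<forall>i j. 0 \<le> a i j" "\<forall>m n. f m n = (\<Sum>i\<le>d. \<Sum>j\<le>d. a i j * real m ^ i * real n ^ j)"
    using assms(1) unfolding dim_poly_def by blast
  define b where "b i j = (if i \<le> d \<and> j \<le> d then a i j else 0)" for i j
  have "f m n = (\<Sum>i\<le>e. \<Sum>j\<le>e. b i j * real m ^ i * real n ^ j)" for m n
  proof -
    have "f m n = (\<Sum>i\<le>d. \<Sum>j\<le>e. b i j * real m ^ i * real n ^ j)"
      unfolding a(2)[rule_format] using assms(2)
      by (intro sum.cong refl sum.mono_neutral_cong_left) (auto simp: b_def)
    also have "\<dots> = (\<Sum>i\<le>e. \<Sum>j\<le>e. b i j * real m ^ i * real n ^ j)"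
      using assms(2) by (intro sum.mono_neutral_left) (auto simp: b_def intro!: sum.neutral)
    finally show ?thesis .
  qed
  moreover have "\<forall>i j. 0 \<le> b i j" using a(1) by (simp add: b_def)
  ultimately show ?thesis unfolding dim_poly_def by blast
qed

text \<open>Multiplication by m shifts the coefficients by one row. The factor m + 1 is used instead
  of m because it is at least 1, so products of such factors dominate each of them. Linear factors
  suffice for all constants, and general products of polynomials are avoided.\<close>

lemma dim_poly_mult_rows:
  assumes "dim_poly d f" shows "dim_poly (Suc d) (\<lambda>m n. (real m + 1) * f m n)"
proof -
  obtain a where a: "\<forall>i j. 0 \<le> a i j" "\<forall>m n. f m n = (\<Sum>i\<le>d. \<Sum>j\<le>d. a i j * real m ^ i * real n ^ j)"
    using assms(1) unfolding dim_poly_def by blast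
  define b where "b i j = (case i of 0 \<Rightarrow> 0 | Suc i \<Rightarrow> if j \<le> d then a i j else 0)" for i j
  have "real m * f m n = (\<Sum>i\<le>Suc d. \<Sum>j\<le>Suc d. b i j * real m ^ i * real n ^ j)" for m n
  proof -
    have "(\<Sum>j\<le>Suc d. b i j * real m ^ i * real n ^ j) = (\<Sum>j\<le>d. b i j * real m ^ i * real n ^ j)" for i
      by (simp add: b_def split: nat.split)
    then have "(\<Sum>i\<le>Suc d. \<Sum>j\<le>Suc d. b i j * real m ^ i * real n ^ j)
        = (\<Sum>i\<le>d. \<Sum>j\<le>d. b (Suc i) j * real m ^ Suc i * real n ^ j)"
      by (simp only: sum.atMost_Suc_shift[of _ d]) (simp add: b_def)
    also have "\<dots> = (\<Sum>i\<le>d. \<Sum>j\<le>d. real m * (a i j * real m ^ i * real n ^ j))"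
      by (intro sum.cong refl) (simp add: b_def mult_ac)
    finally show ?thesis by (simp only: a(2) sum_distrib_left)
  qed
  moreover have "\<forall>i j. 0 \<le> b i j" using a(1) by (simp add: b_def split: nat.split)
  ultimately have "dim_poly (Suc d) (\<lambda>m n. real m * f m n)" unfolding dim_poly_def by blast
  from dim_poly_add[OF this dim_poly_mono[OF assms, of "Suc d"]] show ?thesis
    by (simp add: distrib_right)
qed

lemma dim_poly_swap:
  assumes "dim_poly d f" shows "dim_poly d (\<lambda>m n. f n m)"
proof -
  obtain a where a: "\<forall>i j. 0 \<le> a i j" "\<forall>m n. f m n = (\<Sum>i\<le>d. \<Sum>j\<le>d. a i j * real m ^ i * real n ^ j)"
    using assms(1) unfolding dim_poly_def by blast
  have "f n m = (\<Sum>i\<le>d. \<Sum>j\<le>d. a j i * real m ^ i * real n ^ j)" for m n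
    unfolding a(2)[rule_format] by (subst sum.swap) (simp add: mult_ac)
  with a(1) show ?thesis unfolding dim_poly_def by (intro exI[of _ "\<lambda>i j. a j i"]) simp
qed

lemma dim_poly_mult_cols:
  assumes "dim_poly d f" shows "dim_poly (Suc d) (\<lambda>m n. (real n + 1) * f m n)"
  using dim_poly_swap[OF dim_poly_mult_rows[OF dim_poly_swap[OF assms]]] .

lemma dim_poly_mult_cols_power:
  assumes "dim_poly d f" shows "dim_poly (d + k) (\<lambda>m n. (real n + 1) ^ k * f m n)"
proof (induction k)
  case (Suc k)
  then show ?case using dim_poly_mult_cols[OF Suc] by (simp add: mult.assoc)
qed (use assms in simp)

subsection \<open>Two passes\<close>

text \<open>Polarization: evaluating the quadratic bound at e_i + e_j and subtracting the two
  diagonal cases leaves 2 |q_i^T q_j| <= 2 c + c + c.\<close>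

lemma orthogonality_entry:
  assumes orth: "\<And>w. \<bar>(nrm m (mv n Q w))\<^sup>2 - (nrm n w)\<^sup>2\<bar> \<le> c * (nrm n w)\<^sup>2" and ij: "i < n" "j < n"
  shows "\<bar>(if i = j then 1 else 0) - (\<Sum>a<m. Q a i * Q a j)\<bar> \<le> 2 * c"
proof -
  let ?e = "\<lambda>j i. if i = j then 1 else 0 :: real"
  have diag: "\<bar>(nrm m (\<lambda>a. Q a j))\<^sup>2 - 1\<bar> \<le> c" if "j < n" for j
    using orth[of "?e j"] by (simp only: nrm_unit[OF that] mv_unit[OF that] power_one mult_1_right)
  show ?thesis
  proof (cases "i = j")
    case True
    have "(\<Sum>a<m. Q a i * Q a j) = (nrm m (\<lambda>a. Q a j))\<^sup>2"
      unfolding L2_set_sq True by (simp add: power2_eq_square)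
    then show ?thesis using diag[OF ij(2)] True by simp
  next
    case False
    have "mv n Q (\<lambda>k. ?e i k + ?e j k) = (\<lambda>a. mv n Q (?e i) a + mv n Q (?e j) a)"
      by (simp only: mv_def distrib_left sum.distrib)
    then have mv: "mv n Q (\<lambda>k. ?e i k + ?e j k) = (\<lambda>a. Q a i + Q a j)"
      by (simp only: mv_unit[OF ij(1)] mv_unit[OF ij(2)])
    have "(\<Sum>k<n. ?e i k * ?e j k) = 0" using False by (intro sum.neutral) auto
    then have e: "(nrm n (\<lambda>k. ?e i k + ?e j k))\<^sup>2 = 2"
      using L2_set_sq_diff[of "?e i" "?e j" "{..<n}"] nrm_unit[OF ij(1)] nrm_unit[OF ij(2)] by simp
    have "\<bar>(nrm m (\<lambda>a. Q a i + Q a j))\<^sup>2 - 2\<bar> \<le> c * 2"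
      using orth[of "\<lambda>k. ?e i k + ?e j k"] unfolding mv e .
    then show ?thesis
      using L2_set_sq_diff[of "\<lambda>a. Q a i" "\<lambda>a. Q a j" "{..<m}"] diag[OF ij(1)] diag[OF ij(2)] False
      by simp
  qed
qed

context rounding
begin

text \<open>With R = T S + h the residual splits as Q R - X = Q h + (Q T - U) S + (U S - X). In
  units of n^2 \<theta> \<xi> the three parts contribute 16 (entries of h at most 8 n \<theta>
  \<xi>, columns of Q at most 2), 20 (residual 10 n \<theta> of the second pass, entries of S at
  most 2 \<xi>) and 5.\<close>

lemma two_pass_residual:
  assumes P1: "perturbed_gram_schmidt (ent X) (ent U) (ent S) m n s \<theta> \<sigma> \<xi>"
    and P2: "perturbed_gram_schmidt (ent U) (ent Q) (ent T) m n s \<theta> (1/2) 2"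
    and T: "T \<in> carrier_mat n n" and S: "S \<in> carrier_mat n n" and R: "fl_mult \<epsilon> T S R"
    and n: "n < N" and \<theta>: "\<gamma> \<le> \<theta>" and j: "j < n"
  shows "nrm m (\<lambda>a. (\<Sum>i<n. Q $$ (a, i) * R $$ (i, j)) - X $$ (a, j)) \<le> 41 * real n ^ 2 * \<theta> * \<xi>"
proof -
  interpret P1: perturbed_gram_schmidt "ent X" "ent U" "ent S" m n s \<theta> \<sigma> \<xi> by (rule P1)
  interpret P2: perturbed_gram_schmidt "ent U" "ent Q" "ent T" m n s \<theta> "1/2" 2 by (rule P2)
  note pos = P1.\<xi> P1.\<theta>
  define D1 where "D1 a = (\<Sum>k<n. U $$ (a, k) * S $$ (k, j)) - X $$ (a, j)" for a
  define D2 where "D2 k a = (\<Sum>i<n. Q $$ (a, i) * T $$ (i, k)) - U $$ (a, k)" for k a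
  define h where "h i = R $$ (i, j) - (\<Sum>k<n. T $$ (i, k) * S $$ (k, j))" for i
  have h: "\<bar>h i\<bar> \<le> 8 * real n * \<theta> * \<xi>" if "i < n" for i
  proof -
    have "\<bar>h i\<bar> \<le> \<gamma> * (\<Sum>k<n. \<bar>T $$ (i, k)\<bar> * \<bar>S $$ (k, j)\<bar>)"
      unfolding h_def using fl_mult_close[OF R, of i j] T S n j that by simp
    also have "\<dots> \<le> \<theta> * (\<Sum>k<n. (2 * 2) * (2 * \<xi>))"
      using \<theta> P1.R_entry P2.R_entry j that pos
      by (intro mult_mono sum_mono sum_nonneg) auto
    finally show ?thesis by (simp add: mult_ac)
  qed
  have eq: "(\<Sum>i<n. Q $$ (a, i) * R $$ (i, j)) - X $$ (a, j)
      = (\<Sum>i<n. h i * Q $$ (a, i)) + ((\<Sum>k<n. S $$ (k, j) * D2 k a) + D1 a)" for a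
  proof -
    have "(\<Sum>i<n. Q $$ (a, i) * R $$ (i, j))
        = (\<Sum>i<n. h i * Q $$ (a, i)) + (\<Sum>i<n. \<Sum>k<n. Q $$ (a, i) * T $$ (i, k) * S $$ (k, j))"
      by (simp add: h_def sum.distrib[symmetric] sum_distrib_left algebra_simps)
    also have "(\<Sum>i<n. \<Sum>k<n. Q $$ (a, i) * T $$ (i, k) * S $$ (k, j))
        = (\<Sum>k<n. (\<Sum>i<n. Q $$ (a, i) * T $$ (i, k)) * S $$ (k, j))"
      by (subst sum.swap) (simp add: sum_distrib_right)
    also have "\<dots> = (\<Sum>k<n. S $$ (k, j) * D2 k a) + (\<Sum>k<n. U $$ (a, k) * S $$ (k, j))"
      unfolding sum.distrib[symmetric] by (intro sum.cong refl) (simp add: D2_def algebra_simps)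
    finally show ?thesis by (simp add: D1_def)
  qed
  have 1: "nrm m (\<lambda>a. \<Sum>i<n. h i * Q $$ (a, i)) \<le> 16 * real n ^ 2 * \<theta> * \<xi>"
  proof -
    have "nrm m (\<lambda>a. \<Sum>i<n. h i * Q $$ (a, i)) \<le> (\<Sum>i<n. \<bar>h i\<bar> * nrm m (\<lambda>a. Q $$ (a, i)))"
      by (rule L2_set_sum_le)
    also have "\<dots> \<le> (\<Sum>i<n. 8 * real n * \<theta> * \<xi> * 2)"
      using h P2.Q_column pos by (intro sum_mono mult_mono) auto
    finally show ?thesis by (simp add: power2_eq_square mult_ac)
  qed
  have 2: "nrm m (\<lambda>a. \<Sum>k<n. S $$ (k, j) * D2 k a) \<le> 20 * real n ^ 2 * \<theta> * \<xi>"
  proof -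
    have "nrm m (\<lambda>a. \<Sum>k<n. S $$ (k, j) * D2 k a) \<le> (\<Sum>k<n. \<bar>S $$ (k, j)\<bar> * nrm m (D2 k))"
      using L2_set_sum_le[of "\<lambda>k. S $$ (k, j)" D2] by simp
    also have "\<dots> \<le> (\<Sum>k<n. 2 * \<xi> * (5 * real n * \<theta> * 2))"
      using P1.R_entry P2.residual_column j pos unfolding D2_def by (intro sum_mono mult_mono) auto
    finally show ?thesis by (simp add: power2_eq_square mult_ac)
  qed
  have "real n * 1 \<le> real n * real n" using j by (intro mult_left_mono) auto
  then have nn: "5 * real n \<le> 5 * real n ^ 2" by (simp add: power2_eq_square)
  have "nrm m D1 \<le> 5 * real n * \<theta> * \<xi>"
    using P1.residual_column[OF j] unfolding D1_def .
  also have "\<dots> \<le> 5 * real n ^ 2 * \<theta> * \<xi>" using nn pos by (intro mult_right_mono) auto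
  finally have 3: "nrm m D1 \<le> 5 * real n ^ 2 * \<theta> * \<xi>" .
  show ?thesis unfolding eq
    using L2_set_triangle_ineq[of "\<lambda>a. \<Sum>i<n. h i * Q $$ (a, i)" "\<lambda>a. (\<Sum>k<n. S $$ (k, j) * D2 k a) + D1 a" "{..<m}"]
      L2_set_triangle_ineq[of "\<lambda>a. \<Sum>k<n. S $$ (k, j) * D2 k a" D1 "{..<m}"] 1 2 3
    by (simp add: mult.assoc)
qed

lemma fl_bcgs_pip_carrier:
  assumes "fl_bcgs_pip \<epsilon> IO s p X Q R" "X \<in> carrier_mat m (p * s)"
  shows "Q \<in> carrier_mat m (p * s)" "R \<in> carrier_mat (p * s) (p * s)"
  using assms unfolding fl_bcgs_pip_def Let_def by auto

text \<open>\<eta> is the loss of orthogonality tolerated after the first pass. It confines the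
  singular values of U to [sqrt (1 - \<eta>), sqrt (1 + \<eta>)], and 1 + \<eta> <= \<tau>^2 (1 -
  \<eta>) says exactly that the quotient of these ends is at most \<tau>. The factor 1000 leaves
  room for the factors 48 and 60 of both passes.\<close>

lemma fl_bcgs_pip_plus_accuracy:
  assumes pip: "fl_bcgs_pip_plus \<epsilon> IO s p X Q R" and X: "X \<in> carrier_mat m (p * s)"
    and s: "0 < s" and p: "0 < p" and large: "m + p * s + 1 < N"
    and io: "io_accurate m s (max (cond2 X) (ereal \<tau>)) bE bD IO"
    and \<theta>: "bE \<le> \<theta>" "bD \<le> \<theta>" "72 * \<gamma> \<le> \<theta>"
    and \<eta>: "0 < \<eta>" "\<eta> \<le> 1/2" "1 + \<eta> \<le> \<tau>\<^sup>2 * (1 - \<eta>)" and \<tau>: "0 < \<tau>"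
    and \<sigma>: "0 < \<sigma>" and low: "\<And>v. \<sigma> * nrm (p * s) v \<le> nrm m (mv (p * s) (ent X) v)"
    and cond: "ereal (spectral_norm X / \<sigma>) \<le> cond2 X"
    and small: "1000 * (real (p * s) ^ 3 * \<theta> * (spectral_norm X)\<^sup>2) \<le> \<eta> * \<sigma>\<^sup>2"
  shows "spectral_norm (1\<^sub>m (p * s) - transpose_mat Q * Q) \<le> 1536 * real (p * s) ^ 5 * \<theta>"
    and "\<exists>dD\<in>carrier_mat m (p * s). Q * R = X + dD \<and>
      spectral_norm dD \<le> 41 * real (p * s) ^ 3 * \<theta> * spectral_norm X"
proof -
  define n where "n = p * s"
  define \<xi> where "\<xi> = spectral_norm X"
  have n: "0 < n" "s \<le> n" using s p by (auto simp: n_def)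
  note X = X[folded n_def] and low = low[folded n_def]
  have n3: "1 \<le> real n ^ 3" using n by (intro one_le_power) simp
  have \<theta>0: "0 \<le> \<theta>" and \<gamma>\<theta>: "\<gamma> \<le> \<theta>" using \<theta>(3) \<gamma>_nonneg by linarith+
  have up: "nrm m (mv n (ent X) v) \<le> \<xi> * nrm n v" for v
    unfolding \<xi>_def by (rule spectral_norm_ge[OF X])
  have \<sigma>\<xi>: "\<sigma> \<le> \<xi>"
    using low[of "\<lambda>i. if i = 0 then 1 else 0"] up[of "\<lambda>i. if i = 0 then 1 else 0"] nrm_unit[OF n(1)]
    by simp
  then have \<sigma>\<xi>2: "\<sigma>\<^sup>2 \<le> \<xi>\<^sup>2" using \<sigma> by (intro power_mono) auto
  define \<nu> where "\<nu> = real n ^ 3 * \<theta>"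
  have \<nu>: "0 \<le> \<nu>" using \<theta>0 by (simp add: \<nu>_def)
  have small': "1000 * (\<nu> * \<xi>\<^sup>2) \<le> \<eta> * \<sigma>\<^sup>2" using small by (simp add: \<nu>_def n_def \<xi>_def)
  \<comment> \<open>As \<sigma> <= \<xi>, smallness relative to the condition number includes
    absolute smallness of \<nu>; the second pass, whose bounds no longer see X, needs the
    latter.\<close>
  have "1000 * (\<nu> * \<sigma>\<^sup>2) \<le> 1000 * (\<nu> * \<xi>\<^sup>2)" using \<sigma>\<xi>2 \<nu> by (intro mult_left_mono) auto
  then have "1000 * \<nu> * \<sigma>\<^sup>2 \<le> \<eta> * \<sigma>\<^sup>2" using small' by simp
  then have \<nu>\<eta>: "1000 * \<nu> \<le> \<eta>" using \<sigma> by simp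
  have "\<theta> \<le> \<nu>" using mult_right_mono[OF n3 \<theta>0] by (simp add: \<nu>_def)
  then have \<theta>1: "\<theta> \<le> 1" using \<nu>\<eta> \<eta> \<nu> by linarith
  obtain U S T where pip1: "fl_bcgs_pip \<epsilon> IO s p X U S" and pip2: "fl_bcgs_pip \<epsilon> IO s p U Q T"
    and R: "fl_mult \<epsilon> T S R"
    using pip unfolding fl_bcgs_pip_plus_def by blast
  have U: "U \<in> carrier_mat m n" and S: "S \<in> carrier_mat n n"
    using fl_bcgs_pip_carrier[OF pip1] X by (simp_all add: n_def)
  have Q: "Q \<in> carrier_mat m n" and T: "T \<in> carrier_mat n n"
    using fl_bcgs_pip_carrier[OF pip2] U by (simp_all add: n_def)
  have condX: "cond2 (sub_mat X 0 0 m s) \<le> max (cond2 X) (ereal \<tau>)"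
  proof -
    have "cond2 (sub_mat X 0 0 m s) \<le> ereal (\<xi> / \<sigma>)"
    proof (rule cond2_le[OF sub_mat_carrier s \<sigma>])
      show "\<sigma> * nrm s v \<le> nrm m (mv s (ent (sub_mat X 0 0 m s)) v)"
        "nrm m (mv s (ent (sub_mat X 0 0 m s)) v) \<le> \<xi> * nrm s v" for v
        unfolding mv_sub_mat_first[OF n(2)] nrm_restrict[OF n(2), symmetric] by (rule low, rule up)
    qed
    then show ?thesis using cond unfolding \<xi>_def by (meson max.coboundedI1 order_trans)
  qed
  have "60 * (\<nu> * \<xi>\<^sup>2) \<le> \<sigma>\<^sup>2"
  proof -
    have "\<eta> * \<sigma>\<^sup>2 \<le> 1 * \<sigma>\<^sup>2" using \<eta> by (intro mult_right_mono) auto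
    moreover have "0 \<le> \<nu> * \<xi>\<^sup>2" using \<nu> by simp
    ultimately show ?thesis using small' by linarith
  qed
  then have sm1: "60 * real (p * s) ^ 3 * \<theta> * \<xi>\<^sup>2 \<le> \<sigma>\<^sup>2" by (simp add: \<nu>_def n_def mult_ac)
  have P1: "perturbed_gram_schmidt (ent X) (ent U) (ent S) m n s \<theta> \<sigma> \<xi>"
    unfolding n_def using fl_bcgs_pip_perturbed[OF pip1 X[unfolded n_def] s p large io condX \<theta> \<theta>1 \<sigma>
        low[unfolded n_def] up[unfolded n_def] sm1] .
  interpret P1: perturbed_gram_schmidt "ent X" "ent U" "ent S" m n s \<theta> \<sigma> \<xi> by (rule P1)
  have "48 * (\<nu> * \<xi>\<^sup>2) \<le> \<eta> * \<sigma>\<^sup>2" using small' \<nu> mult_nonneg_nonneg[OF \<nu> zero_le_power2[of \<xi>]] by linarith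
  then have \<eta>_bound: "48 * real n ^ 3 * \<theta> * \<xi>\<^sup>2 / \<sigma>\<^sup>2 \<le> \<eta>"
    using \<sigma> by (simp add: \<nu>_def pos_divide_le_eq mult_ac)
  have orthU: "\<bar>(nrm m (mv n (ent U) w))\<^sup>2 - (nrm n w)\<^sup>2\<bar> \<le> \<eta> * (nrm n w)\<^sup>2" for w
    by (rule order_trans[OF P1.Q_orthogonality mult_right_mono[OF \<eta>_bound]]) simp
  have lowU: "sqrt (1 - \<eta>) * nrm n w \<le> nrm m (mv n (ent U) w)" for w
  proof (rule power2_le_imp_le)
    show "(sqrt (1 - \<eta>) * nrm n w)\<^sup>2 \<le> (nrm m (mv n (ent U) w))\<^sup>2"
      using orthU[of w] \<eta> by (simp add: power_mult_distrib left_diff_distrib)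
  qed simp
  have upU: "nrm m (mv n (ent U) w) \<le> sqrt (1 + \<eta>) * nrm n w" for w
  proof (rule power2_le_imp_le)
    show "(nrm m (mv n (ent U) w))\<^sup>2 \<le> (sqrt (1 + \<eta>) * nrm n w)\<^sup>2"
      using orthU[of w] \<eta> by (simp add: power_mult_distrib distrib_right)
  qed (use \<eta> in simp)
  have condU: "cond2 (sub_mat U 0 0 m s) \<le> max (cond2 X) (ereal \<tau>)"
  proof -
    have "cond2 (sub_mat U 0 0 m s) \<le> ereal (sqrt (1 + \<eta>) / sqrt (1 - \<eta>))"
    proof (rule cond2_le[OF sub_mat_carrier s])
      show "0 < sqrt (1 - \<eta>)" using \<eta> by simp
      show "sqrt (1 - \<eta>) * nrm s v \<le> nrm m (mv s (ent (sub_mat U 0 0 m s)) v)"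
        "nrm m (mv s (ent (sub_mat U 0 0 m s)) v) \<le> sqrt (1 + \<eta>) * nrm s v" for v
        unfolding mv_sub_mat_first[OF n(2)] nrm_restrict[OF n(2), symmetric] by (rule lowU, rule upU)
    qed
    also have "sqrt (1 + \<eta>) / sqrt (1 - \<eta>) \<le> \<tau>"
    proof -
      have "sqrt (1 + \<eta>) \<le> sqrt (\<tau>\<^sup>2 * (1 - \<eta>))" using \<eta>(3) by (rule real_sqrt_le_mono)
      also have "\<dots> = \<tau> * sqrt (1 - \<eta>)" using \<tau> by (simp add: real_sqrt_mult)
      finally show ?thesis using \<eta> by (simp add: pos_divide_le_eq)
    qed
    finally show ?thesis by (simp add: max.coboundedI2)
  qed
  \<comment> \<open>For the second pass the bounds on U are replaced by the fixed numbers 1/2 and 2;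
    the upper one is already available from the first pass.\<close>
  have lowU2: "1/2 * nrm n w \<le> nrm m (mv n (ent U) w)" for w
  proof -
    have "1/2 \<le> sqrt (1 - \<eta>)" using \<eta> by (intro real_le_rsqrt) (simp add: power2_eq_square)
    then have "1/2 * nrm n w \<le> sqrt (1 - \<eta>) * nrm n w" by (intro mult_right_mono) auto
    then show ?thesis using lowU[of w] by linarith
  qed
  have "60 * \<nu> * 4 \<le> 1/4" using \<nu>\<eta> \<eta> \<nu> by linarith
  then have sm2: "60 * real (p * s) ^ 3 * \<theta> * 2\<^sup>2 \<le> (1/2)\<^sup>2"
    by (simp add: \<nu>_def n_def power2_eq_square mult_ac)
  have P2: "perturbed_gram_schmidt (ent U) (ent Q) (ent T) m n s \<theta> (1/2) 2"
    unfolding n_def using fl_bcgs_pip_perturbed[OF pip2 U[unfolded n_def] s p large io condU \<theta> \<theta>1 _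
        lowU2[unfolded n_def] P1.Q_norm[unfolded n_def] sm2] by simp
  interpret P2: perturbed_gram_schmidt "ent U" "ent Q" "ent T" m n s \<theta> "1/2" 2 by (rule P2)
  \<comment> \<open>The factor 48 times \<xi>^2 / \<sigma>^2 with \<xi> = 2 and \<sigma> = 1/2, that
    is 48 times 16.\<close>
  define c where "c = 768 * real n ^ 3 * \<theta>"
  have c0: "0 \<le> c" using \<theta>0 by (simp add: c_def)
  have "48 * real n ^ 3 * \<theta> * 2\<^sup>2 / (1/2)\<^sup>2 = c" by (simp add: c_def power2_eq_square)
  then have orthQ: "\<bar>(nrm m (mv n (ent Q) w))\<^sup>2 - (nrm n w)\<^sup>2\<bar> \<le> c * (nrm n w)\<^sup>2" for w
    using P2.Q_orthogonality[of w] by simp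
  define G where "G = 1\<^sub>m n - transpose_mat Q * Q"
  have G: "G \<in> carrier_mat n n" using Q by (simp add: G_def minus_carrier_mat)
  have Gij: "\<bar>G $$ (i, j)\<bar> \<le> 2 * c" if "i < n" "j < n" for i j
  proof -
    have "G $$ (i, j) = (if i = j then 1 else 0) - (\<Sum>a<m. Q $$ (a, i) * Q $$ (a, j))"
      unfolding G_def gram_entry[OF Q that, symmetric] using Q that by simp
    then show ?thesis using orthogonality_entry[OF orthQ that] by simp
  qed
  have "spectral_norm G \<le> real n * (real n * (2 * c))"
  proof (rule spectral_norm_le_columns[OF G n(1)])
    fix j assume j: "j < n"
    have "nrm n (\<lambda>i. G $$ (i, j)) \<le> (\<Sum>i<n. \<bar>G $$ (i, j)\<bar>)" by (rule L2_set_le_sum_abs)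
    also have "\<dots> \<le> (\<Sum>i<n. 2 * c)" using Gij j by (intro sum_mono) auto
    finally show "nrm n (\<lambda>i. G $$ (i, j)) \<le> real n * (2 * c)" by simp
  qed
  \<comment> \<open>Entries of I - Q^T Q are at most 2 c, and passing from entries to columns and
    from columns to the spectral norm costs n each time.\<close>
  also have "\<dots> = 1536 * real n ^ 5 * \<theta>" by (simp add: c_def power_numeral_reduce)
  finally show "spectral_norm (1\<^sub>m (p * s) - transpose_mat Q * Q) \<le> 1536 * real (p * s) ^ 5 * \<theta>"
    by (simp add: G_def n_def)
  have Rc: "R \<in> carrier_mat n n" using R T S by (simp add: fl_mult_def)
  define dD where "dD = Q * R - X"
  have dD: "dD \<in> carrier_mat m n" using X by (simp add: dD_def minus_carrier_mat)
  have QR: "Q * R = X + dD" using Q Rc X unfolding dD_def by (intro eq_matI) auto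
  have "spectral_norm dD \<le> real n * (41 * real n ^ 2 * \<theta> * \<xi>)"
  proof (rule spectral_norm_le_columns[OF dD n(1)])
    fix j assume j: "j < n"
    have "dD $$ (a, j) = (\<Sum>i<n. Q $$ (a, i) * R $$ (i, j)) - X $$ (a, j)" if "a < m" for a
      unfolding dD_def using Q Rc X that j by (simp add: scalar_prod_def lessThan_atLeast0)
    then have "nrm m (\<lambda>a. dD $$ (a, j)) = nrm m (\<lambda>a. (\<Sum>i<n. Q $$ (a, i) * R $$ (i, j)) - X $$ (a, j))"
      by (intro L2_set_cong) auto
    also have "\<dots> \<le> 41 * real n ^ 2 * \<theta> * \<xi>"
      by (rule two_pass_residual[OF P1 P2 T S R _ \<gamma>\<theta> j]) (use large n_def in simp)
    finally show "nrm m (\<lambda>a. dD $$ (a, j)) \<le> 41 * real n ^ 2 * \<theta> * \<xi>" .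
  qed
  also have "\<dots> = 41 * real n ^ 3 * \<theta> * \<xi>" by (simp add: power_numeral_reduce)
  finally show "\<exists>dD\<in>carrier_mat m (p * s). Q * R = X + dD \<and>
      spectral_norm dD \<le> 41 * real (p * s) ^ 3 * \<theta> * spectral_norm X"
    using dD QR unfolding n_def \<xi>_def by blast
qed

end

section \<open>Choice of the final polynomials\<close>

lemma dim_poly_nonneg: "dim_poly d f \<Longrightarrow> 0 \<le> f m n"
  unfolding dim_poly_def by (auto intro!: sum_nonneg)

text \<open>A positive multiple of infinity cannot be at most 1/2, so X has full column rank.
  Bounding the condition number below by |X| / \<sigma> then rewrites the hypothesis as an
  inequality between |X|^2 and \<sigma>^2.\<close>

lemma cond2_bounded:
  assumes X: "X \<in> carrier_mat m n" and n: "0 < n" and c: "0 < c"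
    and small: "ereal c * (cond2 X)\<^sup>2 \<le> ereal (1/2)"
  obtains \<sigma> where "0 < \<sigma>" "\<And>v. \<sigma> * nrm n v \<le> nrm m (mv n (ent X) v)"
    "ereal (spectral_norm X / \<sigma>) \<le> cond2 X" "2 * c * (spectral_norm X)\<^sup>2 \<le> \<sigma>\<^sup>2"
proof -
  have "cond2 X \<noteq> \<infinity>" using small c by (auto simp: power2_eq_square)
  then obtain \<sigma> where \<sigma>: "0 < \<sigma>" "\<And>v. \<sigma> * nrm n v \<le> nrm m (mv n (ent X) v)"
    "ereal (spectral_norm X / \<sigma>) \<le> cond2 X"
    using cond2_finite[OF X n] by blast
  obtain \<kappa> where \<kappa>: "cond2 X = ereal \<kappa>"
    using \<sigma>(3) \<open>cond2 X \<noteq> \<infinity>\<close> by (cases "cond2 X") auto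
  have "0 \<le> spectral_norm X / \<sigma>" using spectral_norm_nonneg[OF X n] \<sigma>(1) by simp
  then have "(spectral_norm X / \<sigma>)\<^sup>2 \<le> \<kappa>\<^sup>2" using \<sigma>(3) \<kappa> by (intro power_mono) auto
  then have "c * (spectral_norm X / \<sigma>)\<^sup>2 \<le> c * \<kappa>\<^sup>2" using c by simp
  also have "\<dots> \<le> 1/2" using small \<kappa> by (simp add: power2_eq_square)
  finally have "2 * c * (spectral_norm X)\<^sup>2 \<le> \<sigma>\<^sup>2"
    using \<sigma>(1) by (simp add: power_divide field_simps)
  with \<sigma> show thesis using that by blast
qed

theorem corollary1:
  shows "\<exists>D::nat. \<forall>(d::nat) (\<tau>::real) cE cD.
    1 < \<tau> \<longrightarrow> dim_poly d cE \<longrightarrow> dim_poly d cD \<longrightarrow>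
    (\<exists>c0 c1 c2. dim_poly (d + D) c0 \<and> dim_poly (d + D) c1 \<and> dim_poly (d + D) c2 \<and>
      (\<forall>(m::nat) (s::nat) (p::nat) (\<epsilon>::real) (IO :: real mat \<Rightarrow> real mat \<times> real mat) X Q R.
        0 < s \<longrightarrow> 0 < p \<longrightarrow> 0 < \<epsilon> \<longrightarrow> \<epsilon> < 1 \<longrightarrow> X \<in> carrier_mat m (p * s) \<longrightarrow>
        ereal (c0 m (p * s) * \<epsilon>) * (cond2 X)\<^sup>2 \<le> ereal (1/2) \<longrightarrow>
        io_accurate m s (max (cond2 X) (ereal \<tau>)) (cE m (p * s) * \<epsilon>) (cD m (p * s) * \<epsilon>) IO \<longrightarrow>
        fl_bcgs_pip_plus \<epsilon> IO s p X Q R \<longrightarrow>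
          spectral_norm (1\<^sub>m (p * s) - transpose_mat Q * Q) \<le> c1 m (p * s) * \<epsilon> \<and>
          (\<exists>dD\<in>carrier_mat m (p * s). Q * R = X + dD \<and>
             spectral_norm dD \<le> c2 m (p * s) * \<epsilon> * spectral_norm X)))"
proof (intro exI[of _ 7] allI impI)
  fix d :: nat and \<tau> :: real and cE cD
  assume \<tau>: "1 < \<tau>" and cE: "dim_poly d cE" and cD: "dim_poly d cD"
  define g where "g m n = 1 + cE m n + cD m n" for m n
  \<comment> \<open>\<open>B k\<close> has degree d + 1 + k. \<open>B 1\<close> dominates the
    constants of the routine and, up to a factor, the number of roundings; the powers n^3 and n^5 in
    the accuracy bounds lead to \<open>B 4\<close> and \<open>B 6\<close>, hence to degree d +
    7.\<close>
  define B where "B k m n = (real n + 1) ^ k * ((real m + 1) * g m n)" for k m n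
  \<comment> \<open>The second argument of \<open>min\<close> is the solution of 1 + \<eta> =
    \<tau>^2 (1 - \<eta>). It is positive because \<tau> > 1.\<close>
  define \<eta> where "\<eta> = min (1/2) ((\<tau>\<^sup>2 - 1) / (\<tau>\<^sup>2 + 1))"
  have "1 < \<tau>\<^sup>2" using \<tau> by (rule one_less_power) simp
  then have "0 < (\<tau>\<^sup>2 - 1) / (\<tau>\<^sup>2 + 1)" by (intro divide_pos_pos) linarith+
  then have "0 < \<eta>" by (simp add: \<eta>_def)
  moreover have "\<eta> \<le> 1/2" unfolding \<eta>_def by (rule min.cobounded1)
  ultimately have \<eta>: "0 < \<eta>" "\<eta> \<le> 1/2" by blast+
  have "0 < \<tau>\<^sup>2 + 1" by (simp add: add_nonneg_pos)
  moreover have "\<eta> \<le> (\<tau>\<^sup>2 - 1) / (\<tau>\<^sup>2 + 1)" unfolding \<eta>_def by (rule min.cobounded2)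
  ultimately have "\<eta> * (\<tau>\<^sup>2 + 1) \<le> \<tau>\<^sup>2 - 1" by (simp add: pos_le_divide_eq)
  then have \<eta>\<tau>: "1 + \<eta> \<le> \<tau>\<^sup>2 * (1 - \<eta>)" by (simp add: algebra_simps)
  have B: "dim_poly (d + 7) (B k)" if "k \<le> 6" for k
  proof -
    have "dim_poly d g"
      unfolding g_def using cE cD by (intro dim_poly_add dim_poly_const) auto
    from dim_poly_mult_cols_power[OF dim_poly_mult_rows[OF this], of k]
    show ?thesis unfolding B_def by (rule dim_poly_mono) (use that in simp)
  qed
  show "\<exists>c0 c1 c2. dim_poly (d + 7) c0 \<and> dim_poly (d + 7) c1 \<and> dim_poly (d + 7) c2 \<and>
      (\<forall>(m::nat) (s::nat) (p::nat) (\<epsilon>::real) (IO :: real mat \<Rightarrow> real mat \<times> real mat) X Q R.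
        0 < s \<longrightarrow> 0 < p \<longrightarrow> 0 < \<epsilon> \<longrightarrow> \<epsilon> < 1 \<longrightarrow> X \<in> carrier_mat m (p * s) \<longrightarrow>
        ereal (c0 m (p * s) * \<epsilon>) * (cond2 X)\<^sup>2 \<le> ereal (1/2) \<longrightarrow>
        io_accurate m s (max (cond2 X) (ereal \<tau>)) (cE m (p * s) * \<epsilon>) (cD m (p * s) * \<epsilon>) IO \<longrightarrow>
        fl_bcgs_pip_plus \<epsilon> IO s p X Q R \<longrightarrow>
          spectral_norm (1\<^sub>m (p * s) - transpose_mat Q * Q) \<le> c1 m (p * s) * \<epsilon> \<and>
          (\<exists>dD\<in>carrier_mat m (p * s). Q * R = X + dD \<and>
             spectral_norm dD \<le> c2 m (p * s) * \<epsilon> * spectral_norm X))"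
  \<comment> \<open>All three constants contain the 300 of \<theta> below: 2 * 150000 = 1000 * 300,
    460800 = 1536 * 300 and 12300 = 41 * 300. The division by \<eta> is how \<tau> enters the
    smallness condition.\<close>
  proof (rule exI[of _ "\<lambda>m n. 150000 / \<eta> * B 4 m n"], rule exI[of _ "\<lambda>m n. 460800 * B 6 m n"],
      rule exI[of _ "\<lambda>m n. 12300 * B 4 m n"], intro conjI allI impI)
    fix m s p :: nat and \<epsilon> :: real and IO :: "real mat \<Rightarrow> real mat \<times> real mat" and X Q R
    assume s: "0 < s" and p: "0 < p" and \<epsilon>: "0 < \<epsilon>" "\<epsilon> < 1" and X: "X \<in> carrier_mat m (p * s)"
      and cond: "ereal (150000 / \<eta> * B 4 m (p * s) * \<epsilon>) * (cond2 X)\<^sup>2 \<le> ereal (1/2)"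
      and io: "io_accurate m s (max (cond2 X) (ereal \<tau>)) (cE m (p * s) * \<epsilon>) (cD m (p * s) * \<epsilon>) IO"
      and pip: "fl_bcgs_pip_plus \<epsilon> IO s p X Q R"
    define n where "n = p * s"
    define N where "N = m + n + 2"
    define \<gamma> where "\<gamma> = 2 * real N * \<epsilon>"
    \<comment> \<open>72 \<gamma> equals 144 N \<epsilon>, and N = m + n + 2 is at most 2 (m + 1) (n
      + 1), so any factor from 288 on would do.\<close>
    define \<theta> where "\<theta> = 300 * B 1 m n * \<epsilon>"
    have n: "0 < n" using s p by (simp add: n_def)
    have nn: "0 \<le> cE m n" "0 \<le> cD m n" using cE cD by (simp_all add: dim_poly_nonneg)
    have g: "1 \<le> g m n" "cE m n \<le> g m n" "cD m n \<le> g m n" using nn by (simp_all add: g_def)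
    have mn: "1 \<le> (real n + 1) * (real m + 1)" by (simp add: algebra_simps)
    have B1: "B 1 m n = (real n + 1) * (real m + 1) * g m n" by (simp add: B_def)
    have B_pos: "0 < B k m n" for k
      unfolding B_def using g(1) by (intro mult_pos_pos zero_less_power) auto
    have Bk: "B (k + 1) m n = (real n + 1) ^ k * B 1 m n" for k by (simp add: B_def)
    have gB: "g m n \<le> B 1 m n" unfolding B1 using mult_right_mono[OF mn, of "g m n"] g(1) by simp
    have \<theta>0: "0 < \<theta>" using B_pos \<epsilon> by (simp add: \<theta>_def)
    have bE: "cE m n * \<epsilon> \<le> \<theta>" and bD: "cD m n * \<epsilon> \<le> \<theta>"
      unfolding \<theta>_def using g gB B_pos[of 1] \<epsilon> by (intro mult_right_mono; simp)+
    have "144 * real N \<le> 300 * ((real n + 1) * (real m + 1))"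
      unfolding N_def using mult_nonneg_nonneg[of "real n" "real m"] by (simp add: algebra_simps)
    also have "\<dots> \<le> 300 * B 1 m n"
      unfolding B1 using mult_left_mono[OF g(1), of "(real n + 1) * (real m + 1)"] by simp
    finally have "144 * real N * \<epsilon> \<le> 300 * B 1 m n * \<epsilon>" using \<epsilon> by (intro mult_right_mono) auto
    then have \<gamma>\<theta>: "72 * \<gamma> \<le> \<theta>" by (simp add: \<gamma>_def \<theta>_def)
    have "0 < 150000 / \<eta> * B 4 m (p * s) * \<epsilon>" using \<eta> B_pos[of 4] \<epsilon> by (simp add: n_def)
    then obtain \<sigma> where \<sigma>: "0 < \<sigma>" "\<And>v. \<sigma> * nrm (p * s) v \<le> nrm m (mv (p * s) (ent X) v)"
      "ereal (spectral_norm X / \<sigma>) \<le> cond2 X"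
      "2 * (150000 / \<eta> * B 4 m (p * s) * \<epsilon>) * (spectral_norm X)\<^sup>2 \<le> \<sigma>\<^sup>2"
      using cond2_bounded[OF X _ _ cond] n unfolding n_def by blast
    have B4: "300 * B 4 m n * \<epsilon> = (real n + 1) ^ 3 * \<theta>"
      using Bk[of 3] by (simp add: \<theta>_def)
    have "1000 * ((real n + 1) ^ 3 * \<theta> * (spectral_norm X)\<^sup>2) \<le> \<eta> * \<sigma>\<^sup>2"
      using mult_left_mono[OF \<sigma>(4), of \<eta>] \<eta> unfolding B4[symmetric] by (simp add: n_def)
    moreover have "real n ^ 3 * \<theta> * (spectral_norm X)\<^sup>2 \<le> (real n + 1) ^ 3 * \<theta> * (spectral_norm X)\<^sup>2"
      using \<theta>0 by (intro mult_right_mono power_mono) auto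
    ultimately have small: "1000 * (real n ^ 3 * \<theta> * (spectral_norm X)\<^sup>2) \<le> \<eta> * \<sigma>\<^sup>2" by linarith
    \<comment> \<open>The condition number is at least 1, so the hypothesis on X bounds \<theta>
      itself. With 72 \<gamma> <= \<theta> this yields the bound 1/100 on \<gamma> and N \<epsilon>
      <= 1, with no separate smallness assumption on \<epsilon>.\<close>
    have "\<theta> \<le> 1/2"
    proof -
      have "\<sigma> \<le> spectral_norm X"
        using \<sigma>(2)[of "\<lambda>i. if i = 0 then 1 else 0"] spectral_norm_ge[OF X, of "\<lambda>i. if i = 0 then 1 else 0"]
          nrm_unit[OF n] by (simp add: n_def)
      then have "\<sigma>\<^sup>2 \<le> (spectral_norm X)\<^sup>2" using \<sigma>(1) by (intro power_mono) auto
      moreover have "1 \<le> real n ^ 3" using n by (intro one_le_power) simp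
      ultimately have "(1 * \<theta>) * \<sigma>\<^sup>2 \<le> (real n ^ 3 * \<theta>) * (spectral_norm X)\<^sup>2"
        using \<theta>0 by (intro mult_mono mult_right_mono) auto
      moreover have "\<eta> * \<sigma>\<^sup>2 \<le> 1/2 * \<sigma>\<^sup>2" using \<eta> by (intro mult_right_mono) auto
      ultimately have "1000 * \<theta> * \<sigma>\<^sup>2 \<le> 1/2 * \<sigma>\<^sup>2" using small by linarith
      then have "1000 * \<theta> \<le> 1/2" using \<sigma>(1) by (simp add: mult_le_cancel_right)
      then show ?thesis using \<theta>0 by linarith
    qed
    then have \<gamma>1: "\<gamma> \<le> 1/100" using \<gamma>\<theta> by linarith
    interpret rounding \<epsilon> \<gamma> N
    proof
      show "(1 + \<epsilon>) ^ N - 1 \<le> \<gamma>" unfolding \<gamma>_def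
        using \<epsilon> \<gamma>1 by (intro one_plus_power_le) (auto simp: \<gamma>_def)
    qed (use \<epsilon> \<gamma>1 in \<open>simp_all add: N_def\<close>)
    have large: "m + p * s + 1 < N" and \<tau>0: "0 < \<tau>" using \<tau> by (simp_all add: N_def n_def)
    note acc = fl_bcgs_pip_plus_accuracy[OF pip X s p large io bE[unfolded n_def] bD[unfolded n_def]
        \<gamma>\<theta> \<eta> \<eta>\<tau> \<tau>0 \<sigma>(1,2,3) small[unfolded n_def]]
    have "1536 * real n ^ 5 * \<theta> \<le> 1536 * (real n + 1) ^ 5 * \<theta>"
      using \<theta>0 by (intro mult_right_mono mult_left_mono power_mono) auto
    also have "\<dots> = 460800 * B 6 m n * \<epsilon>" using Bk[of 5] by (simp add: \<theta>_def)
    finally show "spectral_norm (1\<^sub>m (p * s) - transpose_mat Q * Q) \<le> 460800 * B 6 m (p * s) * \<epsilon>"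
      using acc(1) unfolding n_def by linarith
    have "41 * real n ^ 3 * \<theta> * spectral_norm X \<le> 41 * (real n + 1) ^ 3 * \<theta> * spectral_norm X"
      using \<theta>0 spectral_norm_nonneg[OF X] n
      by (intro mult_right_mono mult_left_mono power_mono) (auto simp: n_def)
    also have "41 * (real n + 1) ^ 3 * \<theta> = 12300 * B 4 m n * \<epsilon>" using Bk[of 3] by (simp add: \<theta>_def)
    finally have "41 * real (p * s) ^ 3 * \<theta> * spectral_norm X \<le> 12300 * B 4 m (p * s) * \<epsilon> * spectral_norm X"
      unfolding n_def .
    moreover obtain dD where "dD \<in> carrier_mat m (p * s)" "Q * R = X + dD"
      "spectral_norm dD \<le> 41 * real (p * s) ^ 3 * \<theta> * spectral_norm X"
      using acc(2) by blast
    ultimately show "\<exists>dD\<in>carrier_mat m (p * s). Q * R = X + dD \<and>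
        spectral_norm dD \<le> 12300 * B 4 m (p * s) * \<epsilon> * spectral_norm X"
      by (meson order_trans)
  qed (rule dim_poly_scale, rule B, simp, use \<eta> in simp)+
qed

end
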